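(* Let $b=0$ and $K(s)=re^{-rs}$ for $s\ge0$, with $r>0$. If $a<0$ and $$a_1>0,\qquad a_3>0,\qquad a_1a_2-a_3>0,$$ where $$\begin{aligned}a_1&=3(r-a)-\sigma_1^2,\\ a_2&=2r(r-a)-(2a+\sigma_1^2)(3r-a)-2r\sigma_1\sigma_2,\\ a_3&=-2ar\big(2(r-a)-\sigma_1^2\big)-2r^2(\sigma_1+\sigma_2)^2,\end{aligned}$$ then the second moment of the solution of the stochastic equation (S) is bounded.
   Context: Let $a,b,\sigma_0,\sigma_1,\sigma_2\in\mathbb{R}$ be constants. $BC((-\infty,0],\mathbb{R})$ is the space of bounded continuous functions $\phi:(-\infty,0]\to\mathbb{R}$ with norm $\|\phi\|=\sup_{\theta\le 0}|\phi(\theta)|$; it is the space of initial functions. The stochastic equation (S), in the Itô sense, with delay kernel $K$ and $W_t$ a one-dimensional Wiener process, is $$dx(t)=\Big(ax(t)+b\int_0^{+\infty}K(s)x(t-s)\,ds\Big)dt+\Big(\sigma_0+\sigma_1x(t)+\sigma_2\int_0^{+\infty}K(s)x(t-s)\,ds\Big)dW_t .$$ $x(t;\phi)$ denotes its solution with initial function $\phi\in BC((-\infty,0],\mathbb{R})$, and $E$ denotes expectation. The second moment of $x(t;\phi)$ is $M(t)=E\big(|x(t;\phi)-E(x(t;\phi))|^2\big)$. The second moment of the solution of (S) is said to be bounded if there is a positive constant $\tilde R=\tilde R(\|\phi\|^2)$ such that $M(t)\le\tilde R$ for all $t\ge0$, for all $\phi\in BC((-\infty,0],\mathbb{R})$.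 *)

theory Defs
  imports "HOL-Probability.Probability"
begin

section \<open>Wiener processes\<close>

text \<open>
  Time is indexed by the type of reals in order to use the library locale \<^locale>\<open>filtration\<close>; only
  the times \<open>t \<ge> 0\<close> matter (every filtration on \<open>[0, \<infinity>)\<close> extends to negative times by
  \<open>F t = F 0\<close>). The filtration need not satisfy the usual conditions.
\<close>

locale wiener_process = prob_space M + filtration "space M" F
  for M :: "'w measure" and F :: "real \<Rightarrow> 'w measure" +
  fixes W :: "real \<Rightarrow> 'w \<Rightarrow> real"
  assumes subalgebra_F: "\<And>t. subalgebra M (F t)"
    and adapted_W: "\<And>t. 0 \<le> t \<Longrightarrow> W t \<in> borel_measurable (F t)"
    and W_zero: "AE \<omega> in M. W 0 \<omega> = 0"
    and W_continuous: "AE \<omega> in M. continuous_on {0..} (\<lambda>t. W t \<omega>)"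
    and W_increment: "\<And>s t. 0 \<le> s \<Longrightarrow> s < t \<Longrightarrow>
      distributed M lborel (\<lambda>\<omega>. W t \<omega> - W s \<omega>) (\<lambda>y. ennreal (normal_density 0 (sqrt (t - s)) y))"
    and W_indep: "\<And>s t. 0 \<le> s \<Longrightarrow> s < t \<Longrightarrow>
      indep_set (sets (F s)) {(\<lambda>\<omega>. W t \<omega> - W s \<omega>) -` B \<inter> space M |B. B \<in> sets borel}"

section \<open>The It\^o integral\<close>

text \<open>
  A simple process on \<open>[0, t]\<close> is \<open>\<Sum>i<n. \<xi> i \<cdot> 1\<^bsub>(p i, p (i+1)]\<^esub>\<close> for a partition
  \<open>0 = p 0 \<le> \<dots> \<le> p n = t\<close> and bounded \<open>\<xi> i\<close> measurable with respect to \<open>F (p i)\<close>.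
\<close>

definition simple_process ::
  "'w measure \<Rightarrow> (real \<Rightarrow> 'w measure) \<Rightarrow> real \<Rightarrow> nat \<Rightarrow> (nat \<Rightarrow> real) \<Rightarrow> (nat \<Rightarrow> 'w \<Rightarrow> real) \<Rightarrow> bool"
where
  "simple_process M F t n p \<xi> \<longleftrightarrow>
     p 0 = 0 \<and> p n = t \<and> (\<forall>i<n. p i \<le> p (Suc i)) \<and>
     (\<forall>i<n. \<xi> i \<in> borel_measurable (F (p i)) \<and> (\<exists>C. \<forall>\<omega>\<in>space M. \<bar>\<xi> i \<omega>\<bar> \<le> C))"

definition simple_value ::
  "nat \<Rightarrow> (nat \<Rightarrow> real) \<Rightarrow> (nat \<Rightarrow> 'w \<Rightarrow> real) \<Rightarrow> real \<Rightarrow> 'w \<Rightarrow> real"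
where
  "simple_value n p \<xi> s \<omega> = (\<Sum>i<n. \<xi> i \<omega> * indicator {p i<..p (Suc i)} s)"

definition simple_integral_W ::
  "(real \<Rightarrow> 'w \<Rightarrow> real) \<Rightarrow> nat \<Rightarrow> (nat \<Rightarrow> real) \<Rightarrow> (nat \<Rightarrow> 'w \<Rightarrow> real) \<Rightarrow> 'w \<Rightarrow> real"
where
  "simple_integral_W W n p \<xi> \<omega> = (\<Sum>i<n. \<xi> i \<omega> * (W (p (Suc i)) \<omega> - W (p i) \<omega>))"

definition tendsto_in_prob :: "'w measure \<Rightarrow> (nat \<Rightarrow> 'w \<Rightarrow> real) \<Rightarrow> ('w \<Rightarrow> real) \<Rightarrow> bool"
where
  "tendsto_in_prob M X Y \<longleftrightarrow>
     (\<forall>\<epsilon>>0. (\<lambda>k. measure M {\<omega> \<in> space M. \<bar>X k \<omega> - Y \<omega>\<bar> > \<epsilon>}) \<longlonglongrightarrow> 0)"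

definition progressively_measurable ::
  "(real \<Rightarrow> 'w measure) \<Rightarrow> real \<Rightarrow> (real \<Rightarrow> 'w \<Rightarrow> real) \<Rightarrow> bool"
where
  "progressively_measurable F t H \<longleftrightarrow>
     (\<forall>u\<in>{0..t}. (\<lambda>(s, \<omega>). H s \<omega>) \<in> borel_measurable (restrict_space borel {0..u} \<Otimes>\<^sub>M F u))"

text \<open>
  \<open>I\<close> is (a version of) the It\^o integral \<open>\<integral>\<^sub>0\<^sup>t H s dW s\<close>. This is the integral for progressively
  measurable integrands that are almost surely square integrable on \<open>[0, t]\<close>: the limit in
  probability of integrals of simple processes \<open>H\<^sub>k\<close> with \<open>\<integral>\<^sub>0\<^sup>t (H\<^sub>k s - H s)\<^sup>2 ds \<rightarrow> 0\<close> in
  probability. It is unique up to almost sure equality. The inner integrals are taken in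
  \<open>[0, \<infinity>]\<close>, so no integrability is presupposed.
\<close>

definition has_ito_integral ::
  "'w measure \<Rightarrow> (real \<Rightarrow> 'w measure) \<Rightarrow> (real \<Rightarrow> 'w \<Rightarrow> real) \<Rightarrow> (real \<Rightarrow> 'w \<Rightarrow> real) \<Rightarrow> real \<Rightarrow> ('w \<Rightarrow> real) \<Rightarrow> bool"
where
  "has_ito_integral M F W H t I \<longleftrightarrow>
     progressively_measurable F t H \<and>
     (AE \<omega> in M. (\<integral>\<^sup>+s\<in>{0..t}. ennreal ((H s \<omega>)\<^sup>2) \<partial>lborel) < \<infinity>) \<and>
     I \<in> borel_measurable M \<and>
     (\<exists>n p \<xi>. (\<forall>k. simple_process M F t (n k) (p k) (\<xi> k)) \<and>
        (\<forall>\<epsilon>>0. (\<lambda>k. measure M {\<omega> \<in> space M.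
             (\<integral>\<^sup>+s\<in>{0..t}. ennreal ((simple_value (n k) (p k) (\<xi> k) s \<omega> - H s \<omega>)\<^sup>2) \<partial>lborel) > ennreal \<epsilon>})
           \<longlonglongrightarrow> 0) \<and>
        tendsto_in_prob M (\<lambda>k. simple_integral_W W (n k) (p k) (\<xi> k)) I)"

section \<open>The stochastic delay equation\<close>

text \<open>
  Initial functions are represented by total functions of which only the values on \<open>(-\<infinity>, 0]\<close> matter.
\<close>

definition BC :: "(real \<Rightarrow> real) set" where
  "BC = {\<phi>. continuous_on {..0} \<phi> \<and> bounded (\<phi> ` {..0})}"

definition BC_norm :: "(real \<Rightarrow> real) \<Rightarrow> real" where
  "BC_norm \<phi> = (SUP \<theta>\<in>{..0}. \<bar>\<phi> \<theta>\<bar>)"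

definition delay_term :: "(real \<Rightarrow> real) \<Rightarrow> (real \<Rightarrow> 'w \<Rightarrow> real) \<Rightarrow> real \<Rightarrow> 'w \<Rightarrow> real" where
  "delay_term K x t \<omega> = (LINT s:{0..}|lborel. K s * x (t - s) \<omega>)"

definition drift ::
  "real \<Rightarrow> real \<Rightarrow> (real \<Rightarrow> real) \<Rightarrow> (real \<Rightarrow> 'w \<Rightarrow> real) \<Rightarrow> real \<Rightarrow> 'w \<Rightarrow> real"
where
  "drift a b K x t \<omega> = a * x t \<omega> + b * delay_term K x t \<omega>"

definition diffusion ::
  "real \<Rightarrow> real \<Rightarrow> real \<Rightarrow> (real \<Rightarrow> real) \<Rightarrow> (real \<Rightarrow> 'w \<Rightarrow> real) \<Rightarrow> real \<Rightarrow> 'w \<Rightarrow> real"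
where
  "diffusion \<sigma>\<^sub>0 \<sigma>\<^sub>1 \<sigma>\<^sub>2 K x t \<omega> = \<sigma>\<^sub>0 + \<sigma>\<^sub>1 * x t \<omega> + \<sigma>\<^sub>2 * delay_term K x t \<omega>"

text \<open>
  The two integrability conditions say that the Lebesgue integrals in the equation exist (the
  Bochner integral of the library is 0 otherwise). No moment condition is imposed on a solution.
\<close>

definition is_solution ::
  "'w measure \<Rightarrow> (real \<Rightarrow> 'w measure) \<Rightarrow> (real \<Rightarrow> 'w \<Rightarrow> real) \<Rightarrow>
   real \<Rightarrow> real \<Rightarrow> real \<Rightarrow> real \<Rightarrow> real \<Rightarrow> (real \<Rightarrow> real) \<Rightarrow>
   (real \<Rightarrow> real) \<Rightarrow> (real \<Rightarrow> 'w \<Rightarrow> real) \<Rightarrow> bool"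
where
  "is_solution M F W a b \<sigma>\<^sub>0 \<sigma>\<^sub>1 \<sigma>\<^sub>2 K \<phi> x \<longleftrightarrow>
     (\<forall>\<omega>\<in>space M. \<forall>t\<le>0. x t \<omega> = \<phi> t) \<and>
     (\<forall>\<omega>\<in>space M. continuous_on {0..} (\<lambda>t. x t \<omega>)) \<and>
     (\<forall>t\<ge>0. x t \<in> borel_measurable (F t)) \<and>
     (AE \<omega> in M. \<forall>t\<ge>0. set_integrable lborel {0..} (\<lambda>s. K s * x (t - s) \<omega>)) \<and>
     (AE \<omega> in M. \<forall>t\<ge>0. set_integrable lborel {0..t} (\<lambda>s. drift a b K x s \<omega>)) \<and>
     (\<forall>t\<ge>0. \<exists>I. has_ito_integral M F W (diffusion \<sigma>\<^sub>0 \<sigma>\<^sub>1 \<sigma>\<^sub>2 K x) t I \<and>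
        (AE \<omega> in M. x t \<omega> = \<phi> 0 + (LINT s:{0..t}|lborel. drift a b K x s \<omega>) + I \<omega>))"

section \<open>Boundedness of the second moment\<close>

text \<open>
  The outer expectation takes values in \<open>[0, \<infinity>]\<close>, so a finite bound on it asserts in particular
  that \<open>x t\<close> is square integrable: if \<open>x t\<close> is not integrable, the inner expectation is 0 by
  convention, but then the value below is \<open>\<infinity>\<close>.
\<close>

definition second_moment :: "'w measure \<Rightarrow> (real \<Rightarrow> 'w \<Rightarrow> real) \<Rightarrow> real \<Rightarrow> ennreal" where
  "second_moment M x t = (\<integral>\<^sup>+\<omega>. ennreal (\<bar>x t \<omega> - (\<integral>\<omega>'. x t \<omega>' \<partial>M)\<bar>\<^sup>2) \<partial>M)"

definition second_moment_bounded ::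
  "'w measure \<Rightarrow> (real \<Rightarrow> 'w measure) \<Rightarrow> (real \<Rightarrow> 'w \<Rightarrow> real) \<Rightarrow>
   real \<Rightarrow> real \<Rightarrow> real \<Rightarrow> real \<Rightarrow> real \<Rightarrow> (real \<Rightarrow> real) \<Rightarrow> bool"
where
  "second_moment_bounded M F W a b \<sigma>\<^sub>0 \<sigma>\<^sub>1 \<sigma>\<^sub>2 K \<longleftrightarrow>
     (\<exists>R :: real \<Rightarrow> real. (\<forall>u. 0 < R u) \<and>
        (\<forall>\<phi>\<in>BC. \<forall>x. is_solution M F W a b \<sigma>\<^sub>0 \<sigma>\<^sub>1 \<sigma>\<^sub>2 K \<phi> x \<longrightarrow>
           (\<forall>t\<ge>0. second_moment M x t \<le> ennreal (R ((BC_norm \<phi>)\<^sup>2)))))"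

end

theory Submission
  imports Defs
begin

text \<open>
  Write \<open>y\<close> for the delay term and \<open>H = \<sigma>\<^sub>0 + \<sigma>\<^sub>1 x + \<sigma>\<^sub>2 y\<close>. For the exponential kernel
  \<open>y' = r (x - y)\<close>, so \<open>(x, y)\<close> solves a linear system driven by the noise \<open>H dW\<close>, and variation of
  constants gives \<open>c\<^sub>0 + c\<^sub>1 x t + c\<^sub>2 y t = d t + \<integral> G (t - s) H s dW s\<close> with a bounded deterministic
  \<open>d\<close> and \<open>G s = c\<^sub>1 exp (a s) + c\<^sub>2 r P s\<close>, where \<open>P' = exp (a s) - r P\<close>, \<open>P 0 = 0\<close>. For
  \<open>(c\<^sub>0, c\<^sub>1, c\<^sub>2) = (\<sigma>\<^sub>0, \<sigma>\<^sub>1, \<sigma>\<^sub>2)\<close> the left-hand side is \<open>H t\<close> itself, so the It\^o isometry yields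
  the renewal inequality \<open>h t \<le> d\<^sup>2 + \<integral> G (t - s)\<^sup>2 h s ds\<close> for \<open>h t = E (H t)\<^sup>2\<close>. The energy
  \<open>\<kappa> = \<integral> G\<^sup>2\<close> satisfies \<open>a\<^sub>3 = 2 r (r - a) (- 2 a) (1 - \<kappa>)\<close>; hence \<open>\<kappa> < 1\<close> and \<open>sup h\<close> is bounded,
  and \<open>(c\<^sub>0, c\<^sub>1, c\<^sub>2) = (0, 1, 0)\<close> then bounds \<open>E (x t)\<^sup>2\<close>.

  No moments are known a priori, so \<open>H\<close> is truncated on the decreasing events that it has stayed
  below \<open>N\<close> up to time \<open>t\<close>. The isometry is applied only to truncated sums over grids; Fatou's lemma
  transfers the resulting inequality to the integral and then lets \<open>N\<close> tend to infinity, without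
  stopping times.
\<close>

section \<open>Simple integrals\<close>

text \<open>The hypotheses are the Routh-Hurwitz conditions for the homogeneous part of the linear
  system that E x^2, E (x y), E y^2 would satisfy, and \<open>a\<^sub>3\<close> is the constant
  coefficient of its characteristic polynomial. Using that system would presuppose finite moments;
  the renewal inequality survives truncation. The main obstacle is that
  \<open>has_ito_integral\<close> treats one time at a time and gives an integral up to null sets,
  as a limit along unspecified simple processes. These vary with the time and ignore the truncation.
  They are traded for left-endpoint sums of H on uniform grids, to which indicators of past events
  can be attached. The stochastic convolution is never constructed: by the equation the noise is, at
  each fixed time almost surely, the continuous path x - x 0 - a * (integral of x), and G is smooth,
  so summation by parts makes the convolution sums converge path by path. Truncation also makes the
  supremum of h finite beforehand, which permits solving S <= D + S \<kappa> for S.\<close>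

lemma (in prob_space) integrable_bounded:
  fixes X :: "'a \<Rightarrow> real"
  assumes "X \<in> borel_measurable M" "\<And>\<omega>. \<omega> \<in> space M \<Longrightarrow> \<bar>X \<omega>\<bar> \<le> C"
  shows "integrable M X"
  using assms by (intro integrable_const_bound[of _ C]) auto

section \<open>Wiener increments and the isometry for step integrands\<close>

context wiener_process
begin

lemma measurable_F_mono:
  assumes "s \<le> t" and "X \<in> borel_measurable (F s)"
  shows "X \<in> borel_measurable (F t)"
  using assms measurable_mono[of borel borel "F s" "F t"] sets_F_mono[of s t] by (auto simp: space_F)

lemma measurable_F_M:
  assumes "X \<in> borel_measurable (F s)"
  shows "X \<in> borel_measurable M"
  using assms measurable_from_subalg[OF subalgebra_F] by blast

lemma measurable_W [measurable (raw)]: "0 \<le> t \<Longrightarrow> W t \<in> borel_measurable M"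
  using adapted_W measurable_F_M by blast

lemma indep_var_increment:
  fixes X :: "'w \<Rightarrow> real"
  assumes "0 \<le> s" "s < t" and X: "X \<in> borel_measurable (F s)"
  shows "indep_var borel X borel (\<lambda>\<omega>. W t \<omega> - W s \<omega>)"
proof -
  let ?D = "\<lambda>\<omega>. W t \<omega> - W s \<omega>"
  have "?D \<in> borel_measurable M"
    using assms by (intro borel_measurable_diff measurable_W) auto
  moreover have "indep_set (sigma_sets (space M) {X -` A \<inter> space M |A. A \<in> sets borel})
      (sigma_sets (space M) {?D -` A \<inter> space M |A. A \<in> sets borel})"
  \<comment> \<open>\<open>W_indep\<close> yields independence of the preimage families; both are
    closed under intersection, so it extends to the sigma-algebras that they generate.\<close>
  proof (rule indep_set_sigma_sets)
    have sub: "{X -` A \<inter> space M |A. A \<in> sets borel} \<subseteq> sets (F s)"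
      using measurable_sets[OF X] by (auto simp: space_F)
    show "indep_set {X -` A \<inter> space M |A. A \<in> sets borel} {?D -` A \<inter> space M |A. A \<in> sets borel}"
      using W_indep[OF assms(1,2)] sub unfolding indep_sets2_eq by (meson subset_iff)
  next
    show "Int_stable {X -` A \<inter> space M |A. A \<in> sets borel}"
      by (rule Int_stableI) (smt (verit) Int_assoc Int_commute Int_left_absorb mem_Collect_eq sets.Int vimage_Int)
    show "Int_stable {?D -` A \<inter> space M |A. A \<in> sets borel}"
      by (rule Int_stableI) (smt (verit) Int_assoc Int_commute Int_left_absorb mem_Collect_eq sets.Int vimage_Int)
  qed
  ultimately show ?thesis
    using measurable_F_M[OF X] by (auto simp: indep_var_eq)
qed

lemma increment_moments:
  assumes "0 \<le> s" "s < t"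
  shows integrable_increment: "integrable M (\<lambda>\<omega>. W t \<omega> - W s \<omega>)"
    and expectation_increment: "expectation (\<lambda>\<omega>. W t \<omega> - W s \<omega>) = 0"
    and integrable_increment_square: "integrable M (\<lambda>\<omega>. (W t \<omega> - W s \<omega>)\<^sup>2)"
    and expectation_increment_square: "expectation (\<lambda>\<omega>. (W t \<omega> - W s \<omega>)\<^sup>2) = t - s"
proof -
  note D = W_increment[OF assms]
  have \<sigma>: "0 < sqrt (t - s)"
    using assms by simp
  show "integrable M (\<lambda>\<omega>. W t \<omega> - W s \<omega>)"
    using integrable_normal_moment[OF \<sigma>, of 0 1]
    by (intro distributed_integrable_var[OF D]) (auto simp: mult.commute)
  show 1: "expectation (\<lambda>\<omega>. W t \<omega> - W s \<omega>) = 0"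
    by (rule normal_distributed_expectation[OF \<sigma> D])
  show "integrable M (\<lambda>\<omega>. (W t \<omega> - W s \<omega>)\<^sup>2)"
    using integrable_normal_moment[OF \<sigma>, of 0 2]
    by (subst distributed_integrable[OF D, of "\<lambda>x. x\<^sup>2", symmetric]) auto
  show "expectation (\<lambda>\<omega>. (W t \<omega> - W s \<omega>)\<^sup>2) = t - s"
    using normal_distributed_variance[OF \<sigma> D] assms unfolding 1 by simp
qed

text \<open>The sign of \<open>p n\<close> is proved in the same induction because
  \<open>adapted_W\<close> is available only for nonnegative times.\<close>

lemma simple_integral_measurable:
  assumes "0 \<le> p 0" "\<And>i. i < n \<Longrightarrow> p i \<le> p (Suc i)"
    and "\<And>i. i < n \<Longrightarrow> \<xi> i \<in> borel_measurable (F (p i))"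
  shows "simple_integral_W W n p \<xi> \<in> borel_measurable (F (p n))" "0 \<le> p n"
  using assms
proof (induction n)
  case 0
  { case 1 then show ?case by (simp add: simple_integral_W_def[abs_def]) next case 2 then show ?case by simp }
next
  case (Suc n)
  note IH = Suc.IH[OF \<open>0 \<le> p 0\<close>]
  { case 1
    have n: "0 \<le> p n" "p n \<le> p (Suc n)"
      using IH(2) 1 by auto
    have "simple_integral_W W n p \<xi> \<in> borel_measurable (F (p (Suc n)))"
      using measurable_F_mono[OF n(2)] IH(1) 1 by auto
    moreover have "\<xi> n \<in> borel_measurable (F (p (Suc n)))" "W (p n) \<in> borel_measurable (F (p (Suc n)))"
      using n 1(3)[of n] by (auto intro: measurable_F_mono[OF n(2)] adapted_W)
    moreover have "W (p (Suc n)) \<in> borel_measurable (F (p (Suc n)))"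
      using n by (intro adapted_W) auto
    ultimately show ?case
      by (simp add: simple_integral_W_def[abs_def])
  next
    case 2
    have "0 \<le> p n"
      by (rule IH(2)) (use 2 in auto)
    then show ?case using 2(2)[of n] by auto }
qed

text \<open>In the expanded square the cross term has mean zero, because \<open>Z * X\<close> is
  known at time \<open>s\<close> and the increment is centred and independent of the past; likewise
  \<open>X\<^sup>2\<close> and the squared increment factorize. Boundedness of \<open>X\<close>
  makes the products integrable when \<open>Z\<close> is merely square integrable.\<close>

lemma ito_isometry_step:
  fixes Z X :: "'w \<Rightarrow> real"
  assumes "0 \<le> s" "s \<le> t"
    and Z: "Z \<in> borel_measurable (F s)" "integrable M (\<lambda>\<omega>. (Z \<omega>)\<^sup>2)"
    and X: "X \<in> borel_measurable (F s)" "\<And>\<omega>. \<omega> \<in> space M \<Longrightarrow> \<bar>X \<omega>\<bar> \<le> C"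
  shows "integrable M (\<lambda>\<omega>. (Z \<omega> + X \<omega> * (W t \<omega> - W s \<omega>))\<^sup>2)"
    and "expectation (\<lambda>\<omega>. (Z \<omega> + X \<omega> * (W t \<omega> - W s \<omega>))\<^sup>2) =
      expectation (\<lambda>\<omega>. (Z \<omega>)\<^sup>2) + expectation (\<lambda>\<omega>. (X \<omega>)\<^sup>2) * (t - s)"
proof -
  let ?D = "\<lambda>\<omega>. W t \<omega> - W s \<omega>"
  have "integrable M (\<lambda>\<omega>. (Z \<omega> + X \<omega> * ?D \<omega>)\<^sup>2) \<and>
    expectation (\<lambda>\<omega>. (Z \<omega> + X \<omega> * ?D \<omega>)\<^sup>2) =
      expectation (\<lambda>\<omega>. (Z \<omega>)\<^sup>2) + expectation (\<lambda>\<omega>. (X \<omega>)\<^sup>2) * (t - s)"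
  \<comment> \<open>Partitions may have empty cells, whereas the law and the independence of
    increments are given for \<open>s < t\<close>.\<close>
  proof (cases "s = t")
    case True
    then show ?thesis using Z by simp
  next
    case False
    then have st: "0 \<le> s" "s < t" using assms by auto
    note [measurable] = measurable_F_M[OF Z(1)] measurable_F_M[OF X(1)]
    have iZ: "integrable M Z"
      by (rule square_integrable_imp_integrable) (use Z in auto)
    have iZX: "integrable M (\<lambda>\<omega>. Z \<omega> * X \<omega>)"
      by (rule Bochner_Integration.integrable_bound[of _ "\<lambda>\<omega>. Z \<omega> * C"])
        (use iZ X(2) in \<open>auto simp: abs_mult intro!: AE_I2 mult_left_mono intro: order_trans[OF _ abs_ge_self]\<close>)
    have iX2: "integrable M (\<lambda>\<omega>. (X \<omega>)\<^sup>2)"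
      by (rule integrable_bounded[of _ "C\<^sup>2"]) (use X(2) in \<open>auto simp: abs_le_square_iff[symmetric] intro: order_trans[OF _ abs_ge_self]\<close>)
    have m: "(\<lambda>\<omega>. Z \<omega> * X \<omega>) \<in> borel_measurable (F s)" "(\<lambda>\<omega>. (X \<omega>)\<^sup>2) \<in> borel_measurable (F s)"
      using Z(1) X(1) by measurable
    note i1 = indep_var_increment[OF st m(1)]
    have i2: "indep_var borel (\<lambda>\<omega>. (X \<omega>)\<^sup>2) borel (\<lambda>\<omega>. (?D \<omega>)\<^sup>2)"
      using indep_var_compose[OF indep_var_increment[OF st m(2)], of "\<lambda>x. x" borel "\<lambda>x. x\<^sup>2" borel]
      by (simp add: comp_def)
    have a: "integrable M (\<lambda>\<omega>. Z \<omega> * X \<omega> * ?D \<omega>)" "expectation (\<lambda>\<omega>. Z \<omega> * X \<omega> * ?D \<omega>) = 0"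
      using indep_var_integrable[OF i1 iZX integrable_increment[OF st]]
        indep_var_lebesgue_integral[OF i1 iZX integrable_increment[OF st]]
        expectation_increment[OF st] by auto
    have b: "integrable M (\<lambda>\<omega>. (X \<omega>)\<^sup>2 * (?D \<omega>)\<^sup>2)"
        "expectation (\<lambda>\<omega>. (X \<omega>)\<^sup>2 * (?D \<omega>)\<^sup>2) = expectation (\<lambda>\<omega>. (X \<omega>)\<^sup>2) * (t - s)"
      using indep_var_integrable[OF i2 iX2 integrable_increment_square[OF st]]
        indep_var_lebesgue_integral[OF i2 iX2 integrable_increment_square[OF st]]
        expectation_increment_square[OF st] by auto
    have eq: "(\<lambda>\<omega>. (Z \<omega> + X \<omega> * ?D \<omega>)\<^sup>2) = (\<lambda>\<omega>. (Z \<omega>)\<^sup>2 + 2 * (Z \<omega> * X \<omega> * ?D \<omega>) + (X \<omega>)\<^sup>2 * (?D \<omega>)\<^sup>2)"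
      by (auto simp: power2_eq_square algebra_simps)
    show ?thesis
      unfolding eq using a b Z(2) by simp
  qed
  then show "integrable M (\<lambda>\<omega>. (Z \<omega> + X \<omega> * ?D \<omega>)\<^sup>2)"
    and "expectation (\<lambda>\<omega>. (Z \<omega> + X \<omega> * ?D \<omega>)\<^sup>2) =
      expectation (\<lambda>\<omega>. (Z \<omega>)\<^sup>2) + expectation (\<lambda>\<omega>. (X \<omega>)\<^sup>2) * (t - s)" by auto
qed

text \<open>The constant \<open>d\<close> plays the role of \<open>Z\<close> for the empty sum. It
  is kept inside the square because variation of constants yields a deterministic term plus an
  integral; the two are orthogonal.\<close>

lemma ito_isometry_simple:
  fixes d :: real
  assumes "0 \<le> p 0" "\<And>i. i < n \<Longrightarrow> p i \<le> p (Suc i)"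
    and "\<And>i. i < n \<Longrightarrow> \<xi> i \<in> borel_measurable (F (p i))"
    and "\<And>i. i < n \<Longrightarrow> \<exists>C. \<forall>\<omega>\<in>space M. \<bar>\<xi> i \<omega>\<bar> \<le> C"
  shows "integrable M (\<lambda>\<omega>. (d + simple_integral_W W n p \<xi> \<omega>)\<^sup>2) \<and>
    expectation (\<lambda>\<omega>. (d + simple_integral_W W n p \<xi> \<omega>)\<^sup>2) =
      d\<^sup>2 + (\<Sum>i<n. expectation (\<lambda>\<omega>. (\<xi> i \<omega>)\<^sup>2) * (p (Suc i) - p i))"
  using assms
proof (induction n)
  case 0
  then show ?case by (simp add: simple_integral_W_def prob_space)
next
  case (Suc n)
  obtain C where C: "\<And>\<omega>. \<omega> \<in> space M \<Longrightarrow> \<bar>\<xi> n \<omega>\<bar> \<le> C"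
    using Suc.prems(4)[of n] by auto
  have m: "simple_integral_W W n p \<xi> \<in> borel_measurable (F (p n))" "0 \<le> p n"
    by (rule simple_integral_measurable[where \<xi> = \<xi>]; use Suc.prems in auto)+
  have eq: "d + simple_integral_W W (Suc n) p \<xi> \<omega> =
      (d + simple_integral_W W n p \<xi> \<omega>) + \<xi> n \<omega> * (W (p (Suc n)) \<omega> - W (p n) \<omega>)" for \<omega>
    by (simp add: simple_integral_W_def)
  have IH: "integrable M (\<lambda>\<omega>. (d + simple_integral_W W n p \<xi> \<omega>)\<^sup>2)"
    "expectation (\<lambda>\<omega>. (d + simple_integral_W W n p \<xi> \<omega>)\<^sup>2) =
      d\<^sup>2 + (\<Sum>i<n. expectation (\<lambda>\<omega>. (\<xi> i \<omega>)\<^sup>2) * (p (Suc i) - p i))"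
    using Suc.IH[OF Suc.prems(1)] Suc.prems by auto
  have "(\<lambda>\<omega>. d + simple_integral_W W n p \<xi> \<omega>) \<in> borel_measurable (F (p n))"
    using m(1) by measurable
  from ito_isometry_step[OF m(2) Suc.prems(2)[OF lessI] this IH(1) Suc.prems(3)[OF lessI] C]
  show ?case
    unfolding eq IH(2) by (simp add: algebra_simps)
qed

end

section \<open>Partitions and their common refinement\<close>

lemma increasing_from_steps:
  fixes q :: "nat \<Rightarrow> real"
  assumes "\<And>i. i < N \<Longrightarrow> q i < q (Suc i)" "i \<le> N" "j \<le> N"
  shows "q i < q j \<longleftrightarrow> i < j"
proof -
  have *: "q i < q j" if "i < j" "j \<le> N" for i j
    using that
  proof (induction j)
    case (Suc j)
    then show ?case
      using assms(1)[of j] by (cases "i = j") (auto intro: less_trans)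
  qed simp
  show ?thesis
    using *[of i j] *[of j i] assms by (cases i j rule: linorder_cases) auto
qed

lemma nondecreasing_from_steps:
  fixes q :: "nat \<Rightarrow> real"
  assumes "\<And>i. i < N \<Longrightarrow> q i \<le> q (Suc i)" "i \<le> j" "j \<le> N"
  shows "q i \<le> q j"
  using assms(2,3)
proof (induction j)
  case (Suc j)
  then show ?case
    using assms(1)[of j] by (cases "i = Suc j") (auto intro: order_trans)
qed simp

text \<open>Two step integrands on different partitions are compared on the sorted union of their
  division points. Passing to a set removes repetitions, so every cell of \<open>q\<close> has
  positive length, by which \<open>simple_integral_prob_le\<close> divides.\<close>

lemma common_refinement:
  fixes T :: "real set"
  assumes T: "finite T" "T \<subseteq> {0..t}" "0 \<in> T" "t \<in> T"
  obtains q and N :: nat where "q 0 = 0" "q N = t" "\<And>i. i < N \<Longrightarrow> q i < q (Suc i)" "q ` {..N} = T"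
proof -
  let ?xs = "sorted_list_of_set T"
  define N where "N = card T - 1"
  have len: "length ?xs = Suc N"
    using T card_gt_0_iff[of T] by (auto simp: N_def)
  have st: "sorted_wrt (<) ?xs" "set ?xs = T"
    using T by auto
  have less: "?xs ! i < ?xs ! j" if "i < j" "j \<le> N" for i j
    using sorted_wrt_nth_less[OF st(1) that(1)] that len by simp
  have img: "(\<lambda>i. ?xs ! i) ` {..N} = T"
    using st(2) len by (auto simp: set_conv_nth less_Suc_eq_le image_iff)
  obtain i where i: "i \<le> N" "?xs ! i = 0"
    using T(3) equalityD2[OF img] by (auto simp: subset_iff image_iff)
  obtain j where j: "j \<le> N" "?xs ! j = t"
    using T(4) equalityD2[OF img] by (auto simp: subset_iff image_iff)
  have rng: "?xs ! i \<in> {0..t}" if "i \<le> N" for i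
    using img T(2) that by blast
  have "i = 0"
    using less[of 0 i] i rng[of 0] by (cases "i = 0") auto
  moreover have "j = N"
    using less[of j N] j rng[of N] by (cases "j = N") auto
  ultimately show thesis
    using i j less img by (intro that[of "(!) ?xs" N]) auto
qed

lemma sum_over_cells:
  fixes q :: "nat \<Rightarrow> real" and f :: "real \<Rightarrow> ennreal"
  assumes "\<And>i. i < N \<Longrightarrow> q i \<le> q (Suc i)"
    and "\<And>l s. l < N \<Longrightarrow> s \<in> {q l<..q (Suc l)} \<Longrightarrow> f s = c l"
  shows "f s * indicator {q 0<..q N} s = (\<Sum>l<N. c l * indicator {q l<..q (Suc l)} s)"
  using assms
proof (induction N)
  case (Suc N)
  have "q 0 \<le> q N"
    by (rule nondecreasing_from_steps[of N]) (use Suc.prems(1) in auto)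
  then have "f s * indicator {q 0<..q (Suc N)} s =
      f s * indicator {q 0<..q N} s + f s * indicator {q N<..q (Suc N)} s"
    using Suc.prems(1)[of N] by (auto split: split_indicator)
  also have "f s * indicator {q N<..q (Suc N)} s = c N * indicator {q N<..q (Suc N)} s"
    using Suc.prems(2)[of N s] by (auto split: split_indicator)
  finally show ?case
    using Suc by simp
qed simp

lemma nn_integral_step:
  fixes q :: "nat \<Rightarrow> real" and c f :: "_ \<Rightarrow> real"
  assumes "\<And>i. i < N \<Longrightarrow> q i \<le> q (Suc i)"
    and "\<And>l s. l < N \<Longrightarrow> s \<in> {q l<..q (Suc l)} \<Longrightarrow> f s = c l"
  shows "(\<integral>\<^sup>+s\<in>{q 0..q N}. ennreal ((f s)\<^sup>2) \<partial>lborel) = ennreal (\<Sum>l<N. (c l)\<^sup>2 * (q (Suc l) - q l))"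
proof -
  have "(\<integral>\<^sup>+s\<in>{q 0..q N}. ennreal ((f s)\<^sup>2) \<partial>lborel) =
      (\<integral>\<^sup>+s. (\<Sum>l<N. ennreal ((c l)\<^sup>2) * indicator {q l<..q (Suc l)} s) \<partial>lborel)"
  proof (rule nn_integral_cong_AE)
    \<comment> \<open>The half-open cells miss only the left end point of the interval.\<close>
    have "AE s in lborel. s \<noteq> q 0"
      by (rule AE_lborel_singleton)
    then show "AE s in lborel. ennreal ((f s)\<^sup>2) * indicator {q 0..q N} s =
        (\<Sum>l<N. ennreal ((c l)\<^sup>2) * indicator {q l<..q (Suc l)} s)"
    proof eventually_elim
      case (elim s)
      have "ennreal ((f s)\<^sup>2) * indicator {q 0..q N} s = ennreal ((f s)\<^sup>2) * indicator {q 0<..q N} s"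
        using elim by (auto split: split_indicator)
      also have "\<dots> = (\<Sum>l<N. ennreal ((c l)\<^sup>2) * indicator {q l<..q (Suc l)} s)"
        using assms by (intro sum_over_cells) auto
      finally show ?case .
    qed
  qed
  also have "\<dots> = (\<Sum>l<N. ennreal ((c l)\<^sup>2) * ennreal (q (Suc l) - q l))"
    using assms(1) by (subst nn_integral_sum) (auto intro!: sum.cong simp: nn_integral_cmult_indicator)
  also have "\<dots> = ennreal (\<Sum>l<N. (c l)\<^sup>2 * (q (Suc l) - q l))"
    using assms(1) by (subst sum_ennreal[symmetric]) (auto simp: ennreal_mult)
  finally show ?thesis .
qed

text \<open>No \<open>p i\<close> lies strictly inside a cell of \<open>q\<close>, so a cell of
  \<open>q\<close> is contained in a cell of \<open>p\<close> or disjoint from it, whichever point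
  \<open>s\<close> is tested.\<close>

lemma cell_cases:
  fixes p q :: "nat \<Rightarrow> real"
  assumes q: "\<And>i. i < N \<Longrightarrow> q i < q (Suc i)" and p: "p ` {..n} \<subseteq> q ` {..N}"
    and "i < n" "l < N" "s \<in> {q l<..q (Suc l)}"
  shows "s \<in> {p i<..p (Suc i)} \<longleftrightarrow> p i \<le> q l \<and> q (Suc l) \<le> p (Suc i)"
proof -
  note less = increasing_from_steps[of N q, OF q]
  have "\<exists>a\<le>N. p i = q a" "\<exists>b\<le>N. p (Suc i) = q b"
    using p assms(3) by (force simp: image_subset_iff image_iff)+
  then obtain a b where ab: "a \<le> N" "p i = q a" "b \<le> N" "p (Suc i) = q b" by blast
  have "q a < s \<longleftrightarrow> q a \<le> q l"
    using less[of l a] less[of a "Suc l"] less[of a l] ab assms(4,5) by (auto simp: not_less[symmetric] less_Suc_eq)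
  moreover have "s \<le> q b \<longleftrightarrow> q (Suc l) \<le> q b"
    using less[of l b] less[of b "Suc l"] ab assms(4,5) by (auto simp: not_less[symmetric] less_Suc_eq)
  ultimately show ?thesis
    using ab by auto
qed

text \<open>Cells are open on the left, hence the right end point \<open>q (Suc l)\<close> serves as
  representative; \<open>q l\<close> itself lies outside the cell.\<close>

lemma simple_value_const_on_cell:
  fixes p q :: "nat \<Rightarrow> real"
  assumes "\<And>i. i < N \<Longrightarrow> q i < q (Suc i)" "p ` {..n} \<subseteq> q ` {..N}" "l < N" "s \<in> {q l<..q (Suc l)}"
  shows "simple_value n p \<xi> s \<omega> = simple_value n p \<xi> (q (Suc l)) \<omega>"
  unfolding simple_value_def
proof (intro sum.cong refl)
  fix i assume "i \<in> {..<n}"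
  then show "\<xi> i \<omega> * indicator {p i<..p (Suc i)} s = \<xi> i \<omega> * indicator {p i<..p (Suc i)} (q (Suc l))"
    using cell_cases[of N q p n i l s] cell_cases[of N q p n i l "q (Suc l)"] assms
    by (simp add: indicator_def)
qed

text \<open>For each term of the old sum, the increments of \<open>W\<close> over the new cells
  inside the old cell telescope.\<close>

lemma simple_integral_refine:
  fixes p q :: "nat \<Rightarrow> real"
  assumes q: "\<And>i. i < N \<Longrightarrow> q i < q (Suc i)" and p: "p ` {..n} \<subseteq> q ` {..N}"
    and mono: "\<And>i. i < n \<Longrightarrow> p i \<le> p (Suc i)"
  shows "simple_integral_W W N q (\<lambda>l \<omega>. simple_value n p \<xi> (q (Suc l)) \<omega>) \<omega> = simple_integral_W W n p \<xi> \<omega>"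
proof -
  note less = increasing_from_steps[of N q, OF q]
  have tele: "(\<Sum>l<N. indicator {p i<..p (Suc i)} (q (Suc l)) * (W (q (Suc l)) \<omega> - W (q l) \<omega>)) =
      W (p (Suc i)) \<omega> - W (p i) \<omega>" if i: "i < n" for i
  proof -
    have "\<exists>a\<le>N. p i = q a" "\<exists>b\<le>N. p (Suc i) = q b"
      using p i by (force simp: image_subset_iff image_iff)+
    then obtain a b where ab: "a \<le> N" "p i = q a" "b \<le> N" "p (Suc i) = q b" by blast
    have "a \<le> b"
      using less[of b a] ab mono[OF i] by auto
    have "(\<Sum>l<N. indicator {p i<..p (Suc i)} (q (Suc l)) * (W (q (Suc l)) \<omega> - W (q l) \<omega>)) =
        (\<Sum>l\<in>{a..<b}. W (q (Suc l)) \<omega> - W (q l) \<omega>)"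
    proof (rule sum.mono_neutral_cong_right)
      show "{a..<b} \<subseteq> {..<N}" using ab by auto
      show "\<forall>l\<in>{..<N} - {a..<b}. indicator {p i<..p (Suc i)} (q (Suc l)) * (W (q (Suc l)) \<omega> - W (q l) \<omega>) = 0"
        using ab less[of a] less[of b] by (auto simp: indicator_def not_less[symmetric])
      show "indicator {p i<..p (Suc i)} (q (Suc l)) * (W (q (Suc l)) \<omega> - W (q l) \<omega>) =
          W (q (Suc l)) \<omega> - W (q l) \<omega>" if "l \<in> {a..<b}" for l
        using ab less[of a "Suc l"] less[of b "Suc l"] that by (auto simp: indicator_def not_less[symmetric])
    qed auto
    also have "\<dots> = W (q b) \<omega> - W (q a) \<omega>"
      using sum_Suc_diff'[OF \<open>a \<le> b\<close>, of "\<lambda>l. W (q l) \<omega>"] by simp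
    finally show ?thesis using ab by simp
  qed
  have "simple_integral_W W N q (\<lambda>l \<omega>. simple_value n p \<xi> (q (Suc l)) \<omega>) \<omega> =
      (\<Sum>l<N. \<Sum>i<n. \<xi> i \<omega> * (indicator {p i<..p (Suc i)} (q (Suc l)) * (W (q (Suc l)) \<omega> - W (q l) \<omega>)))"
    unfolding simple_integral_W_def simple_value_def by (simp only: sum_distrib_right mult.assoc)
  also have "\<dots> = (\<Sum>i<n. \<xi> i \<omega> * (\<Sum>l<N. indicator {p i<..p (Suc i)} (q (Suc l)) * (W (q (Suc l)) \<omega> - W (q l) \<omega>)))"
    by (subst sum.swap) (simp only: sum_distrib_left)
  also have "\<dots> = simple_integral_W W n p \<xi> \<omega>"
    using tele by (simp add: simple_integral_W_def)
  finally show ?thesis .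
qed

text \<open>This is \<open>simple_process\<close> without the bound on the coefficients: samples of
  \<open>H\<close> at grid points are adapted but may be unbounded.\<close>

definition adapted_step :: "(real \<Rightarrow> 'w measure) \<Rightarrow> real \<Rightarrow> nat \<Rightarrow> (nat \<Rightarrow> real) \<Rightarrow> (nat \<Rightarrow> 'w \<Rightarrow> real) \<Rightarrow> bool" where
  "adapted_step F t n p \<xi> \<longleftrightarrow> p 0 = 0 \<and> p n = t \<and> (\<forall>i<n. p i \<le> p (Suc i)) \<and>
     (\<forall>i<n. \<xi> i \<in> borel_measurable (F (p i)))"

lemma adapted_step_range:
  assumes "adapted_step F t n p \<xi>" "i \<le> n"
  shows "p i \<in> {0..t}"
proof -
  have "p 0 \<le> p i" "p i \<le> p n"
    by (rule nondecreasing_from_steps[of n]; use assms in \<open>simp add: adapted_step_def\<close>)+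
  then show ?thesis using assms by (auto simp: adapted_step_def)
qed

section \<open>Step integrals controlled in probability by their quadratic variation\<close>

context wiener_process
begin

text \<open>Although the value is taken at the right end point, only terms with
  \<open>p i \<le> q l\<close> contribute to it, so it is already known at the left end
  point.\<close>

lemma simple_value_measurable_at_cell:
  fixes p q :: "nat \<Rightarrow> real"
  assumes q: "\<And>i. i < N \<Longrightarrow> q i < q (Suc i)" and p: "p ` {..n} \<subseteq> q ` {..N}"
    and \<xi>: "\<And>i. i < n \<Longrightarrow> \<xi> i \<in> borel_measurable (F (p i))" and l: "l < N"
  shows "simple_value n p \<xi> (q (Suc l)) \<in> borel_measurable (F (q l))"
  unfolding simple_value_def[abs_def]
proof (rule borel_measurable_sum)
  fix i assume i: "i \<in> {..<n}"
  show "(\<lambda>\<omega>. \<xi> i \<omega> * indicat_real {p i<..p (Suc i)} (q (Suc l))) \<in> borel_measurable (F (q l))"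
  proof (cases "p i \<le> q l")
    case True
    then show ?thesis
      using measurable_F_mono[OF True \<xi>] i by (intro borel_measurable_times) auto
  next
    case False
    then have "indicat_real {p i<..p (Suc i)} (q (Suc l)) = 0"
      using cell_cases[OF q p, of i l "q (Suc l)"] i l q[OF l] by (auto simp: indicator_def)
    then show ?thesis by simp
  qed
qed

text \<open>Dropping the terms after the time at which the quadratic variation exceeds \<open>\<delta>\<close> leaves an
  adapted integrand whose integral has variance at most \<open>\<delta>\<close>.\<close>

lemma simple_integral_prob_le:
  fixes \<delta> \<epsilon> :: real
  assumes p0: "0 \<le> p 0" and p: "\<And>i. i < n \<Longrightarrow> p i < p (Suc i)"
    and \<xi>: "\<And>i. i < n \<Longrightarrow> \<xi> i \<in> borel_measurable (F (p i))" and pos: "0 < \<delta>" "0 < \<epsilon>"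
  shows "prob {\<omega>\<in>space M. \<epsilon> < \<bar>simple_integral_W W n p \<xi> \<omega>\<bar>} \<le>
    prob {\<omega>\<in>space M. \<delta> < (\<Sum>i<n. (\<xi> i \<omega>)\<^sup>2 * (p (Suc i) - p i))} + \<delta> / \<epsilon>\<^sup>2"
proof -
  define V where "V k \<omega> = (\<Sum>i<k. (\<xi> i \<omega>)\<^sup>2 * (p (Suc i) - p i))" for k \<omega>
  \<comment> \<open>\<open>V (Suc i)\<close> includes the cell that starts at \<open>p i\<close> but
    involves only \<open>\<xi> 0\<close> to \<open>\<xi> i\<close>, so the decision to keep term
    \<open>i\<close> is known at time \<open>p i\<close>. Because it accounts for this cell in
    advance, the retained sum never exceeds \<open>\<delta>\<close>.\<close>
  define \<eta> where "\<eta> i \<omega> = (if V (Suc i) \<omega> \<le> \<delta> then \<xi> i \<omega> else 0)" for i \<omega>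
  have V_mono: "V j \<omega> \<le> V k \<omega>" if "j \<le> k" "k \<le> n" for j k \<omega>
    unfolding V_def using that p by (intro sum_mono2) (auto intro!: mult_nonneg_nonneg simp: less_imp_le)
  have pmono: "p i \<le> p j" if "i \<le> j" "j \<le> n" for i j
    using increasing_from_steps[of n p j i] p that by (meson le_trans linorder_not_less order_less_imp_le)
  have V_meas: "V (Suc i) \<in> borel_measurable (F (p i))" if "i < n" for i
    unfolding V_def[abs_def]
  proof (rule borel_measurable_sum)
    fix j assume "j \<in> {..<Suc i}"
    then have "\<xi> j \<in> borel_measurable (F (p i))"
      using that by (intro measurable_F_mono[OF _ \<xi>] pmono) auto
    then show "(\<lambda>\<omega>. (\<xi> j \<omega>)\<^sup>2 * (p (Suc j) - p j)) \<in> borel_measurable (F (p i))"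
      by measurable
  qed
  have \<eta>_meas: "\<eta> i \<in> borel_measurable (F (p i))" if "i < n" for i
    using V_meas[OF that] \<xi>[OF that] unfolding \<eta>_def[abs_def] by measurable
  \<comment> \<open>A retained term alone contributes at most \<open>\<delta>\<close>; dividing by
    the length of its cell bounds the coefficient. The isometry for bounded coefficients thus
    applies to \<open>\<eta>\<close> although \<open>\<xi>\<close> may be unbounded.\<close>
  have \<eta>_bdd: "\<bar>\<eta> i \<omega>\<bar> \<le> sqrt (\<delta> / (p (Suc i) - p i))" if "i < n" for i \<omega>
  proof (cases "V (Suc i) \<omega> \<le> \<delta>")
    case True
    have "0 \<le> V i \<omega>"
      unfolding V_def using p that by (intro sum_nonneg mult_nonneg_nonneg) (auto simp: less_imp_le)
    then have "(\<xi> i \<omega>)\<^sup>2 * (p (Suc i) - p i) \<le> \<delta>"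
      using True by (simp add: V_def)
    then have "(\<xi> i \<omega>)\<^sup>2 \<le> \<delta> / (p (Suc i) - p i)"
      using p[OF that] by (simp add: pos_le_divide_eq)
    then show ?thesis
      using True real_le_rsqrt[of "\<bar>\<xi> i \<omega>\<bar>"] by (auto simp: \<eta>_def)
  next
    case False
    then show ?thesis using pos p[OF that] by (simp add: \<eta>_def)
  qed
  have sum_le: "(\<Sum>i<k. (\<eta> i \<omega>)\<^sup>2 * (p (Suc i) - p i)) \<le> min \<delta> (V k \<omega>)" if "k \<le> n" for k \<omega>
    using that
  proof (induction k)
    case 0
    then show ?case using pos by (simp add: V_def)
  next
    case (Suc k)
    have "V k \<omega> \<le> V (Suc k) \<omega>"
      using Suc.prems by (intro V_mono) auto
    then show ?case
      using Suc by (auto simp: \<eta>_def V_def)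
  qed
  have S_meas: "simple_integral_W W n p \<eta> \<in> borel_measurable M" "simple_integral_W W n p \<xi> \<in> borel_measurable M"
    by (rule measurable_F_M, rule simple_integral_measurable(1)[where p = p and n = n]; use p0 p \<eta>_meas \<xi> in \<open>auto simp: less_imp_le\<close>)+
  have \<eta>_bdd': "\<exists>C. \<forall>\<omega>\<in>space M. \<bar>\<eta> i \<omega>\<bar> \<le> C" if "i < n" for i
    using \<eta>_bdd[OF that] by blast
  have iso: "integrable M (\<lambda>\<omega>. (0 + simple_integral_W W n p \<eta> \<omega>)\<^sup>2) \<and>
    expectation (\<lambda>\<omega>. (0 + simple_integral_W W n p \<eta> \<omega>)\<^sup>2) =
      0\<^sup>2 + (\<Sum>i<n. expectation (\<lambda>\<omega>. (\<eta> i \<omega>)\<^sup>2) * (p (Suc i) - p i))"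
    by (rule ito_isometry_simple) (use p0 p \<eta>_meas \<eta>_bdd' in \<open>auto simp: less_imp_le\<close>)
  have i\<eta>: "integrable M (\<lambda>\<omega>. (\<eta> i \<omega>)\<^sup>2)" if "i < n" for i
    by (rule integrable_bounded[of _ "(sqrt (\<delta> / (p (Suc i) - p i)))\<^sup>2"])
      (use measurable_F_M[OF \<eta>_meas[OF that]] \<eta>_bdd[OF that] in
        \<open>auto simp: abs_le_square_iff[symmetric] intro: order_trans[OF _ abs_ge_self]\<close>)
  have "(\<Sum>i<n. expectation (\<lambda>\<omega>. (\<eta> i \<omega>)\<^sup>2) * (p (Suc i) - p i)) =
      expectation (\<lambda>\<omega>. \<Sum>i<n. (\<eta> i \<omega>)\<^sup>2 * (p (Suc i) - p i))"
    using i\<eta> by (subst Bochner_Integration.integral_sum) auto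
  also have "\<dots> \<le> \<delta>"
    using sum_le[of n] i\<eta> by (intro integral_le_const) auto
  finally have E: "expectation (\<lambda>\<omega>. (simple_integral_W W n p \<eta> \<omega>)\<^sup>2) \<le> \<delta>"
    using iso by simp
  have "prob {\<omega>\<in>space M. \<epsilon> < \<bar>simple_integral_W W n p \<eta> \<omega>\<bar>} \<le>
      prob {\<omega>\<in>space M. \<epsilon>\<^sup>2 \<le> (simple_integral_W W n p \<eta> \<omega>)\<^sup>2}"
    using S_meas pos by (intro finite_measure_mono) (auto simp: abs_le_square_iff[symmetric])
  also have "\<dots> \<le> expectation (\<lambda>\<omega>. (simple_integral_W W n p \<eta> \<omega>)\<^sup>2) / \<epsilon>\<^sup>2"
    using iso pos by (intro integral_Markov_inequality_measure[where A = "{}"]) auto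
  also have "\<dots> \<le> \<delta> / \<epsilon>\<^sup>2"
    using E pos by (intro divide_right_mono) auto
  finally have 1: "prob {\<omega>\<in>space M. \<epsilon> < \<bar>simple_integral_W W n p \<eta> \<omega>\<bar>} \<le> \<delta> / \<epsilon>\<^sup>2" .
  have [measurable]: "V n \<in> borel_measurable M"
    unfolding V_def[abs_def] using measurable_F_M[OF \<xi>] by auto
  \<comment> \<open>As \<open>V\<close> is nondecreasing, \<open>V n \<omega> \<le> \<delta>\<close>
    means that no term was dropped.\<close>
  have eq: "simple_integral_W W n p \<eta> \<omega> = simple_integral_W W n p \<xi> \<omega>" if "V n \<omega> \<le> \<delta>" for \<omega>
    unfolding simple_integral_W_def
  proof (intro sum.cong refl)
    fix i assume "i \<in> {..<n}"
    then show "\<eta> i \<omega> * (W (p (Suc i)) \<omega> - W (p i) \<omega>) = \<xi> i \<omega> * (W (p (Suc i)) \<omega> - W (p i) \<omega>)"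
      using V_mono[of "Suc i" n \<omega>] that by (simp add: \<eta>_def)
  qed
  have "prob {\<omega>\<in>space M. \<epsilon> < \<bar>simple_integral_W W n p \<xi> \<omega>\<bar>} \<le>
      prob ({\<omega>\<in>space M. \<delta> < V n \<omega>} \<union> {\<omega>\<in>space M. \<epsilon> < \<bar>simple_integral_W W n p \<eta> \<omega>\<bar>})"
    using S_meas eq by (intro finite_measure_mono) (auto, metis not_less)
  also have "\<dots> \<le> prob {\<omega>\<in>space M. \<delta> < V n \<omega>} + prob {\<omega>\<in>space M. \<epsilon> < \<bar>simple_integral_W W n p \<eta> \<omega>\<bar>}"
    using S_meas by (intro measure_Un_le) auto
  finally show ?thesis
    using 1 by (simp add: V_def)
qed

text \<open>On the common refinement the difference is a single step integrand with coefficients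
  \<open>\<zeta>\<close>, and its integrated square is exactly the sum in
  \<open>simple_integral_prob_le\<close>. Closeness of integrands in probability thus becomes
  closeness of integrals, with no moments involved.\<close>

lemma simple_integral_diff_prob_le:
  fixes \<delta> \<epsilon> :: real
  assumes step: "adapted_step F t n p \<xi>" "adapted_step F t n' p' \<xi>'" and pos: "0 < \<delta>" "0 < \<epsilon>"
  shows "prob {\<omega>\<in>space M. \<epsilon> < \<bar>simple_integral_W W n p \<xi> \<omega> - simple_integral_W W n' p' \<xi>' \<omega>\<bar>} \<le>
    prob {\<omega>\<in>space M. ennreal \<delta> <
      (\<integral>\<^sup>+s\<in>{0..t}. ennreal ((simple_value n p \<xi> s \<omega> - simple_value n' p' \<xi>' s \<omega>)\<^sup>2) \<partial>lborel)} + \<delta> / \<epsilon>\<^sup>2"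
proof -
  obtain q N where q: "q 0 = 0" "q N = t" "\<And>i. i < N \<Longrightarrow> q i < q (Suc i)"
    and T: "q ` {..N} = p ` {..n} \<union> p' ` {..n'}"
  proof (rule common_refinement[of "p ` {..n} \<union> p' ` {..n'}" t])
    show "p ` {..n} \<union> p' ` {..n'} \<subseteq> {0..t}"
      using adapted_step_range[OF step(1)] adapted_step_range[OF step(2)] by auto
    show "0 \<in> p ` {..n} \<union> p' ` {..n'}" "t \<in> p ` {..n} \<union> p' ` {..n'}"
      using step(1) unfolding adapted_step_def by (metis UnI1 atMost_iff imageI le0, metis UnI1 atMost_iff imageI order_refl)
  qed auto
  define \<zeta> where "\<zeta> l \<omega> = simple_value n p \<xi> (q (Suc l)) \<omega> - simple_value n' p' \<xi>' (q (Suc l)) \<omega>" for l \<omega>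
  have sub: "p ` {..n} \<subseteq> q ` {..N}" "p' ` {..n'} \<subseteq> q ` {..N}"
    using T by auto
  have \<zeta>: "\<zeta> l \<in> borel_measurable (F (q l))" if "l < N" for l
    unfolding \<zeta>_def[abs_def] using step
    by (intro borel_measurable_diff simple_value_measurable_at_cell[OF q(3) sub(1)]
        simple_value_measurable_at_cell[OF q(3) sub(2)]) (auto simp: adapted_step_def that)
  have int: "simple_integral_W W n p \<xi> \<omega> - simple_integral_W W n' p' \<xi>' \<omega> = simple_integral_W W N q \<zeta> \<omega>" for \<omega>
  proof -
    have "simple_integral_W W N q \<zeta> \<omega> = simple_integral_W W N q (\<lambda>l \<omega>. simple_value n p \<xi> (q (Suc l)) \<omega>) \<omega>
        - simple_integral_W W N q (\<lambda>l \<omega>. simple_value n' p' \<xi>' (q (Suc l)) \<omega>) \<omega>"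
      by (simp add: simple_integral_W_def \<zeta>_def sum_subtractf left_diff_distrib)
    then show ?thesis
      using simple_integral_refine[OF q(3) sub(1), of W \<xi> \<omega>] simple_integral_refine[OF q(3) sub(2), of W \<xi>' \<omega>] step
      by (simp add: adapted_step_def)
  qed
  have nn: "(\<integral>\<^sup>+s\<in>{0..t}. ennreal ((simple_value n p \<xi> s \<omega> - simple_value n' p' \<xi>' s \<omega>)\<^sup>2) \<partial>lborel) =
      ennreal (\<Sum>l<N. (\<zeta> l \<omega>)\<^sup>2 * (q (Suc l) - q l))" for \<omega>
    unfolding q(1)[symmetric] q(2)[symmetric]
  proof (rule nn_integral_step)
    show "simple_value n p \<xi> s \<omega> - simple_value n' p' \<xi>' s \<omega> = \<zeta> l \<omega>" if "l < N" "s \<in> {q l<..q (Suc l)}" for l s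
      unfolding \<zeta>_def using simple_value_const_on_cell[OF q(3) sub(1) that, of \<xi> \<omega>]
        simple_value_const_on_cell[OF q(3) sub(2) that, of \<xi>' \<omega>]
      by simp
  qed (use q(3) in \<open>auto simp: less_imp_le\<close>)
  have "0 \<le> (\<Sum>l<N. (\<zeta> l \<omega>)\<^sup>2 * (q (Suc l) - q l))" for \<omega>
    using q(3) by (intro sum_nonneg mult_nonneg_nonneg) (auto simp: less_imp_le)
  then have "ennreal \<delta> < ennreal (\<Sum>l<N. (\<zeta> l \<omega>)\<^sup>2 * (q (Suc l) - q l)) \<longleftrightarrow>
      \<delta> < (\<Sum>l<N. (\<zeta> l \<omega>)\<^sup>2 * (q (Suc l) - q l))" for \<omega>
    using pos by (simp add: ennreal_less_iff)
  then show ?thesis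
    unfolding nn int using simple_integral_prob_le[of q N \<zeta> \<delta> \<epsilon>] q \<zeta> pos by simp
qed

end

section \<open>Grid approximation of the It\^o integral\<close>

lemma simple_value_on_cell:
  fixes p :: "nat \<Rightarrow> real"
  assumes p: "\<And>i. i < n \<Longrightarrow> p i < p (Suc i)" and l: "l < n" "s \<in> {p l<..p (Suc l)}"
  shows "simple_value n p \<xi> s \<omega> = \<xi> l \<omega>"
proof -
  note less = increasing_from_steps[of n p, OF p]
  have "simple_value n p \<xi> s \<omega> = (\<Sum>i<n. if i = l then \<xi> l \<omega> else 0)"
    unfolding simple_value_def
  proof (intro sum.cong refl)
    fix i assume i: "i \<in> {..<n}"
    have "i = l" if s: "s \<in> {p i<..p (Suc i)}"
    proof -
      have "p i < p (Suc l)" "p l < p (Suc i)"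
        using s l(2) by (meson greaterThanAtMost_iff less_le_trans)+
      then have "i < Suc l" "l < Suc i"
        using less[of i "Suc l"] less[of l "Suc i"] l(1) i by simp_all
      then show ?thesis by simp
    qed
    then show "\<xi> i \<omega> * indicator {p i<..p (Suc i)} s = (if i = l then \<xi> l \<omega> else 0)"
      using l(2) by (cases "i = l") (simp_all add: indicator_def, blast)
  qed
  then show ?thesis using l by simp
qed

lemma cell_exists:
  fixes p :: "nat \<Rightarrow> real"
  assumes "s \<in> {p 0<..p n}"
  shows "\<exists>l<n. s \<in> {p l<..p (Suc l)}"
  using assms
proof (induction n)
  case (Suc n)
  show ?case
  proof (cases "s \<le> p n")
    case True
    with Suc obtain l where "l < n" "s \<in> {p l<..p (Suc l)}" by auto
    then show ?thesis by (intro exI[of _ l]) auto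
  next
    case False
    with Suc.prems show ?thesis by (intro exI[of _ n]) auto
  qed
qed simp

text \<open>Progressive measurability concerns time restricted to an interval, so the measurability
  arguments run on the restricted space.\<close>

lemma nn_integral_interval:
  "(\<integral>\<^sup>+s\<in>{0..t}. f s \<partial>lborel) = (\<integral>\<^sup>+s. f s \<partial>restrict_space lborel {0..t::real})"
  by (simp add: nn_integral_restrict_space)

text \<open>Uniform continuity on a compact interval. The cells are closed so that the estimate
  serves left-endpoint samples as well as arbitrary tags of Riemann sums.\<close>

lemma grid_approximation:
  fixes f :: "real \<Rightarrow> real"
  assumes f: "continuous_on {0..t} f" and "0 < t" "0 < e"
  shows "\<forall>\<^sub>F n in sequentially. \<forall>j<n. \<forall>u\<in>{real j * (t / n)..real (Suc j) * (t / n)}.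
    \<forall>v\<in>{real j * (t / n)..real (Suc j) * (t / n)}. \<bar>f u - f v\<bar> \<le> e"
proof -
  have "uniformly_continuous_on {0..t} f"
    using f by (intro compact_uniformly_continuous) auto
  then obtain d where d: "0 < d" "\<And>u v. u \<in> {0..t} \<Longrightarrow> v \<in> {0..t} \<Longrightarrow> dist v u < d \<Longrightarrow> dist (f v) (f u) < e"
    using \<open>0 < e\<close> unfolding uniformly_continuous_on_def by metis
  have "(\<lambda>n. t / real n) \<longlonglongrightarrow> 0"
    by (rule lim_const_over_n)
  then have "\<forall>\<^sub>F n in sequentially. t / real n < d"
    using d(1) by (rule order_tendstoD)
  then show ?thesis
    using eventually_gt_at_top[of 0]
  proof eventually_elim
    case (elim n)
    show ?case
    proof (intro allI impI ballI)
      fix j u v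
      assume j: "j < n" and u: "u \<in> {real j * (t / n)..real (Suc j) * (t / n)}"
        and v: "v \<in> {real j * (t / n)..real (Suc j) * (t / n)}"
      have 1: "real (Suc j) * (t / n) = real j * (t / n) + t / n"
        by (simp add: algebra_simps add_divide_distrib)
      have "real (Suc j) * (t / n) \<le> real n * (t / n)"
        using j \<open>0 < t\<close> by (intro mult_right_mono) auto
      then have 2: "real (Suc j) * (t / n) \<le> t" "0 \<le> real j * (t / n)"
        using elim \<open>0 < t\<close> by auto
      have "dist u v < d"
        using u v 1 elim by (auto simp: dist_real_def abs_less_iff)
      then have "dist (f u) (f v) < e"
        using u v 2 by (intro d(2)) auto
      then show "\<bar>f u - f v\<bar> \<le> e"
        by (simp add: dist_real_def)
    qed
  qed
qed

section \<open>Convergence in probability and Fatou's lemma\<close>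

context prob_space
begin

lemma prob_tendsto_0:
  assumes [measurable]: "\<And>m. A m \<in> sets M" and ev: "AE \<omega> in M. \<forall>\<^sub>F m in sequentially. \<omega> \<notin> A m"
  shows "(\<lambda>m. prob (A m)) \<longlonglongrightarrow> 0"
proof -
  have "(\<lambda>m. expectation (indicat_real (A m))) \<longlonglongrightarrow> expectation (\<lambda>\<omega>. 0)"
  proof (rule integral_dominated_convergence[where w = "\<lambda>_. 1"])
    show "AE \<omega> in M. (\<lambda>m. indicat_real (A m) \<omega>) \<longlonglongrightarrow> 0"
      using ev
    proof eventually_elim
      case (elim \<omega>)
      then have "\<forall>\<^sub>F m in sequentially. indicat_real (A m) \<omega> = 0"
        by eventually_elim auto
      then show ?case by (rule tendsto_eventually)
    qed
  qed auto
  then show ?thesis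
    by simp
qed

lemma tendsto_in_prob_add:
  assumes [measurable]: "\<And>m. X m \<in> borel_measurable M" "X' \<in> borel_measurable M"
    "\<And>m. Y m \<in> borel_measurable M" "Y' \<in> borel_measurable M"
    and X: "tendsto_in_prob M X X'" and Y: "tendsto_in_prob M Y Y'"
  shows "tendsto_in_prob M (\<lambda>m \<omega>. X m \<omega> + Y m \<omega>) (\<lambda>\<omega>. X' \<omega> + Y' \<omega>)"
  unfolding tendsto_in_prob_def
proof (intro allI impI)
  fix \<epsilon> :: real assume "0 < \<epsilon>"
  then have "0 < \<epsilon> / 2" by simp
  with X Y have "(\<lambda>m. prob {\<omega>\<in>space M. \<epsilon> / 2 < \<bar>X m \<omega> - X' \<omega>\<bar>}) \<longlonglongrightarrow> 0"
    "(\<lambda>m. prob {\<omega>\<in>space M. \<epsilon> / 2 < \<bar>Y m \<omega> - Y' \<omega>\<bar>}) \<longlonglongrightarrow> 0"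
    unfolding tendsto_in_prob_def by blast+
  from tendsto_add[OF this]
  have lim: "(\<lambda>m. prob {\<omega>\<in>space M. \<epsilon> / 2 < \<bar>X m \<omega> - X' \<omega>\<bar>} + prob {\<omega>\<in>space M. \<epsilon> / 2 < \<bar>Y m \<omega> - Y' \<omega>\<bar>}) \<longlonglongrightarrow> 0"
    by simp
  have le: "prob {\<omega>\<in>space M. \<epsilon> < \<bar>X m \<omega> + Y m \<omega> - (X' \<omega> + Y' \<omega>)\<bar>} \<le>
      prob {\<omega>\<in>space M. \<epsilon> / 2 < \<bar>X m \<omega> - X' \<omega>\<bar>} + prob {\<omega>\<in>space M. \<epsilon> / 2 < \<bar>Y m \<omega> - Y' \<omega>\<bar>}" for m
  proof -
    have "prob {\<omega>\<in>space M. \<epsilon> < \<bar>X m \<omega> + Y m \<omega> - (X' \<omega> + Y' \<omega>)\<bar>} \<le>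
      prob ({\<omega>\<in>space M. \<epsilon> / 2 < \<bar>X m \<omega> - X' \<omega>\<bar>} \<union> {\<omega>\<in>space M. \<epsilon> / 2 < \<bar>Y m \<omega> - Y' \<omega>\<bar>})"
    proof (intro finite_measure_mono subsetI)
      fix \<omega> assume \<omega>: "\<omega> \<in> {\<omega>\<in>space M. \<epsilon> < \<bar>X m \<omega> + Y m \<omega> - (X' \<omega> + Y' \<omega>)\<bar>}"
      then have "\<epsilon> < \<bar>X m \<omega> - X' \<omega>\<bar> + \<bar>Y m \<omega> - Y' \<omega>\<bar>"
        using abs_diff_triangle_ineq[of "X m \<omega>" "Y m \<omega>" "X' \<omega>" "Y' \<omega>"] by auto
      then have "\<epsilon> / 2 < \<bar>X m \<omega> - X' \<omega>\<bar> \<or> \<epsilon> / 2 < \<bar>Y m \<omega> - Y' \<omega>\<bar>"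
        by linarith
      then show "\<omega> \<in> {\<omega>\<in>space M. \<epsilon> / 2 < \<bar>X m \<omega> - X' \<omega>\<bar>} \<union> {\<omega>\<in>space M. \<epsilon> / 2 < \<bar>Y m \<omega> - Y' \<omega>\<bar>}"
        using \<omega> by blast
    qed measurable
    also have "\<dots> \<le> prob {\<omega>\<in>space M. \<epsilon> / 2 < \<bar>X m \<omega> - X' \<omega>\<bar>} + prob {\<omega>\<in>space M. \<epsilon> / 2 < \<bar>Y m \<omega> - Y' \<omega>\<bar>}"
      by (intro measure_Un_le) auto
    finally show ?thesis .
  qed
  show "(\<lambda>m. prob {\<omega>\<in>space M. \<epsilon> < \<bar>X m \<omega> + Y m \<omega> - (X' \<omega> + Y' \<omega>)\<bar>}) \<longlonglongrightarrow> 0"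
    by (rule tendsto_sandwich[OF _ _ tendsto_const lim]) (use le in auto)
qed

lemma tendsto_in_prob_const: "tendsto_in_prob M (\<lambda>m. X) X"
  by (auto simp: tendsto_in_prob_def)

lemma tendsto_in_prob_cmult:
  assumes X: "tendsto_in_prob M X X'"
  shows "tendsto_in_prob M (\<lambda>m \<omega>. a * X m \<omega>) (\<lambda>\<omega>. a * X' \<omega>)"
proof (cases "a = 0")
  case False
  have "{\<omega>\<in>space M. \<epsilon> < \<bar>a * X m \<omega> - a * X' \<omega>\<bar>} = {\<omega>\<in>space M. \<epsilon> / \<bar>a\<bar> < \<bar>X m \<omega> - X' \<omega>\<bar>}" for \<epsilon> m
    using False by (simp add: pos_divide_less_eq right_diff_distrib[symmetric] abs_mult mult.commute)
  then show ?thesis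
    using X False by (simp add: tendsto_in_prob_def)
qed (simp add: tendsto_in_prob_def)

lemma tendsto_in_prob_compose:
  assumes "tendsto_in_prob M X X'" "filterlim f sequentially sequentially"
  shows "tendsto_in_prob M (\<lambda>m. X (f m)) X'"
  unfolding tendsto_in_prob_def
proof (intro allI impI)
  fix \<epsilon> :: real assume "0 < \<epsilon>"
  then have "(\<lambda>k. prob {\<omega>\<in>space M. \<epsilon> < \<bar>X k \<omega> - X' \<omega>\<bar>}) \<longlonglongrightarrow> 0"
    using assms(1) by (simp add: tendsto_in_prob_def)
  from filterlim_compose[OF this assms(2)]
  show "(\<lambda>m. prob {\<omega>\<in>space M. \<epsilon> < \<bar>X (f m) \<omega> - X' \<omega>\<bar>}) \<longlonglongrightarrow> 0" .
qed

lemma tendsto_in_prob_sum: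
  fixes n :: nat
  assumes "\<And>m k. k < n \<Longrightarrow> X m k \<in> borel_measurable M" "\<And>k. k < n \<Longrightarrow> X' k \<in> borel_measurable M"
    and "\<And>k. k < n \<Longrightarrow> tendsto_in_prob M (\<lambda>m. X m k) (X' k)"
  shows "tendsto_in_prob M (\<lambda>m \<omega>. \<Sum>k<n. X m k \<omega>) (\<lambda>\<omega>. \<Sum>k<n. X' k \<omega>)"
  using assms
proof (induction n)
  case 0
  then show ?case by (simp add: tendsto_in_prob_const)
next
  case (Suc n)
  then have "tendsto_in_prob M (\<lambda>m \<omega>. (\<Sum>k<n. X m k \<omega>) + X m n \<omega>) (\<lambda>\<omega>. (\<Sum>k<n. X' k \<omega>) + X' n \<omega>)"
    by (intro tendsto_in_prob_add borel_measurable_sum) auto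
  then show ?case by simp
qed

text \<open>Fatou's lemma. The limit \<open>Y\<close> enters only through its almost sure equality
  with a liminf of measurable functions, so it may involve the delay term, whose measurability is
  not established.\<close>

lemma nn_integral_le_of_AE_tendsto:
  fixes X :: "nat \<Rightarrow> 'a \<Rightarrow> ennreal"
  assumes [measurable]: "\<And>m. X m \<in> borel_measurable M"
    and lim: "AE \<omega> in M. (\<lambda>m. X m \<omega>) \<longlonglongrightarrow> Y \<omega>"
    and le: "\<And>m. (\<integral>\<^sup>+\<omega>. X m \<omega> \<partial>M) \<le> C m" and C: "C \<longlonglongrightarrow> C'"
  shows "(\<integral>\<^sup>+\<omega>. Y \<omega> \<partial>M) \<le> C'"
proof -
  have "(\<integral>\<^sup>+\<omega>. Y \<omega> \<partial>M) = (\<integral>\<^sup>+\<omega>. liminf (\<lambda>m. X m \<omega>) \<partial>M)"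
  proof (rule nn_integral_cong_AE)
    show "AE \<omega> in M. Y \<omega> = liminf (\<lambda>m. X m \<omega>)"
      using lim
    proof eventually_elim
      case (elim \<omega>)
      show ?case
        by (rule lim_imp_Liminf[symmetric, OF _ elim]) simp
    qed
  qed
  also have "\<dots> \<le> liminf (\<lambda>m. \<integral>\<^sup>+\<omega>. X m \<omega> \<partial>M)"
    by (rule nn_integral_liminf) simp
  also have "\<dots> \<le> liminf C"
    using le by (intro Liminf_mono) auto
  also have "\<dots> = C'"
    by (rule lim_imp_Liminf[OF _ C]) simp
  finally show ?thesis .
qed

text \<open>Indices \<open>r k\<close> with exceptional probability below \<open>(1/2) ^ k\<close>
  are chosen; Borel-Cantelli gives almost sure convergence along them, and Fatou's lemma concludes.
  As the bound holds for each index, \<open>r\<close> may be any selection, increasing or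
  not.\<close>

lemma nn_integral_square_le_of_tendsto_in_prob:
  assumes [measurable]: "\<And>m. X m \<in> borel_measurable M" "Y \<in> borel_measurable M" "A \<in> sets M"
    and lim: "tendsto_in_prob M X Y"
    and le: "\<And>m. (\<integral>\<^sup>+\<omega>\<in>A. ennreal ((X m \<omega>)\<^sup>2) \<partial>M) \<le> C"
  shows "(\<integral>\<^sup>+\<omega>\<in>A. ennreal ((Y \<omega>)\<^sup>2) \<partial>M) \<le> C"
proof -
  have "\<exists>m. prob {\<omega>\<in>space M. (1/2) ^ k < \<bar>X m \<omega> - Y \<omega>\<bar>} < (1/2) ^ k" for k :: nat
  proof -
    have "(\<lambda>m. prob {\<omega>\<in>space M. (1/2) ^ k < \<bar>X m \<omega> - Y \<omega>\<bar>}) \<longlonglongrightarrow> 0"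
      using lim by (simp add: tendsto_in_prob_def)
    then have "\<forall>\<^sub>F m in sequentially. prob {\<omega>\<in>space M. (1/2) ^ k < \<bar>X m \<omega> - Y \<omega>\<bar>} < (1/2) ^ k"
      by (rule order_tendstoD) simp
    then show ?thesis
      by (auto simp: eventually_sequentially)
  qed
  then obtain r where r: "\<And>k. prob {\<omega>\<in>space M. (1/2) ^ k < \<bar>X (r k) \<omega> - Y \<omega>\<bar>} < (1/2) ^ k"
    by metis
  define B where "B k = {\<omega>\<in>space M. (1/2) ^ k < \<bar>X (r k) \<omega> - Y \<omega>\<bar>}" for k
  have "AE \<omega> in M. \<forall>\<^sub>F k in sequentially. \<omega> \<in> space M - B k"
  proof (rule borel_cantelli_AE1)
    show "B k \<in> sets M" for k
      unfolding B_def by measurable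
    show "emeasure M (B k) < \<infinity>" for k
      by (simp add: less_top[symmetric])
    have le: "norm (prob (B k)) \<le> (1/2) ^ k" for k
      using r[of k] unfolding B_def by simp
    show "summable (\<lambda>k. prob (B k))"
      by (rule summable_comparison_test'[OF summable_geometric[of "1/2 :: real"], of 0]) (use le in auto)
  qed
  then have "AE \<omega> in M. (\<lambda>k. ennreal ((X (r k) \<omega>)\<^sup>2) * indicator A \<omega>) \<longlonglongrightarrow> ennreal ((Y \<omega>)\<^sup>2) * indicator A \<omega>"
  proof eventually_elim
    case (elim \<omega>)
    have "(\<lambda>k. X (r k) \<omega> - Y \<omega>) \<longlonglongrightarrow> 0"
    proof (rule Lim_null_comparison)
      show "\<forall>\<^sub>F k in sequentially. norm (X (r k) \<omega> - Y \<omega>) \<le> (1/2) ^ k"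
        using elim by eventually_elim (auto simp: B_def not_less)
      show "(\<lambda>k. (1/2) ^ k :: real) \<longlonglongrightarrow> 0"
        by (rule LIMSEQ_realpow_zero) auto
    qed
    then have "(\<lambda>k. X (r k) \<omega>) \<longlonglongrightarrow> Y \<omega>"
      by (simp add: LIM_zero_iff)
    then have "(\<lambda>k. ennreal ((X (r k) \<omega>)\<^sup>2)) \<longlonglongrightarrow> ennreal ((Y \<omega>)\<^sup>2)"
      by (intro tendsto_intros tendsto_ennrealI)
    then show ?case
      by (cases "\<omega> \<in> A") simp_all
  qed
  from nn_integral_le_of_AE_tendsto[OF _ this le tendsto_const] show ?thesis
    by simp
qed

end

section \<open>Left-endpoint sums of a continuous integrand\<close>

context wiener_process
begin

lemma progressively_measurable_at:
  assumes H: "progressively_measurable F t H" and u: "u \<in> {0..t}"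
  shows "H u \<in> borel_measurable (F u)"
proof -
  have "Pair u \<in> measurable (F u) (restrict_space borel {0..u} \<Otimes>\<^sub>M F u)"
    using u by (intro measurable_Pair1') (simp add: space_restrict_space)
  moreover have "(\<lambda>(s, \<omega>). H s \<omega>) \<in> borel_measurable (restrict_space borel {0..u} \<Otimes>\<^sub>M F u)"
    using H u by (auto simp: progressively_measurable_def)
  ultimately have "(\<lambda>\<omega>. (\<lambda>(s, \<omega>). H s \<omega>) (u, \<omega>)) \<in> borel_measurable (F u)"
    by (rule measurable_compose)
  then show ?thesis by simp
qed

lemma simple_value_jointly_measurable:
  assumes "adapted_step F t n p \<xi>"
  shows "(\<lambda>(s, \<omega>). simple_value n p \<xi> s \<omega>) \<in> borel_measurable (restrict_space lborel {0..t} \<Otimes>\<^sub>M F t)"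
  unfolding simple_value_def split_def
proof (rule borel_measurable_sum)
  fix i assume i: "i \<in> {..<n}"
  have "\<xi> i \<in> borel_measurable (F t)"
    by (rule measurable_F_mono[of "p i"]) (use assms i adapted_step_range[OF assms, of i] in \<open>auto simp: adapted_step_def\<close>)
  then have 1: "(\<lambda>x. \<xi> i (snd x)) \<in> borel_measurable (restrict_space lborel {0..t} \<Otimes>\<^sub>M F t)"
    by (rule measurable_compose[OF measurable_snd])
  have "fst \<in> borel_measurable (restrict_space lborel {0..t} \<Otimes>\<^sub>M F t)"
    by (rule measurable_compose[OF measurable_fst]) (rule measurable_restrict_space1, simp)
  then have 2: "(\<lambda>x. indicat_real {p i<..p (Suc i)} (fst x)) \<in> borel_measurable (restrict_space lborel {0..t} \<Otimes>\<^sub>M F t)"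
    by (rule measurable_compose) simp
  show "(\<lambda>x. \<xi> i (snd x) * indicat_real {p i<..p (Suc i)} (fst x)) \<in> borel_measurable (restrict_space lborel {0..t} \<Otimes>\<^sub>M F t)"
    by (rule borel_measurable_times[OF 1 2])
qed

lemma progressively_measurable_joint:
  assumes "progressively_measurable F t H" "0 \<le> t"
  shows "(\<lambda>(s, \<omega>). H s \<omega>) \<in> borel_measurable (restrict_space lborel {0..t} \<Otimes>\<^sub>M F t)"
proof -
  have eq: "sets (restrict_space lborel {0..t} \<Otimes>\<^sub>M F t) = sets (restrict_space borel {0..t} \<Otimes>\<^sub>M F t)"
    by (intro sets_pair_measure_cong sets_restrict_space_cong) auto
  have "(\<lambda>(s, \<omega>). H s \<omega>) \<in> borel_measurable (restrict_space borel {0..t} \<Otimes>\<^sub>M F t)"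
    using assms by (auto simp: progressively_measurable_def)
  then show ?thesis
    unfolding measurable_cong_sets[OF eq refl] .
qed

lemma L2_distance_measurable:
  assumes H: "progressively_measurable F t H" and st: "adapted_step F t n p \<xi>" and t: "0 \<le> t"
  shows "(\<lambda>\<omega>. \<integral>\<^sup>+s\<in>{0..t}. ennreal ((simple_value n p \<xi> s \<omega> - H s \<omega>)\<^sup>2) \<partial>lborel) \<in> borel_measurable M"
proof -
  interpret R: sigma_finite_measure "restrict_space lborel {0..t}"
    by (rule sigma_finite_measure_restrict_space) (auto intro: sigma_finite_lborel)
  have "(\<lambda>x. ennreal ((simple_value n p \<xi> (snd x) (fst x) - H (snd x) (fst x))\<^sup>2)) \<in>
      borel_measurable (F t \<Otimes>\<^sub>M restrict_space lborel {0..t})"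
    using measurable_pair_swap[OF simple_value_jointly_measurable[OF st]]
      measurable_pair_swap[OF progressively_measurable_joint[OF H t]]
    by (simp add: split_def)
  from R.borel_measurable_nn_integral_fst[OF this]
  have "(\<lambda>\<omega>. \<integral>\<^sup>+s\<in>{0..t}. ennreal ((simple_value n p \<xi> s \<omega> - H s \<omega>)\<^sup>2) \<partial>lborel) \<in> borel_measurable (F t)"
    by (simp add: nn_integral_interval)
  then show ?thesis
    by (rule measurable_from_subalg[OF subalgebra_F])
qed

lemma L2_distance_triangle:
  assumes H: "progressively_measurable F t H" and t: "0 \<le> t" and \<omega>: "\<omega> \<in> space M"
    and st: "adapted_step F t n p \<xi>" "adapted_step F t n' p' \<xi>'"
  shows "(\<integral>\<^sup>+s\<in>{0..t}. ennreal ((simple_value n p \<xi> s \<omega> - simple_value n' p' \<xi>' s \<omega>)\<^sup>2) \<partial>lborel) \<le>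
    2 * (\<integral>\<^sup>+s\<in>{0..t}. ennreal ((simple_value n p \<xi> s \<omega> - H s \<omega>)\<^sup>2) \<partial>lborel) +
    2 * (\<integral>\<^sup>+s\<in>{0..t}. ennreal ((simple_value n' p' \<xi>' s \<omega> - H s \<omega>)\<^sup>2) \<partial>lborel)"
proof -
  have \<omega>': "\<omega> \<in> space (F t)" using \<omega> by (simp add: space_F)
  have [measurable]: "(\<lambda>s. simple_value n p \<xi> s \<omega>) \<in> borel_measurable (restrict_space lborel {0..t})"
    "(\<lambda>s. simple_value n' p' \<xi>' s \<omega>) \<in> borel_measurable (restrict_space lborel {0..t})"
    "(\<lambda>s. H s \<omega>) \<in> borel_measurable (restrict_space lborel {0..t})"
    using measurable_compose[OF measurable_Pair2'[OF \<omega>'] simple_value_jointly_measurable[OF st(1)]]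
      measurable_compose[OF measurable_Pair2'[OF \<omega>'] simple_value_jointly_measurable[OF st(2)]]
      measurable_compose[OF measurable_Pair2'[OF \<omega>'] progressively_measurable_joint[OF H t]]
    by auto
  \<comment> \<open>The right-hand side minus the left-hand side is
    \<open>(x + y - 2 * z)\<^sup>2\<close>.\<close>
  have sq: "(x - y)\<^sup>2 \<le> 2 * (x - z)\<^sup>2 + 2 * (y - z)\<^sup>2" for x y z :: real
    using zero_le_power2[of "x + y - 2 * z"] by (simp add: power2_eq_square algebra_simps)
  have "ennreal ((x - y)\<^sup>2) \<le> 2 * ennreal ((x - z)\<^sup>2) + 2 * ennreal ((y - z)\<^sup>2)" for x y z :: real
  proof -
    have "ennreal ((x - y)\<^sup>2) \<le> ennreal (2 * (x - z)\<^sup>2 + 2 * (y - z)\<^sup>2)"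
      using sq by (rule ennreal_leI)
    then show ?thesis by (simp add: ennreal_mult)
  qed
  then have "(\<integral>\<^sup>+s. ennreal ((simple_value n p \<xi> s \<omega> - simple_value n' p' \<xi>' s \<omega>)\<^sup>2) \<partial>restrict_space lborel {0..t}) \<le>
     (\<integral>\<^sup>+s. 2 * ennreal ((simple_value n p \<xi> s \<omega> - H s \<omega>)\<^sup>2) + 2 * ennreal ((simple_value n' p' \<xi>' s \<omega> - H s \<omega>)\<^sup>2) \<partial>restrict_space lborel {0..t})"
    by (intro nn_integral_mono)
  also have "\<dots> = 2 * (\<integral>\<^sup>+s. ennreal ((simple_value n p \<xi> s \<omega> - H s \<omega>)\<^sup>2) \<partial>restrict_space lborel {0..t}) +
     2 * (\<integral>\<^sup>+s. ennreal ((simple_value n' p' \<xi>' s \<omega> - H s \<omega>)\<^sup>2) \<partial>restrict_space lborel {0..t})"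
    by (simp add: nn_integral_add nn_integral_cmult)
  finally show ?thesis
    by (simp add: nn_integral_interval)
qed

lemma adapted_step_grid:
  assumes H: "progressively_measurable F t H" and "0 < t" "0 < n"
  shows "adapted_step F t n (\<lambda>j. real j * (t / n)) (\<lambda>j. H (real j * (t / n)))"
  unfolding adapted_step_def
proof (intro conjI allI impI)
  fix i assume "i < n"
  then have "real i * (t / n) \<le> real n * (t / n)"
    using assms by (intro mult_right_mono) auto
  then have "real i * (t / n) \<in> {0..t}"
    using assms by auto
  then show "H (real i * (t / n)) \<in> borel_measurable (F (real i * (t / n)))"
    by (rule progressively_measurable_at[OF H])
  show "real i * (t / n) \<le> real (Suc i) * (t / n)"
    using assms by (intro mult_right_mono) auto
qed (use assms in auto)

lemma L2_distance_grid_tendsto: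
  assumes H: "progressively_measurable F t H" and t: "0 < t" and "0 < \<delta>"
    and cont: "AE \<omega> in M. continuous_on {0..t} (\<lambda>s. H s \<omega>)"
  shows "(\<lambda>n. prob {\<omega>\<in>space M. ennreal \<delta> <
    (\<integral>\<^sup>+s\<in>{0..t}. ennreal ((simple_value n (\<lambda>j. real j * (t / n)) (\<lambda>j. H (real j * (t / n))) s \<omega> - H s \<omega>)\<^sup>2) \<partial>lborel)}) \<longlonglongrightarrow> 0"
proof -
  let ?D = "\<lambda>n \<omega>. \<integral>\<^sup>+s\<in>{0..t}. ennreal ((simple_value n (\<lambda>j. real j * (t / n)) (\<lambda>j. H (real j * (t / n))) s \<omega> - H s \<omega>)\<^sup>2) \<partial>lborel"
  \<comment> \<open>Index \<open>0\<close> gives a degenerate grid, so the argument runs over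
    \<open>Suc n\<close> and is shifted back at the end.\<close>
  have "(\<lambda>n. prob {\<omega>\<in>space M. ennreal \<delta> < ?D (Suc n) \<omega>}) \<longlonglongrightarrow> 0"
  proof (rule prob_tendsto_0)
    fix n
    have "{\<omega>\<in>space M. ennreal \<delta> < f \<omega>} \<in> sets M" if "f \<in> borel_measurable M" for f
      using that by measurable
    then show "{\<omega>\<in>space M. ennreal \<delta> < ?D (Suc n) \<omega>} \<in> sets M"
      using L2_distance_measurable[OF H adapted_step_grid[OF H t, of "Suc n"]] t by simp
  next
    show "AE \<omega> in M. \<forall>\<^sub>F n in sequentially. \<omega> \<notin> {\<omega>\<in>space M. ennreal \<delta> < ?D (Suc n) \<omega>}"
      using cont
    proof eventually_elim
      case (elim \<omega>)
      define e where "e = sqrt (\<delta> / t)"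
      have e: "0 < e" "e\<^sup>2 * t = \<delta>"
        using t \<open>0 < \<delta>\<close> by (auto simp: e_def)
      have "\<forall>\<^sub>F n in sequentially. ?D n \<omega> \<le> ennreal \<delta>"
        using grid_approximation[OF elim t e(1)] eventually_gt_at_top[of 0]
      proof eventually_elim
        case (elim n)
        have "?D n \<omega> \<le> (\<integral>\<^sup>+s\<in>{0..t}. ennreal (e\<^sup>2) \<partial>lborel)"
        proof (rule nn_integral_mono_AE)
          have "AE s in lborel. s \<noteq> (0::real)"
            by (rule AE_lborel_singleton)
          then show "AE s in lborel. ennreal ((simple_value n (\<lambda>j. real j * (t / n)) (\<lambda>j. H (real j * (t / n))) s \<omega> - H s \<omega>)\<^sup>2) *
              indicator {0..t} s \<le> ennreal (e\<^sup>2) * indicator {0..t} s"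
          proof eventually_elim
            case s: (elim s)
            show ?case
            proof (cases "s \<in> {0..t}")
              case True
              then have "s \<in> {real 0 * (t / n)<..real n * (t / n)}"
                using s elim(2) by auto
              from cell_exists[OF this]
              obtain l where l: "l < n" "s \<in> {real l * (t / n)<..real (Suc l) * (t / n)}" by blast
              have "simple_value n (\<lambda>j. real j * (t / n)) (\<lambda>j. H (real j * (t / n))) s \<omega> = H (real l * (t / n)) \<omega>"
                by (rule simple_value_on_cell[of n "\<lambda>j. real j * (t / n)" l s "\<lambda>j. H (real j * (t / n))" \<omega>])
                  (use l t in \<open>auto intro!: mult_strict_right_mono simp del: times_divide_eq_right\<close>)
              moreover have "\<bar>H (real l * (t / n)) \<omega> - H s \<omega>\<bar> \<le> e"
                using l t elim(2) by (intro elim(1)[rule_format, OF l(1)]) auto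
              ultimately show ?thesis
                using True e(1) by (auto intro!: ennreal_leI simp: abs_le_square_iff[symmetric])
            qed simp
          qed
        qed
        also have "\<dots> = ennreal \<delta>"
          using t e by (simp add: nn_integral_cmult_indicator ennreal_mult[symmetric])
        finally show ?case .
      qed
      then have "\<forall>\<^sub>F n in sequentially. ?D (Suc n) \<omega> \<le> ennreal \<delta>"
        by (subst eventually_sequentially_Suc)
      then show ?case
        by eventually_elim (auto simp: not_less)
    qed
  qed
  then show ?thesis
    by (subst (asm) filterlim_sequentially_Suc)
qed

text \<open>One of the unspecified simple processes, of index \<open>k\<close>, close to
  \<open>H\<close> and with integral close to \<open>I\<close>, serves as intermediary: by
  \<open>simple_integral_diff_prob_le\<close> the grid sums are close to its integral, since both
  integrands are close to \<open>H\<close>.\<close>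

lemma grid_integral_tendsto_in_prob:
  assumes ito: "has_ito_integral M F W H t I" and t: "0 < t"
    and cont: "AE \<omega> in M. continuous_on {0..t} (\<lambda>s. H s \<omega>)"
  shows "tendsto_in_prob M (\<lambda>n. simple_integral_W W n (\<lambda>j. real j * (t / n)) (\<lambda>j. H (real j * (t / n)))) I"
  unfolding tendsto_in_prob_def
proof (intro allI impI)
  fix \<epsilon> :: real assume "0 < \<epsilon>"
  let ?R = "\<lambda>n. simple_integral_W W n (\<lambda>j. real j * (t / n)) (\<lambda>j. H (real j * (t / n)))"
  let ?v = "\<lambda>n. simple_value n (\<lambda>j. real j * (t / n)) (\<lambda>j. H (real j * (t / n)))"
  have H: "progressively_measurable F t H" and I [measurable]: "I \<in> borel_measurable M"
    using ito by (auto simp: has_ito_integral_def)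
  obtain N p \<xi> where simple: "\<forall>k. simple_process M F t (N k) (p k) (\<xi> k)"
    and L2: "\<forall>\<epsilon>>0. (\<lambda>k. prob {\<omega> \<in> space M.
             (\<integral>\<^sup>+s\<in>{0..t}. ennreal ((simple_value (N k) (p k) (\<xi> k) s \<omega> - H s \<omega>)\<^sup>2) \<partial>lborel) > ennreal \<epsilon>}) \<longlonglongrightarrow> 0"
    and limI: "tendsto_in_prob M (\<lambda>k. simple_integral_W W (N k) (p k) (\<xi> k)) I"
    using ito unfolding has_ito_integral_def by blast
  have st: "adapted_step F t (N k) (p k) (\<xi> k)" for k
    using simple by (auto simp: simple_process_def adapted_step_def)
  have int_meas: "simple_integral_W W n p \<xi> \<in> borel_measurable M" if "adapted_step F t n p \<xi>" for n p \<xi>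
    by (rule measurable_F_M[OF simple_integral_measurable(1)]) (use that in \<open>auto simp: adapted_step_def\<close>)
  show "(\<lambda>n. prob {\<omega>\<in>space M. \<epsilon> < \<bar>?R n \<omega> - I \<omega>\<bar>}) \<longlonglongrightarrow> 0"
  proof (rule order_tendstoI)
    fix \<eta> :: real assume "0 < \<eta>"
    \<comment> \<open>Four errors of size \<open>\<eta> / 4\<close> are allowed: the two integrand
      distances, the term \<open>\<delta> / (\<epsilon> / 2)\<^sup>2\<close>, and the distance of
      the intermediary from \<open>I\<close>. The integrand distances are tested at
      \<open>\<delta> / 4\<close> because \<open>L2_distance_triangle\<close> doubles each of
      them.\<close>
    define \<delta> where "\<delta> = (\<epsilon> / 2)\<^sup>2 * (\<eta> / 4)"
    have \<delta>: "0 < \<delta>" "\<delta> / (\<epsilon> / 2)\<^sup>2 = \<eta> / 4"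
      using \<open>0 < \<epsilon>\<close> \<open>0 < \<eta>\<close> by (auto simp: \<delta>_def)
    have "\<forall>\<^sub>F k in sequentially. prob {\<omega> \<in> space M. ennreal (\<delta> / 4) <
        (\<integral>\<^sup>+s\<in>{0..t}. ennreal ((simple_value (N k) (p k) (\<xi> k) s \<omega> - H s \<omega>)\<^sup>2) \<partial>lborel)} < \<eta> / 4"
      by (rule order_tendstoD(2)[OF L2[rule_format]]) (use \<delta> \<open>0 < \<eta>\<close> in auto)
    moreover have "\<forall>\<^sub>F k in sequentially. prob {\<omega>\<in>space M. \<epsilon> / 2 < \<bar>simple_integral_W W (N k) (p k) (\<xi> k) \<omega> - I \<omega>\<bar>} < \<eta> / 4"
      by (rule order_tendstoD(2)[OF limI[unfolded tendsto_in_prob_def, rule_format, of "\<epsilon> / 2"]])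
        (use \<open>0 < \<eta>\<close> \<open>0 < \<epsilon>\<close> in auto)
    ultimately have "\<forall>\<^sub>F k in sequentially. prob {\<omega> \<in> space M. ennreal (\<delta> / 4) <
        (\<integral>\<^sup>+s\<in>{0..t}. ennreal ((simple_value (N k) (p k) (\<xi> k) s \<omega> - H s \<omega>)\<^sup>2) \<partial>lborel)} < \<eta> / 4 \<and>
       prob {\<omega>\<in>space M. \<epsilon> / 2 < \<bar>simple_integral_W W (N k) (p k) (\<xi> k) \<omega> - I \<omega>\<bar>} < \<eta> / 4"
      by eventually_elim auto
    then obtain k where k: "prob {\<omega> \<in> space M. ennreal (\<delta> / 4) <
        (\<integral>\<^sup>+s\<in>{0..t}. ennreal ((simple_value (N k) (p k) (\<xi> k) s \<omega> - H s \<omega>)\<^sup>2) \<partial>lborel)} < \<eta> / 4"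
       "prob {\<omega>\<in>space M. \<epsilon> / 2 < \<bar>simple_integral_W W (N k) (p k) (\<xi> k) \<omega> - I \<omega>\<bar>} < \<eta> / 4"
      by (auto simp: eventually_sequentially)
    have "\<forall>\<^sub>F n in sequentially. prob {\<omega>\<in>space M. ennreal (\<delta> / 4) <
        (\<integral>\<^sup>+s\<in>{0..t}. ennreal ((?v n s \<omega> - H s \<omega>)\<^sup>2) \<partial>lborel)} < \<eta> / 4"
      by (rule order_tendstoD(2)[OF L2_distance_grid_tendsto[OF H t _ cont]]) (use \<delta> \<open>0 < \<eta>\<close> in auto)
    then show "\<forall>\<^sub>F n in sequentially. prob {\<omega>\<in>space M. \<epsilon> < \<bar>?R n \<omega> - I \<omega>\<bar>} < \<eta>"
      using eventually_gt_at_top[of 0]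
    proof eventually_elim
      case (elim n)
      note grid = adapted_step_grid[OF H t elim(2)]
      let ?S = "simple_integral_W W (N k) (p k) (\<xi> k)"
      define D where "D = (\<lambda>\<omega>. \<integral>\<^sup>+s\<in>{0..t}. ennreal ((?v n s \<omega> - H s \<omega>)\<^sup>2) \<partial>lborel)"
      define D' where "D' = (\<lambda>\<omega>. \<integral>\<^sup>+s\<in>{0..t}. ennreal ((simple_value (N k) (p k) (\<xi> k) s \<omega> - H s \<omega>)\<^sup>2) \<partial>lborel)"
      define D'' where "D'' = (\<lambda>\<omega>. \<integral>\<^sup>+s\<in>{0..t}. ennreal ((?v n s \<omega> - simple_value (N k) (p k) (\<xi> k) s \<omega>)\<^sup>2) \<partial>lborel)"
      have [measurable]: "?R n \<in> borel_measurable M" "?S \<in> borel_measurable M"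
        "D \<in> borel_measurable M" "D' \<in> borel_measurable M"
        using int_meas[OF grid] int_meas[OF st] L2_distance_measurable[OF H grid] L2_distance_measurable[OF H st] t
        by (auto simp: D_def D'_def)
      have tri: "D'' \<omega> \<le> 2 * D \<omega> + 2 * D' \<omega>" if "\<omega> \<in> space M" for \<omega>
        using L2_distance_triangle[OF H _ that grid st[of k]] t by (simp add: D_def D'_def D''_def)
      have "\<omega> \<in> {\<omega>\<in>space M. ennreal (\<delta> / 4) < D \<omega>} \<union> {\<omega>\<in>space M. ennreal (\<delta> / 4) < D' \<omega>}"
        if "\<omega> \<in> space M" "ennreal \<delta> < D'' \<omega>" for \<omega>
      proof (rule ccontr)
        assume "\<not> ?thesis"
        then have "D \<omega> \<le> ennreal (\<delta> / 4)" "D' \<omega> \<le> ennreal (\<delta> / 4)"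
          using that by (auto simp: not_less)
        then have "2 * D \<omega> + 2 * D' \<omega> \<le> 2 * ennreal (\<delta> / 4) + 2 * ennreal (\<delta> / 4)"
          by (intro add_mono mult_left_mono) auto
        also have "2 * ennreal (\<delta> / 4) = ennreal (2 * (\<delta> / 4))"
          using \<delta>(1) by (subst ennreal_mult) auto
        also have "ennreal (2 * (\<delta> / 4)) + ennreal (2 * (\<delta> / 4)) = ennreal \<delta>"
          using \<delta>(1) by (subst ennreal_plus[symmetric]) auto
        finally show False
          using tri[OF that(1)] that(2) by (meson leD order_trans)
      qed
      then have "prob {\<omega>\<in>space M. ennreal \<delta> < D'' \<omega>} \<le>
          prob ({\<omega>\<in>space M. ennreal (\<delta> / 4) < D \<omega>} \<union> {\<omega>\<in>space M. ennreal (\<delta> / 4) < D' \<omega>})"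
        by (intro finite_measure_mono) auto
      also have "\<dots> \<le> prob {\<omega>\<in>space M. ennreal (\<delta> / 4) < D \<omega>} + prob {\<omega>\<in>space M. ennreal (\<delta> / 4) < D' \<omega>}"
        by (intro measure_Un_le) auto
      finally have 1: "prob {\<omega>\<in>space M. ennreal \<delta> < D'' \<omega>} < \<eta> / 4 + \<eta> / 4"
        using elim(1) k(1) unfolding D_def D'_def by linarith
      have "prob {\<omega>\<in>space M. \<epsilon> / 2 < \<bar>?R n \<omega> - ?S \<omega>\<bar>} \<le> prob {\<omega>\<in>space M. ennreal \<delta> < D'' \<omega>} + \<delta> / (\<epsilon> / 2)\<^sup>2"
        unfolding D''_def by (rule simple_integral_diff_prob_le[OF grid st]) (use \<delta> \<open>0 < \<epsilon>\<close> in auto)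
      then have 2: "prob {\<omega>\<in>space M. \<epsilon> / 2 < \<bar>?R n \<omega> - ?S \<omega>\<bar>} < \<eta> / 4 + \<eta> / 4 + \<eta> / 4"
        unfolding \<delta>(2) using 1 by linarith
      have "prob {\<omega>\<in>space M. \<epsilon> < \<bar>?R n \<omega> - I \<omega>\<bar>} \<le>
         prob ({\<omega>\<in>space M. \<epsilon> / 2 < \<bar>?R n \<omega> - ?S \<omega>\<bar>} \<union> {\<omega>\<in>space M. \<epsilon> / 2 < \<bar>?S \<omega> - I \<omega>\<bar>})"
      proof (intro finite_measure_mono subsetI)
        fix \<omega> assume \<omega>: "\<omega> \<in> {\<omega>\<in>space M. \<epsilon> < \<bar>?R n \<omega> - I \<omega>\<bar>}"
        then have "\<epsilon> / 2 < \<bar>?R n \<omega> - ?S \<omega>\<bar> \<or> \<epsilon> / 2 < \<bar>?S \<omega> - I \<omega>\<bar>"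
          using abs_triangle_ineq[of "?R n \<omega> - ?S \<omega>" "?S \<omega> - I \<omega>"] by auto
        then show "\<omega> \<in> {\<omega>\<in>space M. \<epsilon> / 2 < \<bar>?R n \<omega> - ?S \<omega>\<bar>} \<union> {\<omega>\<in>space M. \<epsilon> / 2 < \<bar>?S \<omega> - I \<omega>\<bar>}"
          using \<omega> by blast
      qed measurable
      also have "\<dots> \<le> prob {\<omega>\<in>space M. \<epsilon> / 2 < \<bar>?R n \<omega> - ?S \<omega>\<bar>} + prob {\<omega>\<in>space M. \<epsilon> / 2 < \<bar>?S \<omega> - I \<omega>\<bar>}"
        by (intro measure_Un_le) measurable
      finally show ?case
        using 2 k(2) by linarith
    qed
  next
    fix \<eta> :: real assume "\<eta> < 0"
    then show "\<forall>\<^sub>F n in sequentially. \<eta> < prob {\<omega>\<in>space M. \<epsilon> < \<bar>?R n \<omega> - I \<omega>\<bar>}"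
      by (intro always_eventually allI) (rule less_le_trans[OF _ measure_nonneg])
  qed
qed

end

section \<open>Deterministic estimates\<close>

lemma grid_le_Suc: "0 < t \<Longrightarrow> real k * (t / real n) \<le> real (Suc k) * (t / real n)"
  by (intro mult_right_mono) auto

lemma grid_cell_subset:
  fixes t :: real
  assumes "0 < t" "j < n"
  shows "{real j * (t / n)..real (Suc j) * (t / n)} \<subseteq> {0..t}"
proof -
  have "real (Suc j) * (t / n) \<le> real n * (t / n)"
    using assms by (intro mult_right_mono) auto
  then show ?thesis
    using assms by auto
qed

text \<open>The integral of \<open>f\<close> against \<open>g\<close> is represented by an antiderivative \<open>\<Phi>\<close> of \<open>f * g'\<close>; the mean
  value theorem bounds each summand by the oscillation of \<open>f\<close> on its cell.\<close>

lemma riemann_stieltjes_sum_tendsto: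
  fixes f g g' \<Phi> :: "real \<Rightarrow> real"
  assumes f: "continuous_on {0..t} f" and t: "0 < t"
    and g: "\<And>s. s \<in> {0..t} \<Longrightarrow> (g has_real_derivative g' s) (at s within {0..t})"
    and B: "\<And>s. s \<in> {0..t} \<Longrightarrow> \<bar>g' s\<bar> \<le> B"
    and \<Phi>: "\<And>s. s \<in> {0..t} \<Longrightarrow> (\<Phi> has_real_derivative f s * g' s) (at s within {0..t})"
    and \<tau>: "\<And>n k. k < n \<Longrightarrow> \<tau> n k \<in> {real k * (t / n)..real (Suc k) * (t / n)}"
  shows "(\<lambda>n. \<Sum>k<n. f (\<tau> n k) * (g (real (Suc k) * (t / n)) - g (real k * (t / n)))) \<longlonglongrightarrow> \<Phi> t - \<Phi> 0"
proof (rule LIMSEQ_I)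
  fix \<epsilon> :: real assume "0 < \<epsilon>"
  have B0: "0 \<le> B" using B[of 0] t by auto
  \<comment> \<open>\<open>B\<close> may be \<open>0\<close>; the added \<open>1\<close> keeps the
    divisor in \<open>e\<close> positive.\<close>
  define D where "D = (B + 1) * t"
  have D: "0 < D" "B * t \<le> D"
    using B0 t by (auto simp: D_def algebra_simps add_pos_nonneg)
  define e where "e = \<epsilon> / (2 * D)"
  have e: "0 < e" using \<open>0 < \<epsilon>\<close> D by (simp add: e_def)
  have "e * B * t \<le> e * D"
    using e D by (simp add: mult.assoc)
  also have "\<dots> = \<epsilon> / 2"
    using D by (simp add: e_def)
  also have "\<dots> < \<epsilon>" using \<open>0 < \<epsilon>\<close> by simp
  finally have eB: "e * B * t < \<epsilon>" .
  have "\<forall>\<^sub>F n in sequentially. norm ((\<Sum>k<n. f (\<tau> n k) * (g (real (Suc k) * (t / n)) - g (real k * (t / n)))) - (\<Phi> t - \<Phi> 0)) < \<epsilon>"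
    using grid_approximation[OF f t e] eventually_gt_at_top[of 0]
  proof eventually_elim
    case (elim n)
    define s where "s k = real k * (t / n)" for k
    have cell: "{s k..s (Suc k)} \<subseteq> {0..t}" if "k < n" for k
      using grid_cell_subset[OF t that] by (simp add: s_def)
    have step: "s (Suc k) - s k = t / n" for k
      by (simp add: s_def algebra_simps add_divide_distrib)
    have term_le: "\<bar>f (\<tau> n k) * (g (s (Suc k)) - g (s k)) - (\<Phi> (s (Suc k)) - \<Phi> (s k))\<bar> \<le> e * B * (t / n)"
      if k: "k < n" for k
    proof -
      have sk: "s k \<le> s (Suc k)" using step[of k] t by (smt (verit) divide_nonneg_nonneg of_nat_0_le_iff)
      have "norm ((f (\<tau> n k) * g (s (Suc k)) - \<Phi> (s (Suc k))) - (f (\<tau> n k) * g (s k) - \<Phi> (s k))) \<le>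
          e * B * norm (s (Suc k) - s k)"
      proof (rule field_differentiable_bound[where S = "{s k..s (Suc k)}" and f' = "\<lambda>u. (f (\<tau> n k) - f u) * g' u"])
        fix u assume u: "u \<in> {s k..s (Suc k)}"
        have ut: "u \<in> {0..t}" using cell[OF k] u by blast
        show "((\<lambda>u. f (\<tau> n k) * g u - \<Phi> u) has_field_derivative (f (\<tau> n k) - f u) * g' u) (at u within {s k..s (Suc k)})"
          by (rule DERIV_subset[OF _ cell[OF k]])
            (auto intro!: derivative_eq_intros g[OF ut] \<Phi>[OF ut] simp: algebra_simps)
        have "\<bar>f (\<tau> n k) - f u\<bar> \<le> e"
          using u \<tau>[OF k] by (intro elim(1)[rule_format, OF k]) (auto simp: s_def)
        then show "norm ((f (\<tau> n k) - f u) * g' u) \<le> e * B"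
          using B[OF ut] e by (auto simp: abs_mult intro!: mult_mono)
      qed (use sk in auto)
      then show ?thesis
        using step[of k] t by (simp add: algebra_simps)
    qed
    have "(\<Sum>k<n. f (\<tau> n k) * (g (s (Suc k)) - g (s k))) - (\<Phi> t - \<Phi> 0) =
        (\<Sum>k<n. f (\<tau> n k) * (g (s (Suc k)) - g (s k)) - (\<Phi> (s (Suc k)) - \<Phi> (s k)))"
    proof -
      have "(\<Sum>k<n. \<Phi> (s (Suc k)) - \<Phi> (s k)) = \<Phi> t - \<Phi> 0"
        using elim(2) by (subst sum_lessThan_telescope) (simp add: s_def)
      then show ?thesis by (simp only: sum_subtractf)
    qed
    also have "\<bar>\<dots>\<bar> \<le> (\<Sum>k<n. e * B * (t / n))"
      by (rule order_trans[OF sum_abs]) (intro sum_mono term_le, simp)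
    also have "\<dots> = e * B * t"
      using elim(2) by simp
    finally show ?case
      using eB by (simp add: s_def)
  qed
  then show "\<exists>no. \<forall>n\<ge>no. norm ((\<Sum>k<n. f (\<tau> n k) * (g (real (Suc k) * (t / n)) - g (real k * (t / n)))) - (\<Phi> t - \<Phi> 0)) < \<epsilon>"
    by (simp add: eventually_sequentially)
qed

text \<open>A noise path is merely continuous and is no admissible integrator, so Abel summation
  moves the differences onto the smooth \<open>g\<close>. The samples of \<open>f\<close> then sit
  at right end points, which the free tags of \<open>riemann_stieltjes_sum_tendsto\<close>
  permit.\<close>

lemma riemann_stieltjes_sum_by_parts_tendsto:
  fixes f g g' \<Phi> :: "real \<Rightarrow> real"
  assumes f: "continuous_on {0..t} f" and t: "0 < t"
    and g: "\<And>s. s \<in> {0..t} \<Longrightarrow> (g has_real_derivative g' s) (at s within {0..t})"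
    and B: "\<And>s. s \<in> {0..t} \<Longrightarrow> \<bar>g' s\<bar> \<le> B"
    and \<Phi>: "\<And>s. s \<in> {0..t} \<Longrightarrow> (\<Phi> has_real_derivative f s * g' s) (at s within {0..t})"
  shows "(\<lambda>n. \<Sum>k<n. g (real k * (t / n)) * (f (real (Suc k) * (t / n)) - f (real k * (t / n))))
    \<longlonglongrightarrow> g t * f t - g 0 * f 0 - (\<Phi> t - \<Phi> 0)"
proof -
  let ?s = "\<lambda>n k. real k * (t / real n)"
  have parts: "(\<Sum>k<n. g (?s n k) * (f (?s n (Suc k)) - f (?s n k))) =
      g (?s n n) * f (?s n n) - g 0 * f 0 - (\<Sum>k<n. f (?s n (Suc k)) * (g (?s n (Suc k)) - g (?s n k)))" for n
  proof -
    have "(\<Sum>k<n. g (?s n k) * (f (?s n (Suc k)) - f (?s n k))) + (\<Sum>k<n. f (?s n (Suc k)) * (g (?s n (Suc k)) - g (?s n k))) =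
        (\<Sum>k<n. g (?s n (Suc k)) * f (?s n (Suc k)) - g (?s n k) * f (?s n k))"
      unfolding sum.distrib[symmetric] by (intro sum.cong refl) (simp add: algebra_simps)
    also have "\<dots> = g (?s n n) * f (?s n n) - g 0 * f 0"
      by (subst sum_lessThan_telescope[of "\<lambda>k. g (?s n k) * f (?s n k)"]) simp
    finally show ?thesis by linarith
  qed
  have "(\<lambda>n. \<Sum>k<n. f (?s n (Suc k)) * (g (?s n (Suc k)) - g (?s n k))) \<longlonglongrightarrow> \<Phi> t - \<Phi> 0"
    by (rule riemann_stieltjes_sum_tendsto[OF f t g B \<Phi>])
      (simp_all add: grid_le_Suc t del: of_nat_Suc times_divide_eq_right)
  moreover have "(\<lambda>n. g (?s n n) * f (?s n n) - g 0 * f 0) \<longlonglongrightarrow> g t * f t - g 0 * f 0"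
    by (rule tendsto_eventually) (rule eventually_mono[OF eventually_gt_at_top[of 0]], simp)
  ultimately show ?thesis
    unfolding parts by (rule tendsto_diff[rotated])
qed

section \<open>The resolvent kernel, its energy, and variation of constants\<close>

lemma resolvent_kernel_exists:
  fixes a r :: real
  assumes "a < 0" "0 < r"
  shows "\<exists>P C. P 0 = 0 \<and> (\<forall>t. (P has_real_derivative exp (a * t) - r * P t) (at t)) \<and>
    (\<forall>t\<ge>0. \<bar>P t\<bar> \<le> C)"
\<comment> \<open>\<open>P t\<close> is the convolution of \<open>exp (a * s)\<close> and
  \<open>exp (- r * s)\<close> over \<open>[0, t]\<close>, whose closed form degenerates for
  \<open>a + r = 0\<close>. Only the differential equation, the initial value and the bound are
  passed on, so the distinction ends here.\<close>
proof (cases "a + r = 0")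
  case True
  define P where "P t = t * exp (a * t)" for t
  have r: "r = - a" using True by linarith
  have "\<bar>P t\<bar> \<le> 1 / - a" if "0 \<le> t" for t
  proof -
    have "- a * t \<le> exp (- a * t)"
      using exp_ge_add_one_self[of "- a * t"] by simp
    then have "- a * t * exp (a * t) \<le> exp (- a * t) * exp (a * t)"
      by (rule mult_right_mono) simp
    also have "\<dots> = 1" by (simp add: exp_add[symmetric])
    finally show ?thesis
      using that assms by (simp add: P_def abs_mult field_simps)
  qed
  moreover have "(P has_real_derivative exp (a * t) - r * P t) (at t)" for t
    unfolding P_def r by (auto intro!: derivative_eq_intros simp: algebra_simps)
  ultimately show ?thesis
    by (intro exI[of _ P] exI[of _ "1 / - a"]) (auto simp: P_def)
next
  case False
  define P where "P t = (exp (a * t) - exp (- r * t)) / (a + r)" for t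
  have "\<bar>P t\<bar> \<le> 1 / \<bar>a + r\<bar>" if "0 \<le> t" for t
  proof -
    have "exp (a * t) \<le> 1" "exp (- r * t) \<le> 1"
      using that assms by (auto simp: mult_nonpos_nonneg)
    then have "\<bar>exp (a * t) - exp (- r * t)\<bar> \<le> 1"
      using exp_gt_zero[of "a * t"] exp_gt_zero[of "- r * t"] by linarith
    then show ?thesis
      using False by (simp add: P_def divide_right_mono)
  qed
  moreover have "(P has_real_derivative exp (a * t) - r * P t) (at t)" for t
  proof -
    have "(P has_real_derivative (exp (a * t) * a - exp (- r * t) * - r) / (a + r)) (at t)"
      unfolding P_def using False by (auto intro!: derivative_eq_intros)
    also have "(exp (a * t) * a - exp (- r * t) * - r) / (a + r) = exp (a * t) - r * P t"
      using False by (simp add: P_def field_simps)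
    finally show ?thesis .
  qed
  ultimately show ?thesis
    by (intro exI[of _ P] exI[of _ "1 / \<bar>a + r\<bar>"]) (auto simp: P_def)
qed

lemma quadratic_form_nonneg:
  fixes \<alpha> \<beta> \<gamma> :: real
  assumes "0 \<le> \<alpha>" "0 \<le> \<gamma>" "\<beta>\<^sup>2 \<le> 4 * \<alpha> * \<gamma>"
  shows "0 \<le> \<alpha> * x\<^sup>2 + \<beta> * x * y + \<gamma> * y\<^sup>2"
\<comment> \<open>With \<open>\<gamma> = 0\<close> the discriminant condition forces
  \<open>\<beta> = 0\<close>; otherwise the square is completed in \<open>y\<close>.\<close>
proof (cases "\<gamma> = 0")
  case True
  then show ?thesis using assms by simp
next
  case False
  have "4 * \<gamma> * (\<alpha> * x\<^sup>2 + \<beta> * x * y + \<gamma> * y\<^sup>2) = (2 * \<gamma> * y + \<beta> * x)\<^sup>2 + (4 * \<alpha> * \<gamma> - \<beta>\<^sup>2) * x\<^sup>2"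
    by (simp add: power2_eq_square algebra_simps)
  also have "\<dots> \<ge> 0"
    using assms by (intro add_nonneg_nonneg mult_nonneg_nonneg) auto
  finally show ?thesis
    using False assms by (simp add: zero_le_mult_iff)
qed

text \<open>The closed form of the integral of
  \<open>(c\<^sub>1 * exp (a * s) + c\<^sub>2 * r * P s)\<^sup>2\<close> over all
  \<open>s \<ge> 0\<close>. It has no denominator \<open>a + r\<close> and so covers both forms of
  \<open>P\<close>. Taking it as a formula avoids the improper integral: only the estimate on finite
  intervals is proved.\<close>

definition kernel_energy :: "real \<Rightarrow> real \<Rightarrow> real \<Rightarrow> real \<Rightarrow> real" where
  "kernel_energy a r c\<^sub>1 c\<^sub>2 = (c\<^sub>1\<^sup>2 + r * (2 * c\<^sub>1 * c\<^sub>2 + c\<^sub>2\<^sup>2) / (r - a)) / (- 2 * a)"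

text \<open>An antiderivative of the squared kernel is found as a quadratic form in \<open>exp (a s)\<close> and \<open>P s\<close>.\<close>

lemma kernel_square_sum_tendsto:
  fixes a r c\<^sub>1 c\<^sub>2 t :: real
  assumes "a < 0" "0 < r" "0 < t" and P0: "P 0 = 0"
    and P: "\<And>s. (P has_real_derivative exp (a * s) - r * P s) (at s)"
  defines "G \<equiv> \<lambda>s. c\<^sub>1 * exp (a * s) + c\<^sub>2 * r * P s"
  obtains L where "(\<lambda>n. \<Sum>k<n. (G (t - real k * (t / n)))\<^sup>2 * (t / n)) \<longlonglongrightarrow> L" "L \<le> kernel_energy a r c\<^sub>1 c\<^sub>2"
    "0 \<le> kernel_energy a r c\<^sub>1 c\<^sub>2"
proof -
  \<comment> \<open>The coefficients are chosen so that \<open>V\<close> has derivative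
    \<open>- (G s)\<^sup>2\<close>: comparing those of \<open>(P s)\<^sup>2\<close>,
    \<open>exp (a * s) * P s\<close> and \<open>(exp (a * s))\<^sup>2\<close> determines first
    \<open>\<gamma>\<close>, then \<open>\<beta>\<close>, then \<open>\<alpha>\<close>.\<close>
  define \<gamma> where "\<gamma> = c\<^sub>2\<^sup>2 * r / 2"
  define \<beta> where "\<beta> = r * (2 * c\<^sub>1 * c\<^sub>2 + c\<^sub>2\<^sup>2) / (r - a)"
  define \<alpha> where "\<alpha> = kernel_energy a r c\<^sub>1 c\<^sub>2"
  have \<alpha>_eq: "- 2 * a * \<alpha> = c\<^sub>1\<^sup>2 + \<beta>"
    using assms(1) by (simp add: \<alpha>_def kernel_energy_def \<beta>_def)
  have \<beta>_eq: "(r - a) * \<beta> = r * (2 * c\<^sub>1 * c\<^sub>2 + c\<^sub>2\<^sup>2)"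
    using assms by (simp add: \<beta>_def)
  \<comment> \<open>Up to a positive factor the discriminant gap is a nonnegative multiple of a
    square; this will make the quadratic form \<open>V\<close> nonnegative.\<close>
  have disc: "(r - a)\<^sup>2 * (- 2 * a) * (4 * \<alpha> * \<gamma> - \<beta>\<^sup>2) = 2 * c\<^sub>2\<^sup>2 * r * (c\<^sub>1 * (r + a) + c\<^sub>2 * r)\<^sup>2"
  proof -
    have "(r - a)\<^sup>2 * (- 2 * a) * (4 * \<alpha> * \<gamma> - \<beta>\<^sup>2) =
        (r - a)\<^sup>2 * 4 * \<gamma> * (- 2 * a * \<alpha>) + 2 * a * ((r - a) * \<beta>)\<^sup>2"
      by (simp add: power2_eq_square algebra_simps)
    also have "\<dots> = 4 * \<gamma> * ((r - a)\<^sup>2 * c\<^sub>1\<^sup>2 + (r - a) * ((r - a) * \<beta>)) + 2 * a * ((r - a) * \<beta>)\<^sup>2"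
      unfolding \<alpha>_eq by (simp add: power2_eq_square algebra_simps)
    also have "\<dots> = 2 * c\<^sub>2\<^sup>2 * r * (c\<^sub>1 * (r + a) + c\<^sub>2 * r)\<^sup>2"
      unfolding \<beta>_eq \<gamma>_def by (simp add: power2_eq_square algebra_simps)
    finally show ?thesis .
  qed
  have pos: "0 < (r - a)\<^sup>2 * (- 2 * a)"
  proof (rule mult_pos_pos)
    have "0 < r - a" using assms(1,2) by linarith
    then show "0 < (r - a)\<^sup>2" by simp
  qed (use assms(1) in simp)
  have "0 \<le> 2 * c\<^sub>2\<^sup>2 * r * (c\<^sub>1 * (r + a) + c\<^sub>2 * r)\<^sup>2"
    using assms by simp
  then have \<beta>2: "\<beta>\<^sup>2 \<le> 4 * \<alpha> * \<gamma>"
    using pos mult_pos_neg[of "(r - a)\<^sup>2 * (- 2 * a)" "4 * \<alpha> * \<gamma> - \<beta>\<^sup>2"] unfolding disc[symmetric] by linarith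
  \<comment> \<open>The cross term \<open>2 * c\<^sub>1 * c\<^sub>2\<close> may be negative, so for
    \<open>c\<^sub>2 \<noteq> 0\<close> the sign is read off from the discriminant and not from the
    formula.\<close>
  have \<alpha>0: "0 \<le> \<alpha>"
  proof (cases "c\<^sub>2 = 0")
    case True
    then show ?thesis using assms by (simp add: \<alpha>_def kernel_energy_def divide_nonneg_neg)
  next
    case False
    then have "0 < \<gamma>" using assms by (simp add: \<gamma>_def)
    have "0 \<le> 4 * \<alpha> * \<gamma>" using \<beta>2 zero_le_power2[of \<beta>] by linarith
    then show ?thesis using \<open>0 < \<gamma>\<close> by (simp add: zero_le_mult_iff)
  qed
  define V where "V s = \<alpha> * (exp (a * s))\<^sup>2 + \<beta> * exp (a * s) * P s + \<gamma> * (P s)\<^sup>2" for s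
  \<comment> \<open>Nonnegativity bounds the integral \<open>V 0 - V t\<close> by
    \<open>V 0 = \<alpha>\<close> without a limit at infinity.\<close>
  have V0: "0 \<le> V s" for s
    unfolding V_def using \<alpha>0 \<beta>2 assms by (intro quadratic_form_nonneg) (auto simp: \<gamma>_def)
  have dV: "(V has_real_derivative - (G s)\<^sup>2) (at s)" for s
  proof -
    let ?E = "exp (a * s)"
    have "(V has_real_derivative \<alpha> * (2 * ?E * (?E * a)) + \<beta> * (?E * a * P s + ?E * (?E - r * P s)) +
        \<gamma> * (2 * P s * (?E - r * P s))) (at s)"
      unfolding V_def by (auto intro!: derivative_eq_intros P simp: algebra_simps)
    also have "\<alpha> * (2 * ?E * (?E * a)) + \<beta> * (?E * a * P s + ?E * (?E - r * P s)) + \<gamma> * (2 * P s * (?E - r * P s))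
        = - (- 2 * a * \<alpha> - \<beta>) * ?E\<^sup>2 - ((r - a) * \<beta> - 2 * \<gamma>) * ?E * P s - 2 * r * \<gamma> * (P s)\<^sup>2"
      by (simp add: power2_eq_square algebra_simps)
    also have "\<dots> = - (G s)\<^sup>2"
      unfolding \<alpha>_eq \<beta>_eq \<gamma>_def G_def by (simp add: power2_eq_square algebra_simps)
    finally show ?thesis .
  qed
  have dP: "continuous_on A P" for A
    using P by (intro DERIV_continuous_on[where D = "\<lambda>s. exp (a * s) - r * P s"]) (auto intro: DERIV_subset)
  have "(\<lambda>n. \<Sum>k<n. (G (t - real k * (t / n)))\<^sup>2 * (real (Suc k) * (t / n) - real k * (t / n))) \<longlonglongrightarrow> V (t - t) - V (t - 0)"
  proof (rule riemann_stieltjes_sum_tendsto[where f = "\<lambda>s. (G (t - s))\<^sup>2" and g = "\<lambda>s. s" and g' = "\<lambda>_. 1"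
        and \<Phi> = "\<lambda>s. V (t - s)" and B = 1])
    show "continuous_on {0..t} (\<lambda>s. (G (t - s))\<^sup>2)"
      unfolding G_def by (intro continuous_intros continuous_on_compose2[OF dP[of UNIV]]) auto
    show "((\<lambda>s. V (t - s)) has_real_derivative (G (t - s))\<^sup>2 * 1) (at s within {0..t})" for s
      using DERIV_chain2[where f = V and g = "\<lambda>s. t - s", OF dV, of "-1" s "{0..t}"]
        DERIV_diff[OF DERIV_const DERIV_ident, of t s "{0..t}"] by simp
  qed (simp_all add: grid_le_Suc \<open>0 < t\<close> del: of_nat_Suc times_divide_eq_right)
  moreover have "real (Suc k) * (t / real n) - real k * (t / real n) = t / real n" for k n
    by (simp add: algebra_simps add_divide_distrib)
  ultimately have "(\<lambda>n. \<Sum>k<n. (G (t - real k * (t / n)))\<^sup>2 * (t / n)) \<longlonglongrightarrow> V 0 - V t"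
    by simp
  moreover have "V 0 = \<alpha>" by (simp add: V_def P0)
  ultimately show thesis
    using V0[of t] \<alpha>0 by (intro that[of "V 0 - V t"]) (auto simp: \<alpha>_def)
qed

text \<open>Variation of constants: the sums converge to the integral of the kernel
  \<open>c\<^sub>1 exp (a (t - s)) + c\<^sub>2 r P (t - s)\<close> against the noise \<open>X - x\<^sub>0 - a Q\<close>; the antiderivative used here
  is a combination of products of \<open>Q\<close>, \<open>Y\<close> and the two components of the kernel.\<close>

lemma variation_of_constants_sum_tendsto:
  fixes a r c\<^sub>1 c\<^sub>2 t x\<^sub>0 :: real and X Y Q P :: "real \<Rightarrow> real"
  assumes "a < 0" "0 < r" and t: "0 < t" and P0: "P 0 = 0"
    and P: "\<And>s. (P has_real_derivative exp (a * s) - r * P s) (at s)"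
    and X: "continuous_on {0..t} X" "X 0 = x\<^sub>0"
    and Q: "\<And>s. s \<in> {0..t} \<Longrightarrow> (Q has_real_derivative X s) (at s within {0..t})" "Q 0 = 0"
    and Y: "\<And>s. s \<in> {0..t} \<Longrightarrow> (Y has_real_derivative r * (X s - Y s)) (at s within {0..t})"
  defines "G \<equiv> \<lambda>s. c\<^sub>1 * exp (a * s) + c\<^sub>2 * r * P s" and "I \<equiv> \<lambda>s. X s - x\<^sub>0 - a * Q s"
  shows "(\<lambda>n. \<Sum>k<n. G (t - real k * (t / n)) * (I (real (Suc k) * (t / n)) - I (real k * (t / n))))
    \<longlonglongrightarrow> c\<^sub>1 * X t + c\<^sub>2 * Y t - x\<^sub>0 * G t - c\<^sub>2 * Y 0 * (exp (a * t) - (r + a) * P t)"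
proof -
  let ?E = "\<lambda>s. exp (a * (t - s))" and ?P = "\<lambda>s. P (t - s)"
  define g' where "g' s = - (c\<^sub>1 * a * ?E s + c\<^sub>2 * r * (?E s - r * ?P s))" for s
  \<comment> \<open>\<open>exp (a * s) - (r + a) * P s\<close> is \<open>exp (- r * s)\<close>.
    Taken at \<open>t - s\<close> it is an integrating factor for the equation of \<open>Y\<close>:
    its product with \<open>Y s\<close> has derivative \<open>r * X s\<close> times it. This absorbs
    the occurrences of \<open>X\<close> that remain after the terms with \<open>Q\<close> are
    integrated by parts.\<close>
  define \<Phi> where "\<Phi> s = - c\<^sub>1 * (a * Q s * ?E s + x\<^sub>0 * ?E s) -
     c\<^sub>2 * (a * r * Q s * ?P s + Y s * ?E s - (r + a) * Y s * ?P s + x\<^sub>0 * r * ?P s)" for s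
  have cQ: "continuous_on {0..t} Q"
    using Q(1) by (intro DERIV_continuous_on) auto
  have cP: "continuous_on A P" for A
    using P by (intro DERIV_continuous_on[where D = "\<lambda>s. exp (a * s) - r * P s"]) (auto intro: DERIV_subset)
  have cI: "continuous_on {0..t} I"
    unfolding I_def by (intro continuous_intros X cQ)
  have dE: "(?E has_real_derivative - a * ?E s) (at s within {0..t})" for s
    by (auto intro!: derivative_eq_intros)
  have dP: "(?P has_real_derivative - (?E s - r * ?P s)) (at s within {0..t})" for s
    using DERIV_chain2[where f = P and g = "\<lambda>s. t - s", OF P, of "-1" s "{0..t}"] DERIV_diff[OF DERIV_const DERIV_ident, of t s "{0..t}"]
    by simp
  have "continuous_on {0..t} g'"
    unfolding g'_def by (intro continuous_intros continuous_on_compose2[OF cP[of UNIV]]) auto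
  then have "bounded (g' ` {0..t})"
    by (intro compact_imp_bounded compact_continuous_image) auto
  then obtain B where "\<forall>s\<in>{0..t}. \<bar>g' s\<bar> \<le> B"
    by (auto simp: bounded_iff)
  then have B: "\<bar>g' s\<bar> \<le> B" if "s \<in> {0..t}" for s
    using that by blast
  have "(\<lambda>n. \<Sum>k<n. G (t - real k * (t / n)) * (I (real (Suc k) * (t / n)) - I (real k * (t / n))))
    \<longlonglongrightarrow> G (t - t) * I t - G (t - 0) * I 0 - (\<Phi> t - \<Phi> 0)"
  proof (rule riemann_stieltjes_sum_by_parts_tendsto[OF cI t _ B, where g = "\<lambda>s. G (t - s)"])
    fix s assume s: "s \<in> {0..t}"
    show "((\<lambda>s. G (t - s)) has_real_derivative g' s) (at s within {0..t})"
      unfolding G_def g'_def by (auto intro!: derivative_eq_intros dE dP simp: algebra_simps)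
    have "(\<Phi> has_real_derivative
       - c\<^sub>1 * (a * (X s * ?E s + Q s * (- a * ?E s)) + x\<^sub>0 * (- a * ?E s)) -
       c\<^sub>2 * (a * r * (X s * ?P s + Q s * - (?E s - r * ?P s)) + (r * (X s - Y s) * ?E s + Y s * (- a * ?E s))
         - (r + a) * (r * (X s - Y s) * ?P s + Y s * - (?E s - r * ?P s)) + x\<^sub>0 * r * - (?E s - r * ?P s))) (at s within {0..t})"
      unfolding \<Phi>_def by (auto intro!: derivative_eq_intros dE dP Q(1)[OF s] Y[OF s] simp: algebra_simps)
    also have "- c\<^sub>1 * (a * (X s * ?E s + Q s * (- a * ?E s)) + x\<^sub>0 * (- a * ?E s)) -
       c\<^sub>2 * (a * r * (X s * ?P s + Q s * - (?E s - r * ?P s)) + (r * (X s - Y s) * ?E s + Y s * (- a * ?E s))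
         - (r + a) * (r * (X s - Y s) * ?P s + Y s * - (?E s - r * ?P s)) + x\<^sub>0 * r * - (?E s - r * ?P s)) = I s * g' s"
      unfolding I_def g'_def by (simp add: algebra_simps)
    finally show "(\<Phi> has_real_derivative I s * g' s) (at s within {0..t})" .
  qed
  also have "G (t - t) * I t - G (t - 0) * I 0 - (\<Phi> t - \<Phi> 0) =
     c\<^sub>1 * X t + c\<^sub>2 * Y t - x\<^sub>0 * G t - c\<^sub>2 * Y 0 * (exp (a * t) - (r + a) * P t)"
    using X(2) Q(2) by (simp add: \<Phi>_def G_def I_def P0 algebra_simps)
  finally show ?thesis .
qed

section \<open>The delay integral for the exponential kernel\<close>

lemma exponential_kernel_integral:
  fixes r :: real
  assumes "0 < r"
  shows "set_integrable lborel {0..} (\<lambda>s. r * exp (- r * s))"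
    and "(LINT s:{0..}|lborel. r * exp (- r * s)) = 1"
proof -
  have "has_bochner_integral lborel (\<lambda>x. x ^ 0 * exp (- x) * indicator {0..} x) (fact 0 :: real)"
    by (rule has_bochner_integral_I0i_power_exp_m')
  then have "has_bochner_integral lborel (\<lambda>x. exp (- x) * indicator {0..} x) (1 :: real)"
    by simp
  then have "has_bochner_integral lborel (\<lambda>s. exp (- (0 + r * s)) * indicator {0..} (0 + r * s)) (1 /\<^sub>R \<bar>r\<bar>)"
    using assms by (subst (asm) lborel_has_bochner_integral_real_affine_iff[of r _ _ 0]) auto
  then have "has_bochner_integral lborel (\<lambda>s. r * (exp (- (0 + r * s)) * indicator {0..} (0 + r * s))) (r * (1 /\<^sub>R \<bar>r\<bar>))"
    by (rule has_bochner_integral_mult_right)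
  also have "(\<lambda>s. r * (exp (- (0 + r * s)) * indicator {0..} (0 + r * s))) = (\<lambda>s. indicat_real {0..} s *\<^sub>R (r * exp (- r * s)))"
    using assms by (auto simp: fun_eq_iff indicator_def zero_le_mult_iff)
  also have "r * (1 /\<^sub>R \<bar>r\<bar>) = 1"
    using assms by simp
  finally have "has_bochner_integral lborel (\<lambda>s. indicat_real {0..} s *\<^sub>R (r * exp (- r * s))) 1" .
  then show "set_integrable lborel {0..} (\<lambda>s. r * exp (- r * s))"
    and "(LINT s:{0..}|lborel. r * exp (- r * s)) = 1"
    unfolding set_integrable_def set_lebesgue_integral_def has_bochner_integral_iff by blast+
qed

text \<open>Since \<open>K (t + v) = exp (- r * t) * K v\<close>, the part of the integral that
  reaches back before time \<open>0\<close> is the initial delay scaled by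
  \<open>exp (- r * t)\<close>; the part over \<open>[0, t]\<close> is reflected by
  \<open>s = t - u\<close>.\<close>

lemma delay_integral_eq:
  fixes K x :: "real \<Rightarrow> real" and r t :: real
  assumes K: "\<And>s. 0 \<le> s \<Longrightarrow> K s = r * exp (- r * s)" and t: "0 \<le> t"
    and x: "continuous_on {0..} x"
    and int: "set_integrable lborel {0..} (\<lambda>s. K s * x (t - s))"
  shows "(LINT s:{0..}|lborel. K s * x (t - s)) =
    exp (- r * t) * ((LINT s:{0..}|lborel. K s * x (0 - s)) + r * integral {0..t} (\<lambda>u. exp (r * u) * x u))"
proof -
  have split: "{0..} = {0..t} \<union> {t..}" using t by auto
  have i: "set_integrable lborel {0..t} (\<lambda>s. K s * x (t - s))" "set_integrable lborel {t..} (\<lambda>s. K s * x (t - s))"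
    by (rule set_integrable_subset[OF int]; use t in auto)+
  have "AE s in lborel. \<not> (s \<in> {0..t} \<and> s \<in> {t..})"
    using AE_lborel_singleton[of t] by eventually_elim auto
  then have "(LINT s:{0..}|lborel. K s * x (t - s)) =
      (LINT s:{0..t}|lborel. K s * x (t - s)) + (LINT s:{t..}|lborel. K s * x (t - s))"
    unfolding split by (rule set_integral_Un_AE) (use i in auto)
  also have "(LINT s:{0..t}|lborel. K s * x (t - s)) = (LINT u:{0..t}|lborel. r * exp (- r * t) * (exp (r * u) * x u))"
  proof -
    have "(LINT u:{0..t}|lborel. r * exp (- r * t) * (exp (r * u) * x u)) =
        \<bar>-1\<bar> *\<^sub>R (LINT s|lborel. indicator {0..t} (t + -1 * s) *\<^sub>R (r * exp (- r * t) * (exp (r * (t + -1 * s)) * x (t + -1 * s))))"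
      unfolding set_lebesgue_integral_def by (rule lborel_integral_real_affine) simp
    also have "\<dots> = (LINT s|lborel. indicator {0..t} s *\<^sub>R (K s * x (t - s)))"
      unfolding abs_minus abs_one scaleR_one
    proof (rule Bochner_Integration.integral_cong[OF refl])
      fix s
      have "exp (- r * s) = exp (- r * t) * exp (r * (t - s))"
        by (simp add: exp_add[symmetric] algebra_simps)
      then have "K s = r * exp (- r * t) * exp (r * (t - s))" if "0 \<le> s"
        using K[OF that] by simp
      then show "indicator {0..t} (t + -1 * s) *\<^sub>R (r * exp (- r * t) * (exp (r * (t + -1 * s)) * x (t + -1 * s))) =
          indicator {0..t} s *\<^sub>R (K s * x (t - s))"
        by (cases "s \<in> {0..t}") (auto simp: indicator_def)
    qed
    finally show ?thesis by (simp add: set_lebesgue_integral_def)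
  qed
  also have "\<dots> = r * exp (- r * t) * integral {0..t} (\<lambda>u. exp (r * u) * x u)"
  proof -
    have "continuous_on {0..t} (\<lambda>u. exp (r * u) * x u)"
      by (intro continuous_intros continuous_on_subset[OF x]) auto
    then have "set_integrable lborel {0..t} (\<lambda>u. exp (r * u) * x u)"
      by (rule borel_integrable_atLeastAtMost')
    then show ?thesis
      by (simp add: set_borel_integral_eq_integral)
  qed
  also have "(LINT s:{t..}|lborel. K s * x (t - s)) = exp (- r * t) * (LINT s:{0..}|lborel. K s * x (0 - s))"
  proof -
    have "(LINT s:{t..}|lborel. K s * x (t - s)) =
        \<bar>1\<bar> *\<^sub>R (LINT v|lborel. indicator {t..} (t + 1 * v) *\<^sub>R (K (t + 1 * v) * x (t - (t + 1 * v))))"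
      unfolding set_lebesgue_integral_def by (rule lborel_integral_real_affine) simp
    also have "\<dots> = (LINT v|lborel. exp (- r * t) * (indicator {0..} v *\<^sub>R (K v * x (0 - v))))"
      unfolding abs_one scaleR_one using t
      by (intro Bochner_Integration.integral_cong refl)
        (auto simp: indicator_def K exp_add[symmetric] algebra_simps)
    finally show ?thesis by (simp add: set_lebesgue_integral_def)
  qed
  finally show ?thesis
    by (simp add: algebra_simps)
qed

text \<open>The formula of \<open>delay_integral_eq\<close> is differentiated in \<open>t\<close>.
  An exponential delay thus amounts to one more state variable with a linear differential
  equation.\<close>

lemma delay_integral_derivative:
  fixes K x :: "real \<Rightarrow> real" and r T :: real
  assumes K: "\<And>s. 0 \<le> s \<Longrightarrow> K s = r * exp (- r * s)" and x: "continuous_on {0..} x"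
    and int: "\<And>t. 0 \<le> t \<Longrightarrow> set_integrable lborel {0..} (\<lambda>s. K s * x (t - s))"
    and s: "s \<in> {0..T}"
  defines "Y \<equiv> \<lambda>t. LINT s:{0..}|lborel. K s * x (t - s)"
  shows "(Y has_real_derivative r * (x s - Y s)) (at s within {0..T})"
proof -
  define Z where "Z t = integral {0..t} (\<lambda>u. exp (r * u) * x u)" for t
  have Y: "Y t = exp (- r * t) * (Y 0 + r * Z t)" if "0 \<le> t" for t
    using delay_integral_eq[OF K that x int[OF that]] by (simp add: Y_def Z_def)
  have "continuous_on {0..T} (\<lambda>u. exp (r * u) * x u)"
    by (intro continuous_intros continuous_on_subset[OF x]) auto
  from integral_has_real_derivative[OF this s]
  have dZ: "(Z has_real_derivative exp (r * s) * x s) (at s within {0..T})"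
    by (simp add: Z_def[abs_def])
  have "((\<lambda>t. exp (- r * t) * (Y 0 + r * Z t)) has_real_derivative
      exp (- r * s) * - r * (Y 0 + r * Z s) + exp (- r * s) * (r * (exp (r * s) * x s))) (at s within {0..T})"
    by (auto intro!: derivative_eq_intros dZ)
  also have "exp (- r * s) * - r * (Y 0 + r * Z s) + exp (- r * s) * (r * (exp (r * s) * x s)) = r * (x s - Y s)"
    using s by (simp add: Y[of s] algebra_simps exp_minus)
  finally show ?thesis
    by (rule has_field_derivative_transform_within[where d = 1]) (use s Y[symmetric] in auto)
qed

section \<open>The isometry for kernel-weighted sums of Ito increments\<close>

context wiener_process
begin

text \<open>The weights \<open>g k\<close> belong to the coarse times \<open>k * c\<close>; each
  coarse cell is split into \<open>Suc m\<close> fine cells, on which left-endpoint sums of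
  \<open>H\<close> approximate the integrals. All \<open>I k\<close> use the same fine grid, so
  \<open>I (Suc k) - I k\<close> is the limit of the sums over one block, and additivity of the
  integral in time is not proved separately. For fixed \<open>m\<close> the isometry is applied to
  the truncated sums; convergence in probability and Fatou's lemma then carry the bound
  over.\<close>

lemma kernel_sum_bound:
  fixes H :: "real \<Rightarrow> 'w \<Rightarrow> real" and I :: "nat \<Rightarrow> 'w \<Rightarrow> real" and g :: "nat \<Rightarrow> real" and c d B S :: real
  assumes c: "0 < c" and n: "0 < n"
    and ito: "\<And>k. 0 < k \<Longrightarrow> k \<le> n \<Longrightarrow> has_ito_integral M F W H (real k * c) (I k)"
    and I0: "I 0 = (\<lambda>_. 0)"
    and cont: "AE \<omega> in M. continuous_on {0..real n * c} (\<lambda>s. H s \<omega>)"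
    and A: "\<And>u. u \<in> {0..real n * c} \<Longrightarrow> A u \<in> sets (F u)"
    and A_mono: "AE \<omega> in M. \<omega> \<in> A (real n * c) \<longrightarrow> (\<forall>u\<in>{0..real n * c}. \<omega> \<in> A u)"
    and B: "\<And>u \<omega>. u \<in> {0..real n * c} \<Longrightarrow> \<omega> \<in> A u \<Longrightarrow> \<bar>H u \<omega>\<bar> \<le> B"
    and S: "\<And>u. u \<in> {0..real n * c} \<Longrightarrow> expectation (\<lambda>\<omega>. indicator (A u) \<omega> * (H u \<omega>)\<^sup>2) \<le> S"
  shows "(\<integral>\<^sup>+\<omega>\<in>A (real n * c). ennreal ((d + (\<Sum>k<n. g k * (I (Suc k) \<omega> - I k \<omega>)))\<^sup>2) \<partial>M) \<le>
    ennreal (d\<^sup>2 + S * (\<Sum>k<n. (g k)\<^sup>2 * c))"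
proof -
  define T where "T = real n * c"
  have H: "progressively_measurable F T H"
    using ito[OF n order_refl] by (simp add: has_ito_integral_def T_def)
  define p where "p m j = real j * (c / real (Suc m))" for m j
  define R where "R m k = simple_integral_W W (k * Suc m) (p m) (\<lambda>j. H (p m j))" for m k
  have p_step: "p m (Suc j) - p m j = c / real (Suc m)" for m j
    by (simp add: p_def algebra_simps add_divide_distrib)
  have p_le: "p m j \<le> p m (Suc j)" for m j
    using p_step[of m j] c by (smt (verit) divide_nonneg_nonneg of_nat_0_le_iff)
  have p_range: "p m j \<in> {0..T}" if "j \<le> n * Suc m" for m j
  proof -
    have "real j * (c / real (Suc m)) \<le> real (n * Suc m) * (c / real (Suc m))"
      using that c by (intro mult_right_mono) (auto simp del: of_nat_Suc of_nat_mult)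
    also have "\<dots> = T" unfolding of_nat_mult T_def by (simp del: of_nat_Suc)
    finally show ?thesis using c by (simp add: p_def)
  qed
  have p0: "p m 0 = 0" for m by (simp add: p_def)
  have H_meas: "H (p m j) \<in> borel_measurable (F (p m j))" if "j \<le> n * Suc m" for m j
    by (rule progressively_measurable_at[OF H p_range[OF that]])
  have R_meas: "R m k \<in> borel_measurable M" if "k \<le> n" for m k
  proof -
    have "j \<le> n * Suc m" if "j < k * Suc m" for j
      using that \<open>k \<le> n\<close> by (meson le_trans less_imp_le mult_le_mono1)
    then show ?thesis
      unfolding R_def by (intro measurable_F_M[OF simple_integral_measurable(1)]) (auto simp: p0 p_le intro: H_meas)
  qed
  have I_meas: "I k \<in> borel_measurable M" if "k \<le> n" for k
    using ito[of k] that by (cases "k = 0") (auto simp: I0 has_ito_integral_def)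
  have R_lim: "tendsto_in_prob M (\<lambda>m. R m k) (I k)" if k: "k \<le> n" for k
  proof (cases "k = 0")
    case True
    then show ?thesis by (simp add: R_def I0 simple_integral_W_def tendsto_in_prob_def)
  next
    case False
    have sub: "{0..real k * c} \<subseteq> {0..real n * c}"
      using k c by (auto intro: order_trans[OF _ mult_right_mono])
    have lim: "tendsto_in_prob M (\<lambda>N. simple_integral_W W N (\<lambda>j. real j * (real k * c / N)) (\<lambda>j. H (real j * (real k * c / N)))) (I k)"
    proof (rule grid_integral_tendsto_in_prob[OF ito])
      show "AE \<omega> in M. continuous_on {0..real k * c} (\<lambda>s. H s \<omega>)"
        using cont by eventually_elim (rule continuous_on_subset[OF _ sub])
    qed (use False k c in auto)
    have "filterlim (\<lambda>m. k * Suc m) at_top sequentially"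
      using False by (intro filterlim_subseq) (auto simp: strict_mono_def)
    note sub_seq = this
    \<comment> \<open>The uniform grid with \<open>k * Suc m\<close> cells on
      \<open>[0, k * c]\<close> has mesh \<open>c / Suc m\<close>, independent of \<open>k\<close>:
      it is the initial part of the common fine grid.\<close>
    have R_eq: "R m k = simple_integral_W W (k * Suc m) (\<lambda>j. real j * (real k * c / real (k * Suc m)))
        (\<lambda>j. H (real j * (real k * c / real (k * Suc m))))" for m
    proof -
      have "real k * c / real (k * Suc m) = c / real (Suc m)"
        using False unfolding of_nat_mult by (simp del: of_nat_Suc)
      then show ?thesis by (simp only: R_def p_def[abs_def])
    qed
    show ?thesis
      unfolding R_eq by (rule tendsto_in_prob_compose[OF lim sub_seq])
  qed
  have lim: "tendsto_in_prob M (\<lambda>m \<omega>. d + (\<Sum>k<n. g k * (R m (Suc k) \<omega> - R m k \<omega>)))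
      (\<lambda>\<omega>. d + (\<Sum>k<n. g k * (I (Suc k) \<omega> - I k \<omega>)))"
  proof -
    have "tendsto_in_prob M (\<lambda>m \<omega>. g k * (R m (Suc k) \<omega> + (-1) * R m k \<omega>)) (\<lambda>\<omega>. g k * (I (Suc k) \<omega> + (-1) * I k \<omega>))"
      if "k < n" for k
      using that R_meas I_meas
      by (intro tendsto_in_prob_cmult tendsto_in_prob_add R_lim borel_measurable_times borel_measurable_const) auto
    then have "tendsto_in_prob M (\<lambda>m \<omega>. g k * (R m (Suc k) \<omega> - R m k \<omega>)) (\<lambda>\<omega>. g k * (I (Suc k) \<omega> - I k \<omega>))"
      if "k < n" for k
      using that by simp
    then show ?thesis
      using R_meas I_meas
      by (intro tendsto_in_prob_add tendsto_in_prob_const tendsto_in_prob_sum borel_measurable_sum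
          borel_measurable_times borel_measurable_diff borel_measurable_const) auto
  qed
  have A_sets: "A T \<in> sets M"
    using A[of T] subalgebra_F[of T] n c by (auto simp: T_def subalgebra_def)
  have bound: "(\<integral>\<^sup>+\<omega>\<in>A T. ennreal ((d + (\<Sum>k<n. g k * (R m (Suc k) \<omega> - R m k \<omega>)))\<^sup>2) \<partial>M) \<le>
      ennreal (d\<^sup>2 + S * (\<Sum>k<n. (g k)\<^sup>2 * c))" for m
  proof -
    \<comment> \<open>\<open>j div Suc m\<close> is the coarse cell containing the fine cell
      \<open>j\<close>. The indicator is taken at the left end point, which keeps the coefficient
      adapted and cuts \<open>H\<close> off at the level \<open>B\<close>.\<close>
    define \<xi> where "\<xi> j \<omega> = g (j div Suc m) * (indicator (A (p m j)) \<omega> * H (p m j) \<omega>)" for j \<omega>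
    define N where "N = n * Suc m"
    have \<xi>_meas: "\<xi> j \<in> borel_measurable (F (p m j))" if "j < N" for j
      using H_meas[of j m] A[of "p m j"] p_range[of j m] that
      unfolding \<xi>_def[abs_def] N_def T_def
      by (intro borel_measurable_times borel_measurable_const borel_measurable_indicator) auto
    have ind_bdd: "\<bar>indicator (A (p m j)) \<omega> * H (p m j) \<omega>\<bar> \<le> \<bar>B\<bar>" if "j < N" for j \<omega>
      using B[of "p m j" \<omega>] p_range[of j m] that by (auto simp: N_def T_def indicator_def)
    have \<xi>_bdd: "\<exists>C. \<forall>\<omega>\<in>space M. \<bar>\<xi> j \<omega>\<bar> \<le> C" if "j < N" for j
      using ind_bdd[OF that] by (intro exI[of _ "\<bar>g (j div Suc m)\<bar> * \<bar>B\<bar>"]) (auto simp: \<xi>_def abs_mult intro!: mult_left_mono)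
    have iso: "integrable M (\<lambda>\<omega>. (d + simple_integral_W W N (p m) \<xi> \<omega>)\<^sup>2) \<and>
      expectation (\<lambda>\<omega>. (d + simple_integral_W W N (p m) \<xi> \<omega>)\<^sup>2) =
        d\<^sup>2 + (\<Sum>i<N. expectation (\<lambda>\<omega>. (\<xi> i \<omega>)\<^sup>2) * (p m (Suc i) - p m i))"
      by (rule ito_isometry_simple) (use p0 p_le \<xi>_meas \<xi>_bdd in auto)
    have E_le: "expectation (\<lambda>\<omega>. (\<xi> j \<omega>)\<^sup>2) \<le> (g (j div Suc m))\<^sup>2 * S" if "j < N" for j
    proof -
      have "(\<lambda>\<omega>. (\<xi> j \<omega>)\<^sup>2) = (\<lambda>\<omega>. (g (j div Suc m))\<^sup>2 * (indicator (A (p m j)) \<omega> * (H (p m j) \<omega>)\<^sup>2))"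
        by (auto simp: \<xi>_def fun_eq_iff power_mult_distrib indicator_def)
      then show ?thesis
        using S[of "p m j"] p_range[of j m] that by (auto simp: N_def T_def intro!: mult_left_mono)
    qed
    have group: "(\<Sum>j<N. f j) = (\<Sum>k<n. \<Sum>j\<in>{k * Suc m..<k * Suc m + Suc m}. f j)" for f :: "nat \<Rightarrow> real"
      unfolding N_def by (rule sum.nat_group[symmetric])
    have div: "j div Suc m = k" if "j \<in> {k * Suc m..<k * Suc m + Suc m}" for j k
      using that by (intro div_nat_eqI) (auto simp: algebra_simps)
    have "(\<Sum>i<N. expectation (\<lambda>\<omega>. (\<xi> i \<omega>)\<^sup>2) * (p m (Suc i) - p m i)) \<le>
        (\<Sum>i<N. (g (i div Suc m))\<^sup>2 * S * (c / real (Suc m)))"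
      unfolding p_step using E_le c by (intro sum_mono mult_right_mono) auto
    also have "\<dots> = (\<Sum>k<n. \<Sum>j\<in>{k * Suc m..<k * Suc m + Suc m}. (g k)\<^sup>2 * S * (c / real (Suc m)))"
      unfolding group by (intro sum.cong refl arg_cong2[where f = "(*)"] arg_cong[where f = "\<lambda>k. (g k)\<^sup>2"] div)
    also have "\<dots> = S * (\<Sum>k<n. (g k)\<^sup>2 * c)"
    proof -
      have "real (Suc m) * ((g k)\<^sup>2 * S * (c / real (Suc m))) = S * ((g k)\<^sup>2 * c)" for k
        by (simp del: of_nat_Suc)
      then show ?thesis
        unfolding sum_distrib_left by (intro sum.cong refl) (simp only: sum_constant card_atLeastLessThan add_diff_cancel_left')
    qed
    finally have E: "expectation (\<lambda>\<omega>. (d + simple_integral_W W N (p m) \<xi> \<omega>)\<^sup>2) \<le> d\<^sup>2 + S * (\<Sum>k<n. (g k)\<^sup>2 * c)"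
      using iso by simp
    have R_diff: "R m (Suc k) \<omega> - R m k \<omega> =
        (\<Sum>j\<in>{k * Suc m..<k * Suc m + Suc m}. H (p m j) \<omega> * (W (p m (Suc j)) \<omega> - W (p m j) \<omega>))" for k \<omega>
    proof -
      have "{..<Suc k * Suc m} = {..<k * Suc m} \<union> {k * Suc m..<k * Suc m + Suc m}"
        by auto
      then have "R m (Suc k) \<omega> = (\<Sum>j\<in>{..<k * Suc m} \<union> {k * Suc m..<k * Suc m + Suc m}. H (p m j) \<omega> * (W (p m (Suc j)) \<omega> - W (p m j) \<omega>))"
        unfolding R_def simple_integral_W_def by (rule arg_cong)
      also have "\<dots> = R m k \<omega> + (\<Sum>j\<in>{k * Suc m..<k * Suc m + Suc m}. H (p m j) \<omega> * (W (p m (Suc j)) \<omega> - W (p m j) \<omega>))"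
        unfolding R_def simple_integral_W_def by (rule sum.union_disjoint) auto
      finally show ?thesis by simp
    qed
    have eq: "(\<Sum>k<n. g k * (R m (Suc k) \<omega> - R m k \<omega>)) = simple_integral_W W N (p m) \<xi> \<omega>"
      if "\<forall>u\<in>{0..T}. \<omega> \<in> A u" for \<omega>
    proof -
      have "\<xi> j \<omega> = g (j div Suc m) * H (p m j) \<omega>" if "j < N" for j
        using \<open>\<forall>u\<in>{0..T}. \<omega> \<in> A u\<close> p_range[of j m] that by (auto simp: \<xi>_def N_def)
      then have "simple_integral_W W N (p m) \<xi> \<omega> =
          (\<Sum>j<N. g (j div Suc m) * (H (p m j) \<omega> * (W (p m (Suc j)) \<omega> - W (p m j) \<omega>)))"
        unfolding simple_integral_W_def by (intro sum.cong refl) (simp add: mult.assoc)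
      also have "\<dots> = (\<Sum>k<n. \<Sum>j\<in>{k * Suc m..<k * Suc m + Suc m}. g k * (H (p m j) \<omega> * (W (p m (Suc j)) \<omega> - W (p m j) \<omega>)))"
        unfolding group by (intro sum.cong refl arg_cong2[where f = "(*)"] arg_cong[where f = g] div)
      also have "\<dots> = (\<Sum>k<n. g k * (R m (Suc k) \<omega> - R m k \<omega>))"
        unfolding R_diff sum_distrib_left ..
      finally show ?thesis by simp
    qed
    \<comment> \<open>On \<open>A T\<close> all earlier indicators are \<open>1\<close> almost
      surely, so the truncated and the original sum agree there; off \<open>A T\<close> the left
      integrand vanishes.\<close>
    have "(\<integral>\<^sup>+\<omega>\<in>A T. ennreal ((d + (\<Sum>k<n. g k * (R m (Suc k) \<omega> - R m k \<omega>)))\<^sup>2) \<partial>M) \<le>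
        (\<integral>\<^sup>+\<omega>. ennreal ((d + simple_integral_W W N (p m) \<xi> \<omega>)\<^sup>2) \<partial>M)"
    proof (rule nn_integral_mono_AE)
      show "AE \<omega> in M. ennreal ((d + (\<Sum>k<n. g k * (R m (Suc k) \<omega> - R m k \<omega>)))\<^sup>2) * indicator (A T) \<omega> \<le>
          ennreal ((d + simple_integral_W W N (p m) \<xi> \<omega>)\<^sup>2)"
        using A_mono
      proof eventually_elim
        case (elim \<omega>)
        then show ?case
          by (cases "\<omega> \<in> A T") (simp_all add: eq T_def)
      qed
    qed
    also have "\<dots> = ennreal (expectation (\<lambda>\<omega>. (d + simple_integral_W W N (p m) \<xi> \<omega>)\<^sup>2))"
      using iso by (intro nn_integral_eq_integral) auto
    also have "\<dots> \<le> ennreal (d\<^sup>2 + S * (\<Sum>k<n. (g k)\<^sup>2 * c))"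
      using E by (rule ennreal_leI)
    finally show ?thesis .
  qed
  show ?thesis
    unfolding T_def[symmetric]
  proof (rule nn_integral_square_le_of_tendsto_in_prob[OF _ _ A_sets lim bound])
    show "(\<lambda>\<omega>. d + (\<Sum>k<n. g k * (R m (Suc k) \<omega> - R m k \<omega>))) \<in> borel_measurable M" for m
      using R_meas by (intro borel_measurable_add borel_measurable_const borel_measurable_sum borel_measurable_times borel_measurable_diff) auto
    show "(\<lambda>\<omega>. d + (\<Sum>k<n. g k * (I (Suc k) \<omega> - I k \<omega>))) \<in> borel_measurable M"
      using I_meas by (intro borel_measurable_add borel_measurable_const borel_measurable_sum borel_measurable_times borel_measurable_diff) auto
  qed
qed

end

section \<open>Truncation and the moment bound\<close>

text \<open>Only rational times are intersected, which keeps the event in \<open>F u\<close>; for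
  continuous paths they represent the whole interval. The time \<open>u\<close> is listed separately
  so that \<open>\<bar>H u \<omega>\<bar> \<le> N\<close> holds on the event for every path and
  every real \<open>u\<close>.\<close>

definition truncation_event :: "'w measure \<Rightarrow> (real \<Rightarrow> 'w \<Rightarrow> real) \<Rightarrow> real \<Rightarrow> real \<Rightarrow> 'w set" where
  "truncation_event M H N u = {\<omega>\<in>space M. \<bar>H u \<omega>\<bar> \<le> N \<and>
     (\<forall>q::rat. 0 \<le> real_of_rat q \<and> real_of_rat q \<le> u \<longrightarrow> \<bar>H (real_of_rat q) \<omega>\<bar> \<le> N)}"

lemma truncation_event_bound: "\<omega> \<in> truncation_event M H N u \<Longrightarrow> \<bar>H u \<omega>\<bar> \<le> N"
  by (simp add: truncation_event_def)

text \<open>A time \<open>u < t\<close> is approached from the right by rationals below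
  \<open>t\<close>, and continuity carries the bound over to \<open>u\<close>. At
  \<open>u = t\<close> there is no room on the right, but there the bound is part of the
  event.\<close>

lemma truncation_event_antimono:
  assumes \<omega>: "\<omega> \<in> truncation_event M H N t" and cont: "continuous_on {0..t} (\<lambda>s. H s \<omega>)" and u: "u \<in> {0..t}"
  shows "\<omega> \<in> truncation_event M H N u"
proof -
  have rat: "\<bar>H (real_of_rat q) \<omega>\<bar> \<le> N" if "0 \<le> real_of_rat q" "real_of_rat q \<le> t" for q
    using \<omega> that by (simp add: truncation_event_def)
  have "\<bar>H u \<omega>\<bar> \<le> N"
  proof (cases "u = t")
    case True
    then show ?thesis using \<omega> by (simp add: truncation_event_def)
  next
    case False
    have "\<forall>n. \<exists>q::rat. u < real_of_rat q \<and> real_of_rat q < min t (u + inverse (real (Suc n)))"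
      using u False by (intro allI of_rat_dense) auto
    from choice[OF this] obtain q :: "nat \<Rightarrow> rat"
      where q: "\<forall>n. u < real_of_rat (q n) \<and> real_of_rat (q n) < min t (u + inverse (real (Suc n)))" by blast
    have lim: "(\<lambda>n. real_of_rat (q n)) \<longlonglongrightarrow> u"
    proof (rule tendsto_sandwich[of "\<lambda>_. u" _ _ "\<lambda>n. u + inverse (real (Suc n))"])
      show "(\<lambda>n. u + inverse (real (Suc n))) \<longlonglongrightarrow> u"
        using tendsto_add[OF tendsto_const LIMSEQ_inverse_real_of_nat, of u] by simp
      show "\<forall>\<^sub>F n in sequentially. u \<le> real_of_rat (q n)"
        using q by (intro always_eventually allI less_imp_le) blast
      show "\<forall>\<^sub>F n in sequentially. real_of_rat (q n) \<le> u + inverse (real (Suc n))"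
        using q by (intro always_eventually allI less_imp_le) (simp del: of_nat_Suc)
    qed simp
    have range: "0 \<le> real_of_rat (q n)" "real_of_rat (q n) \<le> t" for n
    proof -
      have "u < real_of_rat (q n)" "real_of_rat (q n) < t"
        using spec[OF q, of n] by simp_all
      moreover have "0 \<le> u" using u by simp
      ultimately show "0 \<le> real_of_rat (q n)" "real_of_rat (q n) \<le> t"
        by linarith+
    qed
    have "(\<lambda>n. \<bar>H (real_of_rat (q n)) \<omega>\<bar>) \<longlonglongrightarrow> \<bar>H u \<omega>\<bar>"
    proof (rule tendsto_rabs, rule continuous_on_tendsto_compose[OF cont lim u])
      show "\<forall>\<^sub>F n in sequentially. real_of_rat (q n) \<in> {0..t}"
        using range by (intro always_eventually) simp
    qed
    then show ?thesis
      by (rule LIMSEQ_le_const2) (use rat[OF range] in blast)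
  qed
  moreover have "\<bar>H (real_of_rat q) \<omega>\<bar> \<le> N" if "0 \<le> real_of_rat q" "real_of_rat q \<le> u" for q
    using rat[of q] that u by simp
  ultimately show ?thesis
    using \<omega> by (simp add: truncation_event_def)
qed

lemma truncation_event_eventually:
  assumes \<omega>: "\<omega> \<in> space M" and cont: "continuous_on {0..t} (\<lambda>s. H s \<omega>)" and t: "0 \<le> t"
  shows "\<forall>\<^sub>F N in sequentially. \<omega> \<in> truncation_event M H (real N) t"
proof -
  have "bounded ((\<lambda>s. H s \<omega>) ` {0..t})"
    using cont by (intro compact_imp_bounded compact_continuous_image) auto
  then obtain B where B: "\<forall>s\<in>{0..t}. \<bar>H s \<omega>\<bar> \<le> B"
    by (auto simp: bounded_iff)
  obtain N0 where "B \<le> real N0"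
    using real_arch_simple by blast
  then have "\<omega> \<in> truncation_event M H (real N) t" if "N0 \<le> N" for N
  proof -
    have "B \<le> real N"
      using \<open>B \<le> real N0\<close> that by linarith
    then have "\<forall>s\<in>{0..t}. \<bar>H s \<omega>\<bar> \<le> real N"
      using B by (meson order_trans)
    then show ?thesis
      using \<omega> t by (simp add: truncation_event_def)
  qed
  then show ?thesis
    by (auto simp: eventually_sequentially)
qed

section \<open>Pathwise properties of solutions and their truncated moments\<close>

context wiener_process
begin

lemma truncation_event_sets:
  assumes H: "\<And>s. s \<in> {0..u} \<Longrightarrow> H s \<in> borel_measurable (F s)" and u: "0 \<le> u"
  shows "truncation_event M H N u \<in> sets (F u)"
proof -
  have m: "{\<omega>\<in>space (F u). \<bar>H s \<omega>\<bar> \<le> N} \<in> sets (F u)" if "s \<in> {0..u}" for s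
  proof -
    have [measurable]: "H s \<in> borel_measurable (F u)"
      by (rule measurable_F_mono[OF _ H[OF that]]) (use that in simp)
    show ?thesis by measurable
  qed
  have q: "{\<omega>\<in>space (F u). 0 \<le> real_of_rat q \<and> real_of_rat q \<le> u \<longrightarrow> \<bar>H (real_of_rat q) \<omega>\<bar> \<le> N} \<in> sets (F u)" for q
    using m[of "real_of_rat q"] by (cases "0 \<le> real_of_rat q \<and> real_of_rat q \<le> u") auto
  have "truncation_event M H N u = {\<omega>\<in>space (F u). \<bar>H u \<omega>\<bar> \<le> N} \<inter>
      {\<omega>\<in>space (F u). \<forall>q. 0 \<le> real_of_rat q \<and> real_of_rat q \<le> u \<longrightarrow> \<bar>H (real_of_rat q) \<omega>\<bar> \<le> N}"
    by (auto simp: truncation_event_def space_F)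
  also have "\<dots> \<in> sets (F u)"
    using m[of u] u by (intro sets.Int sets.sets_Collect_countable_All q) auto
  finally show ?thesis .
qed

text \<open>The pathwise facts are collected on one null set that does not depend on time, so they
  are available at all grid times and on all intervals at once.\<close>

lemma solution_paths:
  assumes sol: "is_solution M F W a b \<sigma>\<^sub>0 \<sigma>\<^sub>1 \<sigma>\<^sub>2 K \<phi> x" and K: "\<forall>s\<ge>0. K s = r * exp (- r * s)"
  shows "AE \<omega> in M. continuous_on {0..} (\<lambda>s. x s \<omega>) \<and> x 0 \<omega> = \<phi> 0 \<and>
    delay_term K x 0 \<omega> = (LINT s:{0..}|lborel. K s * \<phi> (- s)) \<and>
    (\<forall>T. \<forall>s\<in>{0..T}. ((\<lambda>t. delay_term K x t \<omega>) has_real_derivative r * (x s \<omega> - delay_term K x s \<omega>)) (at s within {0..T}))"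
proof -
  have init: "\<And>\<omega> t. \<omega> \<in> space M \<Longrightarrow> t \<le> 0 \<Longrightarrow> x t \<omega> = \<phi> t"
    and cont: "\<And>\<omega>. \<omega> \<in> space M \<Longrightarrow> continuous_on {0..} (\<lambda>t. x t \<omega>)"
    and int: "AE \<omega> in M. \<forall>t\<ge>0. set_integrable lborel {0..} (\<lambda>s. K s * x (t - s) \<omega>)"
    using sol by (auto simp: is_solution_def)
  show ?thesis
    using int AE_space
  proof eventually_elim
    case (elim \<omega>)
    have "delay_term K x 0 \<omega> = (LINT s:{0..}|lborel. K s * \<phi> (- s))"
      unfolding delay_term_def using init[OF elim(2)] by (intro set_lebesgue_integral_cong) auto
    moreover have "((\<lambda>t. delay_term K x t \<omega>) has_real_derivative r * (x s \<omega> - delay_term K x s \<omega>)) (at s within {0..T})"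
      if "s \<in> {0..T}" for s T
      unfolding delay_term_def
      using delay_integral_derivative[OF K[rule_format] cont[OF elim(2)], where T = T and s = s] elim(1) that by simp
    ultimately show ?case
      using init[OF elim(2)] cont[OF elim(2)] by auto
  qed
qed

lemma solution_diffusion_continuous:
  assumes sol: "is_solution M F W a b \<sigma>\<^sub>0 \<sigma>\<^sub>1 \<sigma>\<^sub>2 K \<phi> x" and K: "\<forall>s\<ge>0. K s = r * exp (- r * s)"
  shows "AE \<omega> in M. \<forall>T. continuous_on {0..T} (\<lambda>s. diffusion \<sigma>\<^sub>0 \<sigma>\<^sub>1 \<sigma>\<^sub>2 K x s \<omega>)"
  using solution_paths[OF sol K]
proof eventually_elim
  case (elim \<omega>)
  show ?case
  proof
    fix T
    have "continuous_on {0..T} (\<lambda>t. delay_term K x t \<omega>)"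
      using elim by (intro DERIV_continuous_on) blast
    moreover have "continuous_on {0..T} (\<lambda>t. x t \<omega>)"
      using elim by (auto intro: continuous_on_subset)
    ultimately show "continuous_on {0..T} (\<lambda>s. diffusion \<sigma>\<^sub>0 \<sigma>\<^sub>1 \<sigma>\<^sub>2 K x s \<omega>)"
      unfolding diffusion_def by (intro continuous_intros)
  qed
qed

text \<open>Two facts about the same sums are combined by Fatou's lemma:
  \<open>kernel_sum_bound\<close> bounds their truncated second moment for every mesh, and
  \<open>variation_of_constants_sum_tendsto\<close> gives their limit on almost every path.\<close>

lemma truncated_second_moment_bound:
  fixes K \<phi> P :: "real \<Rightarrow> real" and x :: "real \<Rightarrow> 'w \<Rightarrow> real"
    and a r \<sigma>\<^sub>0 \<sigma>\<^sub>1 \<sigma>\<^sub>2 c\<^sub>0 c\<^sub>1 c\<^sub>2 N S t :: real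
  assumes sol: "is_solution M F W a 0 \<sigma>\<^sub>0 \<sigma>\<^sub>1 \<sigma>\<^sub>2 K \<phi> x" and K: "\<forall>s\<ge>0. K s = r * exp (- r * s)"
    and a: "a < 0" and r: "0 < r" and P0: "P 0 = 0"
    and P: "\<And>s. (P has_real_derivative exp (a * s) - r * P s) (at s)" and t: "0 < t"
    and S: "\<And>u. 0 \<le> u \<Longrightarrow> expectation (\<lambda>\<omega>. indicator (truncation_event M (diffusion \<sigma>\<^sub>0 \<sigma>\<^sub>1 \<sigma>\<^sub>2 K x) N u) \<omega> *
        (diffusion \<sigma>\<^sub>0 \<sigma>\<^sub>1 \<sigma>\<^sub>2 K x u \<omega>)\<^sup>2) \<le> S" "0 \<le> S"
  shows "(\<integral>\<^sup>+\<omega>\<in>truncation_event M (diffusion \<sigma>\<^sub>0 \<sigma>\<^sub>1 \<sigma>\<^sub>2 K x) N t.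
      ennreal ((c\<^sub>0 + c\<^sub>1 * x t \<omega> + c\<^sub>2 * delay_term K x t \<omega>)\<^sup>2) \<partial>M) \<le>
    ennreal ((c\<^sub>0 + \<phi> 0 * (c\<^sub>1 * exp (a * t) + c\<^sub>2 * r * P t) +
      c\<^sub>2 * (LINT s:{0..}|lborel. K s * \<phi> (- s)) * (exp (a * t) - (r + a) * P t))\<^sup>2 + S * kernel_energy a r c\<^sub>1 c\<^sub>2)"
proof -
  define H where "H = diffusion \<sigma>\<^sub>0 \<sigma>\<^sub>1 \<sigma>\<^sub>2 K x"
  define A where "A = truncation_event M H N"
  define G where "G s = c\<^sub>1 * exp (a * s) + c\<^sub>2 * r * P s" for s
  define y\<^sub>0 where "y\<^sub>0 = (LINT s:{0..}|lborel. K s * \<phi> (- s))"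
  \<comment> \<open>This is the value of \<open>c\<^sub>0 + c\<^sub>1 * x + c\<^sub>2 * y\<close> in
    the absence of noise; the factor \<open>exp (a * t) - (r + a) * P t\<close> equals
    \<open>exp (- r * t)\<close>, the decay of the initial delay.\<close>
  define d where "d = c\<^sub>0 + \<phi> 0 * G t + c\<^sub>2 * y\<^sub>0 * (exp (a * t) - (r + a) * P t)"
  \<comment> \<open>By the equation, \<open>J\<close> is a version of the Ito integrals with almost
    surely continuous paths; each \<open>I' s\<close> agrees with it off a null set that may depend
    on \<open>s\<close>.\<close>
  define J where "J s \<omega> = x s \<omega> - \<phi> 0 - a * integral {0..s} (\<lambda>u. x u \<omega>)" for s \<omega>
  note paths = solution_paths[OF sol K]
  have cont: "AE \<omega> in M. \<forall>T. continuous_on {0..T} (\<lambda>s. H s \<omega>)"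
    using solution_diffusion_continuous[OF sol K] by (simp add: H_def)
  have "\<forall>s\<ge>0. \<exists>I. has_ito_integral M F W H s I \<and>
      (AE \<omega> in M. x s \<omega> = \<phi> 0 + (LINT u:{0..s}|lborel. drift a 0 K x u \<omega>) + I \<omega>)"
    using sol by (auto simp: is_solution_def H_def)
  then have "\<forall>s\<in>{0..}. \<exists>I. has_ito_integral M F W H s I \<and>
      (AE \<omega> in M. x s \<omega> = \<phi> 0 + (LINT u:{0..s}|lborel. drift a 0 K x u \<omega>) + I \<omega>)"
    by simp
  from bchoice[OF this] obtain I' where I': "\<forall>s\<in>{0..}. has_ito_integral M F W H s (I' s) \<and>
      (AE \<omega> in M. x s \<omega> = \<phi> 0 + (LINT u:{0..s}|lborel. drift a 0 K x u \<omega>) + I' s \<omega>)" ..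
  have ito: "has_ito_integral M F W H s (I' s)"
    and eqn: "AE \<omega> in M. x s \<omega> = \<phi> 0 + (LINT u:{0..s}|lborel. drift a 0 K x u \<omega>) + I' s \<omega>" if "0 \<le> s" for s
    using bspec[OF I', of s] that by simp_all
  have I'_eq: "AE \<omega> in M. I' s \<omega> = J s \<omega>" if "0 \<le> s" for s
    using eqn[OF that] paths
  proof eventually_elim
    case (elim \<omega>)
    have "continuous_on {0..s} (\<lambda>u. x u \<omega>)"
      using elim by (auto intro: continuous_on_subset)
    from borel_integrable_atLeastAtMost'[OF this]
    have "(LINT u:{0..s}|lborel. drift a 0 K x u \<omega>) = a * integral {0..s} (\<lambda>u. x u \<omega>)"
      by (simp add: drift_def set_borel_integral_eq_integral)
    then show ?case using elim(1) by (simp add: J_def)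
  qed
  have H_meas: "H s \<in> borel_measurable (F s)" if "0 \<le> s" for s
    by (rule progressively_measurable_at[of s]) (use ito[OF that] that in \<open>auto simp: has_ito_integral_def\<close>)
  have A_F: "A u \<in> sets (F u)" if "0 \<le> u" for u
    unfolding A_def using that by (intro truncation_event_sets H_meas) auto
  have A_M: "A u \<in> sets M" if "0 \<le> u" for u
    using A_F[OF that] subalgebra_F[of u] by (auto simp: subalgebra_def)
  \<comment> \<open>\<open>kernel_sum_bound\<close> requires the integral at time \<open>0\<close>
    to vanish identically, while \<open>I' 0\<close> vanishes only almost surely.\<close>
  define I where "I n k = (if k = 0 then (\<lambda>_. 0) else I' (real k * (t / real (Suc n))))" for n k
  have I_meas: "I n k \<in> borel_measurable M" for n k
    using ito[of "real k * (t / real (Suc n))"] t by (auto simp: I_def has_ito_integral_def)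
  have T: "real (Suc n) * (t / real (Suc n)) = t" for n
    by (simp del: of_nat_Suc)
  \<comment> \<open>The grid times are countably many, so one null set serves all of them.\<close>
  have I_eq: "AE \<omega> in M. \<forall>n k. I n k \<omega> = J (real k * (t / real (Suc n))) \<omega>"
    unfolding AE_all_countable
  proof (intro allI)
    fix n k :: nat
    show "AE \<omega> in M. I n k \<omega> = J (real k * (t / real (Suc n))) \<omega>"
    proof (cases "k = 0")
      case True
      show ?thesis using paths
        by eventually_elim (simp add: I_def J_def True)
    next
      case False
      then show ?thesis
        using I'_eq[of "real k * (t / real (Suc n))"] t by (simp add: I_def)
    qed
  qed
  have bound: "(\<integral>\<^sup>+\<omega>\<in>A t. ennreal ((d + (\<Sum>k<Suc n. G (t - real k * (t / real (Suc n))) * (I n (Suc k) \<omega> - I n k \<omega>)))\<^sup>2) \<partial>M) \<le>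
      ennreal (d\<^sup>2 + S * (\<Sum>k<Suc n. (G (t - real k * (t / real (Suc n))))\<^sup>2 * (t / real (Suc n))))" for n
  proof -
    have "(\<integral>\<^sup>+\<omega>\<in>A (real (Suc n) * (t / real (Suc n))).
        ennreal ((d + (\<Sum>k<Suc n. G (t - real k * (t / real (Suc n))) * (I n (Suc k) \<omega> - I n k \<omega>)))\<^sup>2) \<partial>M) \<le>
      ennreal (d\<^sup>2 + S * (\<Sum>k<Suc n. (G (t - real k * (t / real (Suc n))))\<^sup>2 * (t / real (Suc n))))"
    proof (rule kernel_sum_bound[where H = H and B = N])
      show "has_ito_integral M F W H (real k * (t / real (Suc n))) (I n k)" if "0 < k" "k \<le> Suc n" for k
        using ito[of "real k * (t / real (Suc n))"] t that by (simp add: I_def)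
      show "I n 0 = (\<lambda>_. 0)" by (simp add: I_def)
      show "AE \<omega> in M. continuous_on {0..real (Suc n) * (t / real (Suc n))} (\<lambda>s. H s \<omega>)"
        using cont by eventually_elim blast
      show "AE \<omega> in M. \<omega> \<in> A (real (Suc n) * (t / real (Suc n))) \<longrightarrow> (\<forall>u\<in>{0..real (Suc n) * (t / real (Suc n))}. \<omega> \<in> A u)"
        using cont
      proof eventually_elim
        case (elim \<omega>)
        show ?case
        proof (intro impI ballI)
          fix u assume u: "u \<in> {0..real (Suc n) * (t / real (Suc n))}" and "\<omega> \<in> A (real (Suc n) * (t / real (Suc n)))"
          then show "\<omega> \<in> A u"
            using elim unfolding A_def by (intro truncation_event_antimono[where H = H, OF _ _ u]) blast+
        qed
      qed
      show "expectation (\<lambda>\<omega>. indicator (A u) \<omega> * (H u \<omega>)\<^sup>2) \<le> S" if "u \<in> {0..real (Suc n) * (t / real (Suc n))}" for u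
        using S(1)[of u] that by (simp add: A_def H_def)
    qed (use t A_F in \<open>auto simp: A_def truncation_event_bound\<close>)
    then show ?thesis unfolding T .
  qed
  obtain L where L: "(\<lambda>n. \<Sum>k<n. (G (t - real k * (t / n)))\<^sup>2 * (t / n)) \<longlonglongrightarrow> L" "L \<le> kernel_energy a r c\<^sub>1 c\<^sub>2"
    unfolding G_def by (rule kernel_square_sum_tendsto[OF a r t P0 P, of c\<^sub>1 c\<^sub>2]) blast
  have "(\<integral>\<^sup>+\<omega>. ennreal ((c\<^sub>0 + c\<^sub>1 * x t \<omega> + c\<^sub>2 * delay_term K x t \<omega>)\<^sup>2) * indicator (A t) \<omega> \<partial>M) \<le> ennreal (d\<^sup>2 + S * L)"
  proof (rule nn_integral_le_of_AE_tendsto[OF _ _ bound])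
    show "(\<lambda>\<omega>. ennreal ((d + (\<Sum>k<Suc n. G (t - real k * (t / real (Suc n))) * (I n (Suc k) \<omega> - I n k \<omega>)))\<^sup>2) * indicator (A t) \<omega>)
        \<in> borel_measurable M" for n
    proof -
      note [measurable] = I_meas A_M[OF less_imp_le[OF t]]
      show ?thesis by measurable
    qed
    show "(\<lambda>n. ennreal (d\<^sup>2 + S * (\<Sum>k<Suc n. (G (t - real k * (t / real (Suc n))))\<^sup>2 * (t / real (Suc n))))) \<longlonglongrightarrow> ennreal (d\<^sup>2 + S * L)"
      by (intro tendsto_ennrealI tendsto_intros filterlim_compose[OF L(1) filterlim_Suc])
    show "AE \<omega> in M. (\<lambda>n. ennreal ((d + (\<Sum>k<Suc n. G (t - real k * (t / real (Suc n))) * (I n (Suc k) \<omega> - I n k \<omega>)))\<^sup>2) * indicator (A t) \<omega>)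
        \<longlonglongrightarrow> ennreal ((c\<^sub>0 + c\<^sub>1 * x t \<omega> + c\<^sub>2 * delay_term K x t \<omega>)\<^sup>2) * indicator (A t) \<omega>"
      using I_eq paths
    proof eventually_elim
      case (elim \<omega>)
      have cx: "continuous_on {0..t} (\<lambda>u. x u \<omega>)"
        using elim(2) by (auto intro: continuous_on_subset)
      have "(\<lambda>n. \<Sum>k<n. G (t - real k * (t / n)) * (J (real (Suc k) * (t / n)) \<omega> - J (real k * (t / n)) \<omega>))
        \<longlonglongrightarrow> c\<^sub>1 * x t \<omega> + c\<^sub>2 * delay_term K x t \<omega> - \<phi> 0 * G t - c\<^sub>2 * delay_term K x 0 \<omega> * (exp (a * t) - (r + a) * P t)"
        unfolding G_def J_def
      proof (rule variation_of_constants_sum_tendsto[where X = "\<lambda>s. x s \<omega>" and Y = "\<lambda>s. delay_term K x s \<omega>"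
            and Q = "\<lambda>s. integral {0..s} (\<lambda>u. x u \<omega>)", OF a r t P0 P cx])
        show "((\<lambda>s. integral {0..s} (\<lambda>u. x u \<omega>)) has_real_derivative x s \<omega>) (at s within {0..t})" if "s \<in> {0..t}" for s
          using integral_has_real_derivative[OF cx that] .
      qed (use elim(2) in auto)
      from filterlim_compose[OF this filterlim_Suc]
      have "(\<lambda>n. \<Sum>k<Suc n. G (t - real k * (t / real (Suc n))) * (I n (Suc k) \<omega> - I n k \<omega>)) \<longlonglongrightarrow>
          c\<^sub>1 * x t \<omega> + c\<^sub>2 * delay_term K x t \<omega> - \<phi> 0 * G t - c\<^sub>2 * y\<^sub>0 * (exp (a * t) - (r + a) * P t)"
        using elim by (simp only: y\<^sub>0_def)
      note lim = this
      have eq: "d + (c\<^sub>1 * x t \<omega> + c\<^sub>2 * delay_term K x t \<omega> - \<phi> 0 * G t - c\<^sub>2 * y\<^sub>0 * (exp (a * t) - (r + a) * P t)) =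
          c\<^sub>0 + c\<^sub>1 * x t \<omega> + c\<^sub>2 * delay_term K x t \<omega>"
        by (simp add: d_def)
      from tendsto_add[OF tendsto_const[of d] lim]
      have "(\<lambda>n. d + (\<Sum>k<Suc n. G (t - real k * (t / real (Suc n))) * (I n (Suc k) \<omega> - I n k \<omega>))) \<longlonglongrightarrow>
          c\<^sub>0 + c\<^sub>1 * x t \<omega> + c\<^sub>2 * delay_term K x t \<omega>"
        by (simp only: eq)
      then have "(\<lambda>n. ennreal ((d + (\<Sum>k<Suc n. G (t - real k * (t / real (Suc n))) * (I n (Suc k) \<omega> - I n k \<omega>)))\<^sup>2)) \<longlonglongrightarrow>
          ennreal ((c\<^sub>0 + c\<^sub>1 * x t \<omega> + c\<^sub>2 * delay_term K x t \<omega>)\<^sup>2)"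
        by (intro tendsto_ennrealI tendsto_power)
      then show ?case
        by (cases "\<omega> \<in> A t") (simp_all del: of_nat_Suc sum.lessThan_Suc)
    qed
  qed
  also have "\<dots> \<le> ennreal (d\<^sup>2 + S * kernel_energy a r c\<^sub>1 c\<^sub>2)"
    using L(2) S(2) by (intro ennreal_leI add_left_mono mult_left_mono)
  finally show ?thesis
    unfolding d_def G_def y\<^sub>0_def A_def H_def .
qed

end

section \<open>From truncated moments to the uniform bound\<close>

lemma initial_delay_bound:
  fixes K \<phi> :: "real \<Rightarrow> real"
  assumes K: "\<forall>s\<ge>0. K s = r * exp (- r * s)" and r: "0 < r" and \<phi>: "\<And>s. s \<le> 0 \<Longrightarrow> \<bar>\<phi> s\<bar> \<le> m"
  shows "\<bar>LINT s:{0..}|lborel. K s * \<phi> (- s)\<bar> \<le> m"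
proof -
  have m: "0 \<le> m" using \<phi>[of 0] by simp
  note int = exponential_kernel_integral[OF r]
  show ?thesis
  \<comment> \<open>Here \<open>\<phi>\<close> is only bounded, so integrability is unknown; the
    default value \<open>0\<close> of the integral satisfies the bound as well.\<close>
  proof (cases "set_integrable lborel {0..} (\<lambda>s. K s * \<phi> (- s))")
    case True
    have "norm (LINT s:{0..}|lborel. K s * \<phi> (- s)) \<le> (LINT s:{0..}|lborel. m * (r * exp (- r * s)))"
      unfolding set_lebesgue_integral_def
    proof (rule Bochner_Integration.integral_norm_bound_integral)
      show "integrable lborel (\<lambda>s. indicat_real {0..} s *\<^sub>R (K s * \<phi> (- s)))"
        using True by (simp add: set_integrable_def)
      show "integrable lborel (\<lambda>s. indicat_real {0..} s *\<^sub>R (m * (r * exp (- r * s))))"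
        using set_integrable_mult_right[OF int(1), of m] by (simp add: set_integrable_def)
      show "norm (indicat_real {0..} s *\<^sub>R (K s * \<phi> (- s))) \<le> indicat_real {0..} s *\<^sub>R (m * (r * exp (- r * s)))" for s
        using \<phi>[of "- s"] r by (cases "0 \<le> s") (auto simp: K abs_mult mult_right_mono mult.commute)
    qed
    then show ?thesis
      using int(2) by (simp only: set_integral_mult_right) simp
  next
    case False
    then show ?thesis
      using m by (simp add: set_integrable_def set_lebesgue_integral_def not_integrable_integral_eq)
  qed
qed

text \<open>The finite second moment makes \<open>x t\<close> integrable, so the inner expectation
  is a genuine one, and the variance is at most the second moment about \<open>0\<close>.\<close>

lemma (in prob_space) second_moment_le:
  assumes [measurable]: "x t \<in> borel_measurable M" and le: "(\<integral>\<^sup>+\<omega>. ennreal ((x t \<omega>)\<^sup>2) \<partial>M) \<le> ennreal R"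
  shows "second_moment M x t \<le> ennreal R"
proof -
  have i2: "integrable M (\<lambda>\<omega>. (x t \<omega>)\<^sup>2)"
    using le by (intro integrableI_nonneg) (auto simp: less_top[symmetric] top_unique intro: le_less_trans)
  have i1: "integrable M (x t)"
    by (rule square_integrable_imp_integrable[OF _ i2]) simp
  have iv: "integrable M (\<lambda>\<omega>. (x t \<omega> - expectation (x t))\<^sup>2)"
    using i1 i2 by (simp add: power2_diff)
  have "second_moment M x t = ennreal (variance (x t))"
    unfolding second_moment_def using iv by (simp add: nn_integral_eq_integral)
  also have "\<dots> \<le> ennreal (expectation (\<lambda>\<omega>. (x t \<omega>)\<^sup>2))"
    using variance_eq[OF i1 i2] by (intro ennreal_leI) simp
  also have "\<dots> = (\<integral>\<^sup>+\<omega>. ennreal ((x t \<omega>)\<^sup>2) \<partial>M)"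
    using i2 by (simp add: nn_integral_eq_integral)
  finally show ?thesis using le by simp
qed

context wiener_process
begin

text \<open>\<open>D\<close> is the square of a bound for the deterministic part of the diffusion,
  obtained from \<open>exp (a * s) \<le> 1\<close>, \<open>\<bar>P s\<bar> \<le> C\<close>, and
  \<open>m\<close> for both \<open>\<phi> 0\<close> and the initial delay. The initial function
  enters only through \<open>m\<close>. For the kernel \<open>exp (a * s)\<close> the energy
  \<open>kernel_energy a r 1 0\<close> is \<open>1 / (- 2 * a)\<close>.\<close>

lemma solution_second_moment_bound:
  fixes K \<phi> P :: "real \<Rightarrow> real" and x :: "real \<Rightarrow> 'w \<Rightarrow> real" and a r \<sigma>\<^sub>0 \<sigma>\<^sub>1 \<sigma>\<^sub>2 C m t :: real
  assumes sol: "is_solution M F W a 0 \<sigma>\<^sub>0 \<sigma>\<^sub>1 \<sigma>\<^sub>2 K \<phi> x" and K: "\<forall>s\<ge>0. K s = r * exp (- r * s)"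
    and a: "a < 0" and r: "0 < r" and P0: "P 0 = 0"
    and P: "\<And>s. (P has_real_derivative exp (a * s) - r * P s) (at s)"
    and C: "\<And>s. 0 \<le> s \<Longrightarrow> \<bar>P s\<bar> \<le> C" and \<phi>: "\<And>s. s \<le> 0 \<Longrightarrow> \<bar>\<phi> s\<bar> \<le> m"
    and \<kappa>: "kernel_energy a r \<sigma>\<^sub>1 \<sigma>\<^sub>2 < 1" and t: "0 \<le> t"
  defines "D \<equiv> (\<bar>\<sigma>\<^sub>0\<bar> + m * (\<bar>\<sigma>\<^sub>1\<bar> + \<bar>\<sigma>\<^sub>2\<bar> * r * C) + \<bar>\<sigma>\<^sub>2\<bar> * m * (1 + \<bar>r + a\<bar> * C))\<^sup>2"
  shows "second_moment M x t \<le> ennreal (m\<^sup>2 + D / (1 - kernel_energy a r \<sigma>\<^sub>1 \<sigma>\<^sub>2) * kernel_energy a r 1 0)"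
proof -
  define H where "H = diffusion \<sigma>\<^sub>0 \<sigma>\<^sub>1 \<sigma>\<^sub>2 K x"
  define \<kappa> where "\<kappa> = kernel_energy a r \<sigma>\<^sub>1 \<sigma>\<^sub>2"
  define y\<^sub>0 where "y\<^sub>0 = (LINT s:{0..}|lborel. K s * \<phi> (- s))"
  have m0: "0 \<le> m" using \<phi>[of 0] by simp
  have C0: "0 \<le> C" using C[of 0] by (simp add: P0)
  have \<kappa>0: "0 \<le> \<kappa>" "0 \<le> kernel_energy a r 1 0"
    unfolding \<kappa>_def by (rule kernel_square_sum_tendsto[OF a r zero_less_one P0 P], assumption)+
  have y0: "\<bar>y\<^sub>0\<bar> \<le> m"
    unfolding y\<^sub>0_def by (rule initial_delay_bound[OF K r \<phi>])
  have E1: "exp (a * s) \<le> 1" if "0 \<le> s" for s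
    using that a by (simp add: mult_nonpos_nonneg)
  have d_le: "(\<sigma>\<^sub>0 + \<phi> 0 * (\<sigma>\<^sub>1 * exp (a * s) + \<sigma>\<^sub>2 * r * P s) + \<sigma>\<^sub>2 * y\<^sub>0 * (exp (a * s) - (r + a) * P s))\<^sup>2 \<le> D" if s: "0 \<le> s" for s
  proof -
    have "\<bar>\<sigma>\<^sub>1 * exp (a * s) + \<sigma>\<^sub>2 * r * P s\<bar> \<le> \<bar>\<sigma>\<^sub>1\<bar> * exp (a * s) + \<bar>\<sigma>\<^sub>2\<bar> * r * \<bar>P s\<bar>"
      using r by (intro order_trans[OF abs_triangle_ineq]) (simp add: abs_mult)
    also have "\<dots> \<le> \<bar>\<sigma>\<^sub>1\<bar> * 1 + \<bar>\<sigma>\<^sub>2\<bar> * r * C"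
      using r E1[OF s] C[OF s] by (intro add_mono mult_left_mono) auto
    finally have 1: "\<bar>\<phi> 0 * (\<sigma>\<^sub>1 * exp (a * s) + \<sigma>\<^sub>2 * r * P s)\<bar> \<le> m * (\<bar>\<sigma>\<^sub>1\<bar> + \<bar>\<sigma>\<^sub>2\<bar> * r * C)"
      unfolding abs_mult using \<phi>[of 0] by (intro mult_mono) auto
    have "\<bar>exp (a * s) - (r + a) * P s\<bar> \<le> exp (a * s) + \<bar>r + a\<bar> * \<bar>P s\<bar>"
      by (intro order_trans[OF abs_triangle_ineq4]) (simp add: abs_mult)
    also have "\<dots> \<le> 1 + \<bar>r + a\<bar> * C"
      using E1[OF s] C[OF s] by (intro add_mono mult_left_mono) auto
    finally have 2: "\<bar>\<sigma>\<^sub>2 * y\<^sub>0 * (exp (a * s) - (r + a) * P s)\<bar> \<le> \<bar>\<sigma>\<^sub>2\<bar> * m * (1 + \<bar>r + a\<bar> * C)"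
      unfolding abs_mult using y0 m0 by (intro mult_mono) auto
    have "\<bar>\<sigma>\<^sub>0 + \<phi> 0 * (\<sigma>\<^sub>1 * exp (a * s) + \<sigma>\<^sub>2 * r * P s) + \<sigma>\<^sub>2 * y\<^sub>0 * (exp (a * s) - (r + a) * P s)\<bar> \<le>
        \<bar>\<sigma>\<^sub>0\<bar> + m * (\<bar>\<sigma>\<^sub>1\<bar> + \<bar>\<sigma>\<^sub>2\<bar> * r * C) + \<bar>\<sigma>\<^sub>2\<bar> * m * (1 + \<bar>r + a\<bar> * C)"
      using 1 2 by linarith
    then show ?thesis
      unfolding D_def by (intro abs_le_square_iff[THEN iffD1] order_trans[OF _ abs_ge_self])
  qed
  have x_meas: "x s \<in> borel_measurable M" if "0 \<le> s" for s
    by (rule measurable_F_M[of _ s]) (use sol that in \<open>auto simp: is_solution_def\<close>)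
  have H_meas: "H s \<in> borel_measurable (F s)" if "0 \<le> s" for s
  proof -
    obtain I where "has_ito_integral M F W H s I"
      using sol \<open>0 \<le> s\<close> unfolding is_solution_def H_def by blast
    then show ?thesis
      using that by (intro progressively_measurable_at[of s]) (auto simp: has_ito_integral_def)
  qed
  have A_sets: "truncation_event M H N u \<in> sets M" if "0 \<le> u" for N u
    using truncation_event_sets[of u H N] H_meas that subalgebra_F[of u] by (auto simp: subalgebra_def)
  have bound: "(\<integral>\<^sup>+\<omega>\<in>truncation_event M H (real N) t. ennreal ((x t \<omega>)\<^sup>2) \<partial>M) \<le>
      ennreal (m\<^sup>2 + D / (1 - \<kappa>) * kernel_energy a r 1 0)" for N :: nat
  proof -
    define A where "A = truncation_event M H (real N)"
    define h where "h u = expectation (\<lambda>\<omega>. indicator (A u) \<omega> * (H u \<omega>)\<^sup>2)" for u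
    define S where "S = (SUP u\<in>{0..}. h u)"
    have A_M: "A u \<in> sets M" if "0 \<le> u" for u
      unfolding A_def by (rule A_sets[OF that])
    have bdd: "indicator (A u) \<omega> * (H u \<omega>)\<^sup>2 \<le> (real N)\<^sup>2" for u \<omega>
      using truncation_event_bound[of \<omega> M H "real N" u] abs_le_square_iff[of "H u \<omega>" "real N"]
      by (auto simp: A_def indicator_def)
    have h_int: "integrable M (\<lambda>\<omega>. indicator (A u) \<omega> * (H u \<omega>)\<^sup>2)" if "0 \<le> u" for u
    proof (rule integrable_bounded[of _ "(real N)\<^sup>2"])
      show "(\<lambda>\<omega>. indicator (A u) \<omega> * (H u \<omega>)\<^sup>2) \<in> borel_measurable M"
        using A_M[OF that] measurable_F_M[OF H_meas[OF that]] by measurable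
    qed (use bdd in auto)
    have h_nn: "(\<integral>\<^sup>+\<omega>\<in>A u. ennreal ((H u \<omega>)\<^sup>2) \<partial>M) = ennreal (h u)" if "0 \<le> u" for u
    proof -
      have "(\<integral>\<^sup>+\<omega>\<in>A u. ennreal ((H u \<omega>)\<^sup>2) \<partial>M) = (\<integral>\<^sup>+\<omega>. ennreal (indicator (A u) \<omega> * (H u \<omega>)\<^sup>2) \<partial>M)"
        by (intro nn_integral_cong) (simp add: indicator_def)
      also have "\<dots> = ennreal (h u)"
        unfolding h_def by (rule nn_integral_eq_integral[OF h_int[OF that]]) simp
      finally show ?thesis .
    qed
    have h0: "0 \<le> h u" for u
      unfolding h_def by (intro integral_nonneg_AE) auto
    have h_le: "h u \<le> (real N)\<^sup>2" if "0 \<le> u" for u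
      unfolding h_def using bdd h_int[OF that] by (intro integral_le_const) auto
    then have bddS: "bdd_above (h ` {0..})"
      by (intro bdd_aboveI[of _ "(real N)\<^sup>2"]) auto
    have hS: "h u \<le> S" if "0 \<le> u" for u
      unfolding S_def using that bddS by (intro cSUP_upper) auto
    have S0: "0 \<le> S"
      using h0[of 0] hS[of 0] by simp
    have key: "h u \<le> D + S * \<kappa>" if u: "0 \<le> u" for u
    proof -
      have "(\<integral>\<^sup>+\<omega>\<in>A u. ennreal ((H u \<omega>)\<^sup>2) \<partial>M) \<le> ennreal (D + S * \<kappa>)"
      \<comment> \<open>\<open>truncated_second_moment_bound\<close> concerns positive times; at
        time \<open>0\<close> the value of \<open>H\<close> is almost surely its deterministic part,
        which \<open>d_le\<close> covers.\<close>
      proof (cases "u = 0")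
        case True
        have "(\<integral>\<^sup>+\<omega>\<in>A u. ennreal ((H u \<omega>)\<^sup>2) \<partial>M) \<le> (\<integral>\<^sup>+\<omega>. ennreal D \<partial>M)"
        proof (rule nn_integral_mono_AE)
          show "AE \<omega> in M. ennreal ((H u \<omega>)\<^sup>2) * indicator (A u) \<omega> \<le> ennreal D"
            using solution_paths[OF sol K]
          proof eventually_elim
            case (elim \<omega>)
            then have "H u \<omega> = \<sigma>\<^sub>0 + \<phi> 0 * (\<sigma>\<^sub>1 * exp (a * 0) + \<sigma>\<^sub>2 * r * P 0) + \<sigma>\<^sub>2 * y\<^sub>0 * (exp (a * 0) - (r + a) * P 0)"
              by (simp add: True H_def diffusion_def y\<^sub>0_def P0)
            then have "(H u \<omega>)\<^sup>2 \<le> D"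
              using d_le[of 0] by simp
            then show ?case
              by (auto simp: indicator_def intro: ennreal_leI)
          qed
        qed
        also have "\<dots> = ennreal D" by (simp add: emeasure_space_1)
        also have "\<dots> \<le> ennreal (D + S * \<kappa>)"
          using S0 \<kappa>0 by (intro ennreal_leI) simp
        finally show ?thesis .
      next
        case False
        have "(\<integral>\<^sup>+\<omega>\<in>A u. ennreal ((\<sigma>\<^sub>0 + \<sigma>\<^sub>1 * x u \<omega> + \<sigma>\<^sub>2 * delay_term K x u \<omega>)\<^sup>2) \<partial>M) \<le>
            ennreal ((\<sigma>\<^sub>0 + \<phi> 0 * (\<sigma>\<^sub>1 * exp (a * u) + \<sigma>\<^sub>2 * r * P u) + \<sigma>\<^sub>2 * y\<^sub>0 * (exp (a * u) - (r + a) * P u))\<^sup>2 + S * \<kappa>)"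
          unfolding A_def H_def y\<^sub>0_def \<kappa>_def
          by (rule truncated_second_moment_bound[OF sol K a r P0 P]) (use False u hS S0 in \<open>auto simp: h_def A_def H_def\<close>)
        also have "\<dots> \<le> ennreal (D + S * \<kappa>)"
          using d_le[OF u] by (intro ennreal_leI) simp
        finally show ?thesis
          by (simp add: H_def diffusion_def)
      qed
      then show ?thesis
        unfolding h_nn[OF u] using S0 \<kappa>0 by (subst (asm) ennreal_le_iff) (auto simp: D_def)
    qed
    \<comment> \<open>\<open>S\<close> is finite because the truncated moments are at most
      \<open>(real N)\<^sup>2\<close>, so the inequality can be solved for it. The resulting bound
      no longer contains \<open>N\<close>.\<close>
    have "S \<le> D + S * \<kappa>"
      unfolding S_def using key by (intro cSUP_least) (auto simp: S_def)
    then have S_le: "S \<le> D / (1 - \<kappa>)"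
      using \<kappa> by (simp add: \<kappa>_def pos_le_divide_eq algebra_simps)
    show ?thesis
    proof (cases "t = 0")
      case True
      have "(\<integral>\<^sup>+\<omega>\<in>truncation_event M H (real N) t. ennreal ((x t \<omega>)\<^sup>2) \<partial>M) \<le> (\<integral>\<^sup>+\<omega>. ennreal (m\<^sup>2) \<partial>M)"
      proof (rule nn_integral_mono_AE)
        show "AE \<omega> in M. ennreal ((x t \<omega>)\<^sup>2) * indicator (truncation_event M H (real N) t) \<omega> \<le> ennreal (m\<^sup>2)"
          using solution_paths[OF sol K]
        proof eventually_elim
          case (elim \<omega>)
          then have "(x t \<omega>)\<^sup>2 \<le> m\<^sup>2"
            using \<phi>[of 0] m0 by (simp add: True abs_le_square_iff[symmetric])
          then show ?case
            by (auto simp: indicator_def intro: ennreal_leI)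
        qed
      qed
      also have "\<dots> = ennreal (m\<^sup>2)" by (simp add: emeasure_space_1)
      also have "\<dots> \<le> ennreal (m\<^sup>2 + D / (1 - \<kappa>) * kernel_energy a r 1 0)"
        using \<kappa> \<kappa>0 by (intro ennreal_leI) (simp add: \<kappa>_def D_def)
      finally show ?thesis .
    next
      case False
      have "(\<integral>\<^sup>+\<omega>\<in>A t. ennreal ((0 + 1 * x t \<omega> + 0 * delay_term K x t \<omega>)\<^sup>2) \<partial>M) \<le>
          ennreal ((0 + \<phi> 0 * (1 * exp (a * t) + 0 * r * P t) + 0 * y\<^sub>0 * (exp (a * t) - (r + a) * P t))\<^sup>2 + S * kernel_energy a r 1 0)"
        unfolding A_def H_def y\<^sub>0_def
        by (rule truncated_second_moment_bound[OF sol K a r P0 P]) (use False t hS S0 in \<open>auto simp: h_def A_def H_def\<close>)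
      also have "\<dots> \<le> ennreal (m\<^sup>2 + D / (1 - \<kappa>) * kernel_energy a r 1 0)"
      proof (intro ennreal_leI add_mono mult_right_mono S_le \<kappa>0)
        have "\<bar>\<phi> 0 * exp (a * t)\<bar> \<le> m * 1"
          unfolding abs_mult using \<phi>[of 0] E1[OF t] m0 by (intro mult_mono) auto
        then show "(0 + \<phi> 0 * (1 * exp (a * t) + 0 * r * P t) + 0 * y\<^sub>0 * (exp (a * t) - (r + a) * P t))\<^sup>2 \<le> m\<^sup>2"
          using m0 by (simp add: abs_le_square_iff[symmetric])
      qed
      finally show ?thesis
        by (simp add: A_def)
    qed
  qed
  \<comment> \<open>Almost every path of \<open>H\<close> is continuous, hence bounded on
    \<open>[0, t]\<close>, so the indicators are eventually \<open>1\<close> and Fatou's lemma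
    removes them.\<close>
  have "(\<integral>\<^sup>+\<omega>. ennreal ((x t \<omega>)\<^sup>2) \<partial>M) \<le> ennreal (m\<^sup>2 + D / (1 - \<kappa>) * kernel_energy a r 1 0)"
  proof (rule nn_integral_le_of_AE_tendsto[OF _ _ bound tendsto_const])
    show "(\<lambda>\<omega>. ennreal ((x t \<omega>)\<^sup>2) * indicator (truncation_event M H (real N) t) \<omega>) \<in> borel_measurable M" for N
      using x_meas[OF t] A_sets[OF t] by measurable
    show "AE \<omega> in M. (\<lambda>N. ennreal ((x t \<omega>)\<^sup>2) * indicator (truncation_event M H (real N) t) \<omega>) \<longlonglongrightarrow> ennreal ((x t \<omega>)\<^sup>2)"
      using solution_diffusion_continuous[OF sol K] AE_space
    proof eventually_elim
      case (elim \<omega>)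
      have "\<forall>\<^sub>F N in sequentially. \<omega> \<in> truncation_event M H (real N) t"
        using elim t by (intro truncation_event_eventually) (auto simp: H_def)
      then show ?case
        by (intro tendsto_eventually) (auto elim: eventually_mono)
    qed
  qed
  then show ?thesis
    unfolding \<kappa>_def by (rule second_moment_le[where x = x and t = t, OF x_meas[OF t]])
qed

end

lemma BC_norm_bound:
  assumes "\<phi> \<in> BC" "s \<le> 0"
  shows "\<bar>\<phi> s\<bar> \<le> BC_norm \<phi>"
proof -
  have "bdd_above ((\<lambda>\<theta>. \<bar>\<phi> \<theta>\<bar>) ` {..0})"
    using assms(1) by (auto simp: BC_def bounded_iff bdd_above_def)
  then show ?thesis
    unfolding BC_norm_def using assms(2) by (intro cSUP_upper) auto
qed

theorem theorem4p1:
  fixes M :: "'w measure" and F :: "real \<Rightarrow> 'w measure" and W :: "real \<Rightarrow> 'w \<Rightarrow> real"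
    and a b \<sigma>\<^sub>0 \<sigma>\<^sub>1 \<sigma>\<^sub>2 r a\<^sub>1 a\<^sub>2 a\<^sub>3 :: real and K :: "real \<Rightarrow> real"
  assumes "wiener_process M F W"
    and "b = 0"
    and "r > 0"
    and "\<And>s. s \<ge> 0 \<Longrightarrow> K s = r * exp (- r * s)"
    and "a\<^sub>1 = 3 * (r - a) - \<sigma>\<^sub>1\<^sup>2"
    and "a\<^sub>2 = 2 * r * (r - a) - (2 * a + \<sigma>\<^sub>1\<^sup>2) * (3 * r - a) - 2 * r * \<sigma>\<^sub>1 * \<sigma>\<^sub>2"
    and "a\<^sub>3 = - 2 * a * r * (2 * (r - a) - \<sigma>\<^sub>1\<^sup>2) - 2 * r\<^sup>2 * (\<sigma>\<^sub>1 + \<sigma>\<^sub>2)\<^sup>2"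
    and "a < 0"
    and "a\<^sub>1 > 0" and "a\<^sub>3 > 0" and "a\<^sub>1 * a\<^sub>2 - a\<^sub>3 > 0"
  shows "second_moment_bounded M F W a b \<sigma>\<^sub>0 \<sigma>\<^sub>1 \<sigma>\<^sub>2 K"
proof -
  interpret wiener_process M F W by fact
  obtain P C where P0: "P 0 = 0" and P: "\<And>t. (P has_real_derivative exp (a * t) - r * P t) (at t)"
    and C: "\<And>t. 0 \<le> t \<Longrightarrow> \<bar>P t\<bar> \<le> C"
    using resolvent_kernel_exists[OF \<open>a < 0\<close> \<open>r > 0\<close>] by blast
  let ?\<kappa> = "kernel_energy a r \<sigma>\<^sub>1 \<sigma>\<^sub>2"
  have ra: "0 < r - a" using assms by linarith
  have K: "\<forall>s\<ge>0. K s = r * exp (- r * s)" using assms(4) by blast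
  \<comment> \<open>Multiplying the energy by \<open>(r - a) * (- 2 * a)\<close> clears its
    denominators and gives \<open>(r - a) * (- 2 * a) - a\<^sub>3 / (2 * r)\<close>.\<close>
  have "a\<^sub>3 = 2 * r * ((r - a) * (- 2 * a) * (1 - ?\<kappa>))"
  proof -
    define z where "z = r * (2 * \<sigma>\<^sub>1 * \<sigma>\<^sub>2 + \<sigma>\<^sub>2\<^sup>2)"
    have "(- 2 * a) * ?\<kappa> = \<sigma>\<^sub>1\<^sup>2 + z / (r - a)"
      using \<open>a < 0\<close> by (simp add: kernel_energy_def z_def)
    then have eq: "(r - a) * ((- 2 * a) * ?\<kappa>) = (r - a) * \<sigma>\<^sub>1\<^sup>2 + z"
      using ra by (simp add: distrib_left)
    have "2 * r * ((r - a) * (- 2 * a) * (1 - ?\<kappa>)) = 2 * r * ((r - a) * (- 2 * a) - (r - a) * ((- 2 * a) * ?\<kappa>))"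
      by (simp add: algebra_simps)
    then show ?thesis
      unfolding eq assms(7) z_def by (simp add: power2_eq_square algebra_simps)
  qed
  moreover have "0 < 2 * r * ((r - a) * (- 2 * a))"
  proof -
    have "0 < - 2 * a" using \<open>a < 0\<close> by simp
    then show ?thesis
      by (rule mult_pos_pos[OF mult_pos_pos[OF zero_less_numeral \<open>r > 0\<close>] mult_pos_pos[OF ra]])
  qed
  ultimately have \<kappa>: "?\<kappa> < 1"
    using \<open>a\<^sub>3 > 0\<close> mult_nonneg_nonpos[of "2 * r * ((r - a) * (- 2 * a))" "1 - ?\<kappa>"]
    by (simp only: mult.assoc[symmetric]) linarith
  \<comment> \<open>The bound must be a function of the squared norm that is positive at every real
    argument: \<open>sqrt u\<close> recovers the norm, and \<open>1\<close> plus an absolute value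
    secures the sign.\<close>
  define R where "R u = 1 + \<bar>(sqrt u)\<^sup>2 + (\<bar>\<sigma>\<^sub>0\<bar> + sqrt u * (\<bar>\<sigma>\<^sub>1\<bar> + \<bar>\<sigma>\<^sub>2\<bar> * r * C) +
      \<bar>\<sigma>\<^sub>2\<bar> * sqrt u * (1 + \<bar>r + a\<bar> * C))\<^sup>2 / (1 - ?\<kappa>) * kernel_energy a r 1 0\<bar>" for u
  show ?thesis
    unfolding second_moment_bounded_def
  proof (intro exI[of _ R] conjI allI ballI impI)
    show "0 < R u" for u
      unfolding R_def by linarith
    fix \<phi> x t
    assume \<phi>: "\<phi> \<in> BC" and sol: "is_solution M F W a b \<sigma>\<^sub>0 \<sigma>\<^sub>1 \<sigma>\<^sub>2 K \<phi> x" and t: "(0::real) \<le> t"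
    have "0 \<le> BC_norm \<phi>"
      using BC_norm_bound[OF \<phi>, of 0] by simp
    then have sqrt: "sqrt ((BC_norm \<phi>)\<^sup>2) = BC_norm \<phi>" by simp
    have le: "v \<le> 1 + \<bar>v\<bar>" for v :: real by linarith
    have "second_moment M x t \<le> ennreal ((BC_norm \<phi>)\<^sup>2 + (\<bar>\<sigma>\<^sub>0\<bar> + BC_norm \<phi> * (\<bar>\<sigma>\<^sub>1\<bar> + \<bar>\<sigma>\<^sub>2\<bar> * r * C) +
        \<bar>\<sigma>\<^sub>2\<bar> * BC_norm \<phi> * (1 + \<bar>r + a\<bar> * C))\<^sup>2 / (1 - ?\<kappa>) * kernel_energy a r 1 0)"
      using sol unfolding \<open>b = 0\<close>
      by (rule solution_second_moment_bound[OF _ K \<open>a < 0\<close> \<open>r > 0\<close> P0 P C BC_norm_bound[OF \<phi>] \<kappa> t])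
    from order_trans[OF this ennreal_leI[OF le]]
    show "second_moment M x t \<le> ennreal (R ((BC_norm \<phi>)\<^sup>2))"
      unfolding R_def sqrt .
  qed
qed

end
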